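(* Let $(\alpha,p)\in\Pi_2$. Let $F:\mathbb{T}\to\mathbb{C}$ be absolutely continuous on $\mathbb{T}$ with $\dot F\in\mathcal{L}^p(\mathbb{T})$, and let $f=\mathcal{K}_\alpha[F]$ in $\mathbb{D}$. Then all the partial derivatives $\partial_rf$, $\partial_zf$ and $\partial_{\overline z}f$ belong to $\mathcal{B}^p_{\mathcal{G}}(\mathbb{D})$.
   Context: $\mathbb{D}=\{z\in\mathbb{C}:|z|<1\}$, $\mathbb{T}=\partial\mathbb{D}$. Parameter set: $\Pi_2=\{(\alpha,p):-1<\alpha<0,\ 1\le p<-\frac1\alpha\}\cup\{(0,1)\}$. Poisson type integral: for $\alpha>-1$ and $F\in\mathcal{L}^1(\mathbb{T})$, $$\mathcal{K}_{\alpha}[F](z)=\frac{1}{2\pi}\int_{0}^{2\pi}\mathcal{K}_{\alpha}(ze^{-it})F(e^{it})\,dt,\quad \mathcal{K}_{\alpha}(z)=\mathcal{C}_{\alpha}\frac{(1-|z|^2)^{\alpha+1}}{|1-z|^{\alpha+2}},\quad \mathcal{C}_{\alpha}=\frac{\Gamma^2(1+\frac{\alpha}{2})}{\Gamma(1+\alpha)},\quad z\in\mathbb{D}.$$ Absolute continuity of $F$ on $\mathbb{T}$ refers to $\theta\mapsto F(e^{i\theta})$ on $[0,2\pi]$, and $\dot F(e^{i\theta})=\frac{d}{d\theta}F(e^{i\theta})$, which exists a.e. $\mathcal{L}^p(\mathbb{T})$ is the usual Lebesgue space on $\mathbb{T}$. Derivatives: $\partial_z=\frac12(\partial_x-i\partial_y)$,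 $\partial_{\overline z}=\frac12(\partial_x+i\partial_y)$, and for $z=re^{i\theta}$, $\partial_r f(z)=\partial_zf(z)e^{i\theta}+\partial_{\overline z}f(z)e^{-i\theta}$. Bergman type space: for $p<\infty$, $\mathcal{B}^p_{\mathcal{G}}(\mathbb{D})$ consists of all measurable complex-valued $g$ on $\mathbb{D}$ with $\int_{\mathbb{D}}|g(z)|^p\,d\sigma(z)<\infty$, where $d\sigma=dx\,dy/\pi$. *)

theory Defs
  imports "HOL-Analysis.Analysis"
begin

definition Pi2 :: "(real \<times> real) set" where
  "Pi2 = {(\<alpha>, p). -1 < \<alpha> \<and> \<alpha> < 0 \<and> 1 \<le> p \<and> p < - 1 / \<alpha>} \<union> {(0, 1)}"

section \<open>Functions on the unit circle\<close>

text \<open>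
  A function on the unit circle is a total function on the complex numbers of which only the
  values at the points \<open>cis t\<close> matter.
\<close>

definition absolutely_continuous_fun :: "real \<Rightarrow> real \<Rightarrow> (real \<Rightarrow> complex) \<Rightarrow> bool" where
  "absolutely_continuous_fun l u g \<longleftrightarrow>
     (\<forall>\<epsilon>>0. \<exists>\<delta>>0. \<forall>(n::nat) a b.
        (\<forall>i<n. l \<le> a i \<and> a i \<le> b i \<and> b i \<le> u) \<longrightarrow>
        disjoint_family_on (\<lambda>i. {a i<..<b i}) {..<n} \<longrightarrow>
        (\<Sum>i<n. b i - a i) < \<delta> \<longrightarrow>
        (\<Sum>i<n. norm (g (b i) - g (a i))) < \<epsilon>)"

definition absolutely_continuous_circle :: "(complex \<Rightarrow> complex) \<Rightarrow> bool" where
  "absolutely_continuous_circle F \<longleftrightarrow> absolutely_continuous_fun 0 (2 * pi) (\<lambda>\<theta>. F (cis \<theta>))"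

text \<open>
  The angular derivative as a function of the point on the circle; by periodicity the choice
  of the argument is irrelevant, see \<open>circle_deriv_cis\<close>. Where the derivative does not exist,
  the value is arbitrary.
\<close>

definition circle_deriv :: "(complex \<Rightarrow> complex) \<Rightarrow> complex \<Rightarrow> complex" where
  "circle_deriv F \<zeta> = vector_derivative (\<lambda>\<theta>. F (cis \<theta>)) (at (Arg \<zeta>))"

lemma circle_deriv_cis:
  "circle_deriv F (cis \<theta>) = vector_derivative (\<lambda>t. F (cis t)) (at \<theta>)"
proof -
  let ?g = "\<lambda>t. F (cis t)"
  have shift: "(?g has_vector_derivative D) (at (x + c))"
    if D: "(?g has_vector_derivative D) (at x)" and c: "cis c = 1" for D x c
  proof -
    have "((\<lambda>t. t - c) has_vector_derivative 1) (at (x + c))"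
      by (auto intro!: derivative_eq_intros)
    moreover have "(?g has_vector_derivative D) (at ((x + c) - c))"
      using D by simp
    ultimately have "(?g \<circ> (\<lambda>t. t - c) has_vector_derivative 1 *\<^sub>R D) (at (x + c))"
      by (rule vector_diff_chain_at)
    moreover have "?g \<circ> (\<lambda>t. t - c) = ?g"
      using c by (auto simp: fun_eq_iff cis_divide [symmetric])
    ultimately show ?thesis by simp
  qed
  define c where "c = Arg (cis \<theta>) - \<theta>"
  have c: "cis c = 1"
    by (simp add: c_def cis_divide [symmetric] cis_Arg sgn_div_norm)
  hence c': "cis (- c) = 1"
    by (simp add: cis_cnj [symmetric])
  have A: "Arg (cis \<theta>) = \<theta> + c" by (simp add: c_def)
  have "(?g has_vector_derivative D) (at (\<theta> + c)) \<longleftrightarrow> (?g has_vector_derivative D) (at \<theta>)" for D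
    using shift [of D \<theta> c] shift [of D "\<theta> + c" "- c"] c c' by auto
  thus ?thesis
    by (simp add: circle_deriv_def A vector_derivative_def)
qed

definition Lp_circle :: "real \<Rightarrow> (complex \<Rightarrow> complex) set" where
  "Lp_circle p = {G. (\<lambda>t. G (cis t)) \<in> borel_measurable (lebesgue_on {0..2 * pi}) \<and>
     (\<integral>\<^sup>+ t. ennreal (norm (G (cis t)) powr p) \<partial>lebesgue_on {0..2 * pi}) < \<infinity>}"

section \<open>The Poisson type integral\<close>

definition C_const :: "real \<Rightarrow> real" where
  "C_const \<alpha> = (Gamma (1 + \<alpha> / 2))\<^sup>2 / Gamma (1 + \<alpha>)"

definition K_kernel :: "real \<Rightarrow> complex \<Rightarrow> real" where
  "K_kernel \<alpha> z =
     C_const \<alpha> * ((1 - (norm z)\<^sup>2) powr (\<alpha> + 1) / norm (1 - z) powr (\<alpha> + 2))"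

definition K_integral :: "real \<Rightarrow> (complex \<Rightarrow> complex) \<Rightarrow> complex \<Rightarrow> complex" where
  "K_integral \<alpha> F z = complex_of_real (1 / (2 * pi)) *
     integral\<^sup>L (lebesgue_on {0..2 * pi})
       (\<lambda>t. complex_of_real (K_kernel \<alpha> (z * cis (- t))) * F (cis t))"

section \<open>Partial derivatives\<close>

definition has_partials_at :: "(complex \<Rightarrow> complex) \<Rightarrow> complex \<Rightarrow> bool" where
  "has_partials_at f z \<longleftrightarrow>
     (\<lambda>x. f (Complex x (Im z))) differentiable (at (Re z)) \<and>
     (\<lambda>y. f (Complex (Re z) y)) differentiable (at (Im z))"

definition partial_x :: "(complex \<Rightarrow> complex) \<Rightarrow> complex \<Rightarrow> complex" where
  "partial_x f z = vector_derivative (\<lambda>x. f (Complex x (Im z))) (at (Re z))"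

definition partial_y :: "(complex \<Rightarrow> complex) \<Rightarrow> complex \<Rightarrow> complex" where
  "partial_y f z = vector_derivative (\<lambda>y. f (Complex (Re z) y)) (at (Im z))"

definition partial_z :: "(complex \<Rightarrow> complex) \<Rightarrow> complex \<Rightarrow> complex" where
  "partial_z f z = (partial_x f z - \<i> * partial_y f z) / 2"

definition partial_zbar :: "(complex \<Rightarrow> complex) \<Rightarrow> complex \<Rightarrow> complex" where
  "partial_zbar f z = (partial_x f z + \<i> * partial_y f z) / 2"

text \<open>At the origin, where the angle is undetermined, \<open>Arg 0 = 0\<close> selects the angle 0.\<close>

definition partial_r :: "(complex \<Rightarrow> complex) \<Rightarrow> complex \<Rightarrow> complex" where
  "partial_r f z = partial_z f z * cis (Arg z) + partial_zbar f z * cis (- Arg z)"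

section \<open>The Bergman type space\<close>

definition disc_measure :: "complex measure" where
  "disc_measure = scale_measure (ennreal (1 / pi)) (lebesgue_on (ball 0 1))"

definition Bergman_G :: "real \<Rightarrow> (complex \<Rightarrow> complex) set" where
  "Bergman_G p = {g. g \<in> borel_measurable disc_measure \<and>
     (\<integral>\<^sup>+ z. ennreal (norm (g z) powr p) \<partial>disc_measure) < \<infinity>}"

end

theory Submission
  imports Defs
begin

text \<open>
  Write \<open>\<zeta> = cis t\<close>, \<open>\<delta> = 1 - |z|\<^sup>2\<close> and \<open>k = \<delta> powr (\<alpha> + 1) * |\<zeta> - z| powr - (\<alpha> + 2)\<close> for the kernel
  without its constant. Its derivative in a direction \<open>u\<close> of the \<open>z\<close>-plane has size
  \<open>\<delta> powr \<alpha> * |\<zeta> - z| powr - (\<alpha> + 2)\<close>, whose circle mean is of order \<open>1 / \<delta>\<close>: this is too large. The proof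
  rests on an identity that trades one power of \<open>|\<zeta> - z|\<close> for a derivative along the circle, namely
  \<open>\<partial>\<^sub>u k = \<partial>\<^sub>t H\<^sub>u + R\<^sub>u\<close> with \<open>H\<^sub>u = - 2 * Im (u * cnj (\<zeta> - z)) * \<gamma>\<close>, \<open>R\<^sub>u = \<alpha> * ((\<zeta> - z) \<bullet> u) * \<gamma>\<close> and
  \<open>\<gamma> = \<delta> powr \<alpha> * |\<zeta> - z| powr - (\<alpha> + 2)\<close> (\<open>has_derivative_kernel_potential\<close>). For \<open>\<alpha> = 0\<close> the kernel is
  the real part of \<open>(\<zeta> + z) / (\<zeta> - z)\<close>; the \<open>z\<close>-derivative \<open>2 \<zeta> / (\<zeta> - z)\<^sup>2\<close> of this quotient is the
  \<open>t\<close>-derivative of \<open>2 \<i> / (\<zeta> - z)\<close>, which gives \<open>H\<^sub>u\<close> and no remainder. In general \<open>k\<close> is the Poisson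
  kernel times a power of \<open>\<delta>\<^sup>2 / |\<zeta> - z|\<^sup>2\<close>, and differentiating that power leaves exactly \<open>R\<^sub>u\<close>.

  Integrating by parts, \<open>\<partial>\<^sub>u f\<close> is up to a constant the integral of \<open>R\<^sub>u F - H\<^sub>u F'\<close>, where \<open>F'\<close> is the
  derivative of \<open>t \<mapsto> F (cis t)\<close>. For a unit vector \<open>u\<close> both \<open>H\<^sub>u\<close> and \<open>R\<^sub>u\<close> are at most a constant times
  \<open>\<delta> powr \<beta> * |\<zeta> - z| powr - (\<beta> + 1)\<close> for every \<open>\<beta>\<close> in \<open>[\<alpha> - 1, \<alpha>]\<close>, because \<open>\<delta> \<le> 2 |\<zeta> - z|\<close>. The
  hypothesis on \<open>(\<alpha>, p)\<close> leaves room for some such \<open>\<beta>\<close> with \<open>-1 < \<beta> < 0\<close> and \<open>\<beta> p > -1\<close>: take \<open>\<beta> = \<alpha>\<close> when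
  \<open>\<alpha> < 0\<close>, and \<open>\<beta> = -1/2\<close> when \<open>\<alpha> = 0\<close>, where \<open>p = 1\<close>. Then \<open>|\<zeta> - z| powr - (\<beta> + 1)\<close> is integrable
  over the circle uniformly in \<open>z\<close>, so by convexity \<open>|\<partial>\<^sub>u f| powr p\<close> is dominated by \<open>\<delta> powr (\<beta> p)\<close> times
  1 plus the integral of \<open>(|F'| + const) powr p\<close> against that kernel (\<open>norm_kernel_deriv_integral_le\<close>,
  \<open>weighted_power_mean\<close>). Tonelli and the rotation invariance of area reduce the integral over the
  disc to that of \<open>\<delta> powr (\<beta> p)\<close>, which converges since \<open>\<beta> p > -1\<close> (\<open>disc_kernel_bounded\<close>,
  \<open>disc_Lp_finite\<close>).

  The integration by parts needs the fundamental theorem of calculus for absolutely continuous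
  functions (\<open>AC_on_FTC\<close>): such a function is differentiable almost everywhere and is the
  integral of its derivative. It is obtained by writing a real absolutely continuous function as a
  difference of increasing ones by means of its variation, taking Radon--Nikodym densities of the
  associated Stieltjes measures, and differentiating the resulting indefinite integrals with the
  Lebesgue differentiation theorem on the line, which follows from Vitali's covering theorem.
\<close>

section \<open>Lebesgue differentiation on the line\<close>

lemma set_integrable_Icc:
  fixes f :: "real \<Rightarrow> 'a::{banach, second_countable_topology}"
  assumes "integrable lborel f"
  shows "set_integrable lborel {y..z} f"
  unfolding set_integrable_def by (intro integrable_mult_indicator assms) auto

text \<open>
  The core of the differentiation theorem. The finite measure with density the positive part of
  \<open>v\<close> does not charge \<open>{v \<le> 0}\<close>, so some open \<open>U\<close> around that set has arbitrarily small mass. By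
  Vitali, up to a null set \<open>S\<close> is covered by disjoint intervals inside \<open>U\<close> on which the average
  of \<open>v\<close> is at least \<open>c\<close>, so their total length is at most the mass of \<open>U\<close> divided by \<open>c\<close>. As
  the intervals need not be centred at the points that they cover, one-sided difference quotients
  are included.
\<close>

lemma negligible_large_averages:
  fixes v :: "real \<Rightarrow> real"
  assumes v: "integrable lborel v" and "c > 0"
    and le: "\<And>x. x \<in> S \<Longrightarrow> v x \<le> 0"
    and big: "\<And>x d. x \<in> S \<Longrightarrow> d > 0 \<Longrightarrow>
      \<exists>y z. y \<le> x \<and> x \<le> z \<and> y < z \<and> z - y < d \<and> c * (z - y) \<le> (LINT t:{y..z}|lborel. v t)"
  shows "negligible S"
  unfolding negligible_outer_le
proof (intro allI impI)
  fix e :: real assume "e > 0"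
  have [measurable]: "v \<in> borel_measurable borel" using v by auto
  \<comment> \<open>coercion to \<open>ennreal\<close> truncates, so this density is the positive part of \<open>v\<close>\<close>
  define \<nu> where "\<nu> = density lborel (\<lambda>x. ennreal (v x))"
  have sets_\<nu>: "sets \<nu> = sets borel" by (simp add: \<nu>_def)
  have fin: "emeasure \<nu> (space \<nu>) \<noteq> \<infinity>"
    using integrableD(2)[OF v] by (simp add: \<nu>_def emeasure_density cong: nn_integral_cong)
  define E where "E = {x. v x \<le> 0}"
  have [measurable]: "E \<in> sets borel" unfolding E_def by measurable
  have "(\<integral>\<^sup>+x. ennreal (v x) * indicator E x \<partial>lborel) = (\<integral>\<^sup>+x. 0 \<partial>(lborel :: real measure))"
    by (intro nn_integral_cong) (auto simp: E_def ennreal_neg split: split_indicator)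
  hence "emeasure \<nu> E = 0" by (simp add: \<nu>_def emeasure_density)
  moreover have "emeasure \<nu> E = (INF U\<in>{U. E \<subseteq> U \<and> open U}. emeasure \<nu> U)"
    using sets_\<nu> fin by (intro outer_regular) simp_all
  ultimately have "(INF U\<in>{U. E \<subseteq> U \<and> open U}. emeasure \<nu> U) < ennreal (c * e)"
    using \<open>c > 0\<close> \<open>e > 0\<close> by simp
  then obtain U where U: "E \<subseteq> U" "open U" "emeasure \<nu> U < ennreal (c * e)"
    unfolding INF_less_iff by auto
  define K where "K = {(y, z). y < z \<and> {y..z} \<subseteq> U \<and> c * (z - y) \<le> (LINT t:{y..z}|lborel. v t)}"
  define a r where "a = (\<lambda>(y::real, z). (y + z) / 2)" and "r = (\<lambda>(y::real, z). (z - y) / 2)"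
  have cball: "cball (a i) (r i) = {fst i..snd i}" for i
    by (auto simp: a_def r_def cball_eq_atLeastAtMost field_simps split: prod.split)
  have "\<exists>i. i \<in> K \<and> x \<in> cball (a i) (r i) \<and> r i < d" if x: "x \<in> S" and "d > 0" for x d
  proof -
    have "x \<in> U" using le[OF x] U(1) by (auto simp: E_def)
    then obtain e' where e': "e' > 0" "ball x e' \<subseteq> U" using \<open>open U\<close> openE by blast
    obtain y z where yz: "y \<le> x" "x \<le> z" "y < z" "z - y < min d e'"
        "c * (z - y) \<le> (LINT t:{y..z}|lborel. v t)"
      using big[OF x, of "min d e'"] \<open>d > 0\<close> e'(1) by auto
    have "{y..z} \<subseteq> ball x e'" using yz unfolding subset_iff mem_ball dist_real_def atLeastAtMost_iff by arith
    hence "(y, z) \<in> K" using yz e' unfolding K_def by blast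
    thus ?thesis using yz unfolding cball
      by (intro exI[of _ "(y, z)"]) (simp add: r_def)
  qed
  note fine = this
  have r_pos: "0 < r i" if "i \<in> K" for i
    using that by (auto simp: K_def r_def)
  obtain C where C: "countable C" "C \<subseteq> K"
     "pairwise (\<lambda>i j. disjnt (cball (a i) (r i)) (cball (a j) (r j))) C"
     "negligible (S - (\<Union>i \<in> C. cball (a i) (r i)))"
    by (rule Vitali_covering_theorem_cballs[of K r S a, OF r_pos fine])
  define B where "B = (\<Union>i\<in>C. {fst i..snd i})"
  have [measurable]: "B \<in> sets borel"
    unfolding B_def using C(1) by (intro sets.countable_UN') auto
  have dis: "disjoint_family_on (\<lambda>i. {fst i..snd i}) C"
    using C(3) by (auto simp: disjoint_family_on_def pairwise_def disjnt_def cball)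
  have "ennreal c * emeasure lborel B = (\<integral>\<^sup>+ i. ennreal c * emeasure lborel {fst i..snd i} \<partial>count_space C)"
    unfolding B_def using C(1) dis by (simp add: emeasure_UN_countable nn_integral_cmult)
  also have "\<dots> \<le> (\<integral>\<^sup>+ i. emeasure \<nu> {fst i..snd i} \<partial>count_space C)"
  proof (intro nn_integral_mono)
    fix i assume "i \<in> space (count_space C)"
    then obtain y z where i: "i = (y, z)" "y < z" "c * (z - y) \<le> (LINT t:{y..z}|lborel. v t)"
      using C(2) by (auto simp: K_def)
    have "(LINT t:{y..z}|lborel. v t) \<le> (LINT t:{y..z}|lborel. max 0 (v t))"
      using v by (intro set_integral_mono set_integrable_Icc) auto
    have "ennreal c * emeasure lborel {y..z} = ennreal (c * (z - y))"
      using i \<open>c > 0\<close> by (simp add: ennreal_mult)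
    also have "\<dots> \<le> ennreal (LINT t:{y..z}|lborel. max 0 (v t))"
      using i \<open>_ \<le> (LINT t:{y..z}|lborel. max 0 (v t))\<close> by (intro ennreal_leI) auto
    also have "\<dots> = (\<integral>\<^sup>+ t. ennreal (indicator {y..z} t * max 0 (v t)) \<partial>lborel)"
      unfolding set_lebesgue_integral_def real_scaleR_def using v
      by (intro nn_integral_eq_integral[symmetric])
         (auto intro: integrable_real_mult_indicator simp: mult.commute[of "indicator _ _"])
    also have "\<dots> = emeasure \<nu> {y..z}"
      unfolding \<nu>_def
      by (subst emeasure_density) (auto intro!: nn_integral_cong simp: max_def ennreal_neg split: split_indicator)
    finally show "ennreal c * emeasure lborel {fst i..snd i} \<le> emeasure \<nu> {fst i..snd i}"
      using i by simp
  qed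
  also have "\<dots> = emeasure \<nu> B"
    unfolding B_def using C(1) dis sets_\<nu> by (subst emeasure_UN_countable) auto
  also have "\<dots> \<le> emeasure \<nu> U"
  proof (rule emeasure_mono)
    show "B \<subseteq> U" using C(2) unfolding B_def K_def by fastforce
    show "U \<in> sets \<nu>" using \<open>open U\<close> sets_\<nu> by simp
  qed
  also note U(3)
  finally have "ennreal c * emeasure lborel B < ennreal c * ennreal e"
    using \<open>c > 0\<close> \<open>e > 0\<close> by (simp add: ennreal_mult)
  hence B: "emeasure lborel B < ennreal e"
    using \<open>c > 0\<close> by (metis linorder_not_less mult_left_mono zero_le)
  hence lmB: "B \<in> lmeasurable" using order_less_le_trans[OF B, of top]
    by (intro fmeasurableI) (auto simp: less_top)
  show "\<exists>T. S \<subseteq> T \<and> T \<in> lmeasurable \<and> measure lebesgue T \<le> e"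
  proof (intro exI[of _ "B \<union> (S - B)"] conjI)
    have N: "negligible (S - B)" using C(4) by (simp add: B_def cball)
    show "B \<union> (S - B) \<in> lmeasurable" using lmB negligible_imp_measurable[OF N] by (rule fmeasurable.Un)
    have "measure lebesgue (B \<union> (S - B)) = measure lebesgue B"
      using lmB N by (intro measure_Un_null_set) (auto simp: negligible_iff_null_sets fmeasurableD)
    also have "\<dots> \<le> e" using B \<open>e > 0\<close>
      by (simp add: measure_def enn2real_leI less_imp_le)
    finally show "measure lebesgue (B \<union> (S - B)) \<le> e" .
  qed auto
qed

text \<open>
  The points where the conclusion fails are exhausted by countably many sets of the kind treated
  above: \<open>a\<close> is a rational just above \<open>g x\<close>, \<open>c\<close> a rational excess, and the bound \<open>n\<close> makes
  \<open>g - a\<close> integrable.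
\<close>

lemma AE_averages_le:
  fixes g :: "real \<Rightarrow> real"
  assumes g: "integrable lborel g"
  shows "AE x in lborel. \<forall>e>0. \<exists>d>0. \<forall>y z. y \<le> x \<longrightarrow> x \<le> z \<longrightarrow> y < z \<longrightarrow> z - y < d \<longrightarrow>
     (LINT t:{y..z}|lborel. g t) \<le> (g x + e) * (z - y)"
proof -
  define S where "S = (\<lambda>(a, c, n::nat). {x \<in> {- real n<..<real n}. g x \<le> a \<and>
     (\<forall>d>0. \<exists>y z. y \<le> x \<and> x \<le> z \<and> y < z \<and> z - y < d \<and> (a + c) * (z - y) \<le> (LINT t:{y..z}|lborel. g t))})"
  have neg: "negligible (S (a, c, n))" if "c > 0" for a c n
  proof (rule negligible_large_averages)
    let ?v = "\<lambda>x. indicat_real {- real n<..<real n} x * (g x - a)"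
    have 1: "integrable lborel (\<lambda>x. indicat_real {- real n<..<real n} x * g x)"
      using integrable_mult_indicator[OF _ g, of "{- real n<..<real n}"] by simp
    have 2: "integrable lborel (\<lambda>x. indicat_real {- real n<..<real n} x * a)"
      by (intro integrable_mult_left integrable_real_indicator) auto
    show v: "integrable lborel ?v" using Bochner_Integration.integrable_diff[OF 1 2] by (simp add: algebra_simps)
    show "c > 0" by fact
    show "?v x \<le> 0" if "x \<in> S (a, c, n)" for x
      using that by (auto simp: S_def split: split_indicator)
    fix x d :: real assume x: "x \<in> S (a, c, n)" and d: "d > 0"
    define d' where "d' = min d (min (x + n) (n - x))"
    have "d' > 0" using x d by (auto simp: S_def d'_def)
    then obtain y z where yz: "y \<le> x" "x \<le> z" "y < z" "z - y < d'"
       "(a + c) * (z - y) \<le> (LINT t:{y..z}|lborel. g t)"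
      using x by (auto simp: S_def)
    have sub: "{y..z} \<subseteq> {- real n<..<real n}" using yz by (auto simp: d'_def)
    have "(LINT t:{y..z}|lborel. ?v t) = (LINT t:{y..z}|lborel. g t - a)"
      using sub unfolding set_lebesgue_integral_def
      by (intro Bochner_Integration.integral_cong) (auto split: split_indicator)
    also have "\<dots> = (LINT t:{y..z}|lborel. g t) - (LINT t:{y..z}|lborel. a)"
    proof (rule set_integral_diff)
      show "set_integrable lborel {y..z} g"
        using g by (rule set_integrable_Icc)
      show "set_integrable lborel {y..z} (\<lambda>_. a)"
        unfolding set_integrable_def by (intro integrable_scaleR_left integrable_real_indicator) (auto simp: emeasure_lborel_Icc_eq)
    qed
    also have "(LINT t:{y..z}|lborel. a) = a * (z - y)"
      using yz by (simp add: set_lebesgue_integral_def)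
    finally have "c * (z - y) \<le> (LINT t:{y..z}|lborel. ?v t)" using yz(5) by (simp add: algebra_simps)
    thus "\<exists>y z. y \<le> x \<and> x \<le> z \<and> y < z \<and> z - y < d \<and> c * (z - y) \<le> (LINT t:{y..z}|lborel. ?v t)"
      using yz by (intro exI[of _ y] exI[of _ z]) (auto simp: d'_def)
  qed
  define N where "N = (\<Union>i\<in>\<rat> \<times> (\<rat> \<inter> {0<..}) \<times> UNIV. S i)"
  have "negligible N"
    unfolding N_def using neg
    by (intro negligible_countable_Union) (auto intro!: countable_SIGMA countable_rat)
  hence "AE x in lebesgue. x \<notin> N"
    by (simp add: AE_not_in negligible_iff_null_sets)
  hence "AE x in lborel. x \<notin> N" by (simp add: AE_completion_iff)
  thus ?thesis
  proof eventually_elim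
    case (elim x)
    show ?case
    proof (intro allI impI)
      fix e :: real assume "e > 0"
      obtain a where a: "a \<in> \<rat>" "g x < a" "a < g x + e / 2"
        using Rats_dense_in_real[of "g x" "g x + e / 2"] \<open>e > 0\<close> by auto
      obtain c where c: "c \<in> \<rat>" "0 < c" "c < e / 2"
        using Rats_dense_in_real[of 0 "e / 2"] \<open>e > 0\<close> by auto
      obtain n :: nat where n: "\<bar>x\<bar> < real n" using reals_Archimedean2 by blast
      have "x \<notin> S (a, c, n)" using elim a c by (auto simp: N_def)
      have "\<not> (\<forall>d>0. \<exists>y z. y \<le> x \<and> x \<le> z \<and> y < z \<and> z - y < d \<and>
          (a + c) * (z - y) \<le> (LINT t:{y..z}|lborel. g t))"
      proof
        assume "\<forall>d>0. \<exists>y z. y \<le> x \<and> x \<le> z \<and> y < z \<and> z - y < d \<and>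
          (a + c) * (z - y) \<le> (LINT t:{y..z}|lborel. g t)"
        moreover have "x \<in> {- real n<..<real n}" "g x \<le> a" using n a(2) by auto
        ultimately have "x \<in> S (a, c, n)" unfolding S_def prod.case mem_Collect_eq by blast
        thus False using \<open>x \<notin> S (a, c, n)\<close> by blast
      qed
      then obtain d where d: "d > 0" "\<And>y z. y \<le> x \<Longrightarrow> x \<le> z \<Longrightarrow> y < z \<Longrightarrow> z - y < d \<Longrightarrow>
           (LINT t:{y..z}|lborel. g t) < (a + c) * (z - y)"
        by (metis not_le)
      have le: "(a + c) * (z - y) \<le> (g x + e) * (z - y)" if "y < z" for y z
        using a c that by (intro mult_right_mono) auto
      show "\<exists>d>0. \<forall>y z. y \<le> x \<longrightarrow> x \<le> z \<longrightarrow> y < z \<longrightarrow> z - y < d \<longrightarrow>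
         (LINT t:{y..z}|lborel. g t) \<le> (g x + e) * (z - y)"
      proof (intro exI[of _ d] conjI allI impI)
        fix y z assume "y \<le> x" "x \<le> z" "y < z" "z - y < d"
        thus "(LINT t:{y..z}|lborel. g t) \<le> (g x + e) * (z - y)"
          using d(2)[of y z] le[of y z] by linarith
      qed (rule d(1))
    qed
  qed
qed

text \<open>
  The previous estimate for \<open>g\<close> bounds the difference quotients of \<open>G\<close> from above, and for \<open>- g\<close>
  from below.
\<close>

theorem Lebesgue_differentiation_real:
  fixes g G :: "real \<Rightarrow> real"
  assumes g: "integrable lborel g"
    and G: "\<And>y z. l < y \<Longrightarrow> y \<le> z \<Longrightarrow> z < u \<Longrightarrow> G z - G y = (LINT t:{y..z}|lborel. g t)"
  shows "AE x in lborel. x \<in> {l<..<u} \<longrightarrow> (G has_real_derivative g x) (at x)"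
  using AE_averages_le[OF g] AE_averages_le[OF integrable_minus[OF g]]
proof eventually_elim
  case (elim x)
  show ?case
  proof
    assume x: "x \<in> {l<..<u}"
    have "((\<lambda>y. (G y - G x) / (y - x)) \<longlongrightarrow> g x) (at x)"
      unfolding LIM_eq
    proof (intro allI impI)
      fix e :: real assume "e > 0"
      obtain d1 where d1: "d1 > 0" "\<And>y z. y \<le> x \<Longrightarrow> x \<le> z \<Longrightarrow> y < z \<Longrightarrow> z - y < d1 \<Longrightarrow>
          (LINT t:{y..z}|lborel. g t) \<le> (g x + e / 2) * (z - y)"
        using elim(1)[rule_format, of "e / 2"] \<open>e > 0\<close> by auto
      obtain d2 where d2: "d2 > 0" "\<And>y z. y \<le> x \<Longrightarrow> x \<le> z \<Longrightarrow> y < z \<Longrightarrow> z - y < d2 \<Longrightarrow>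
          (LINT t:{y..z}|lborel. - g t) \<le> (- g x + e / 2) * (z - y)"
        using elim(2)[rule_format, of "e / 2"] \<open>e > 0\<close> by auto
      define d where "d = min (min d1 d2) (min (x - l) (u - x))"
      have "d > 0" using d1 d2 x by (auto simp: d_def)
      have *: "\<bar>(G z - G y) / (z - y) - g x\<bar> < e" if "y \<le> x" "x \<le> z" "y < z" "z - y < d" for y z
      proof -
        have eq: "G z - G y = (LINT t:{y..z}|lborel. g t)"
          using that x by (intro G) (auto simp: d_def)
        have m: "(LINT t:{y..z}|lborel. - g t) = - (LINT t:{y..z}|lborel. g t)"
          by (simp add: set_lebesgue_integral_def)
        have "G z - G y \<le> (g x + e / 2) * (z - y)"
          unfolding eq using that by (intro d1) (auto simp: d_def)
        moreover have "- (G z - G y) \<le> (- g x + e / 2) * (z - y)"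
          unfolding eq m[symmetric] using that by (intro d2) (auto simp: d_def)
        ultimately have "(G z - G y) / (z - y) \<le> g x + e / 2" "g x - e / 2 \<le> (G z - G y) / (z - y)"
          using \<open>y < z\<close> by (simp_all add: field_simps)
        thus ?thesis using \<open>e > 0\<close> unfolding abs_less_iff by linarith
      qed
      show "\<exists>s>0. \<forall>y. y \<noteq> x \<and> norm (y - x) < s \<longrightarrow> norm ((G y - G x) / (y - x) - g x) < e"
      proof (intro exI[of _ d] conjI allI impI)
        fix y assume y: "y \<noteq> x \<and> norm (y - x) < d"
        have sw: "(G y - G x) / (y - x) = (G x - G y) / (x - y)"
          by (metis minus_diff_eq minus_divide_divide)
        show "norm ((G y - G x) / (y - x) - g x) < e"
          using *[of x y] *[of y x] y sw by (cases "x < y") auto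
      qed fact
    qed
    thus "(G has_real_derivative g x) (at x)"
      by (simp add: has_field_derivative_iff)
  qed
qed

section \<open>Absolute continuity and variation\<close>

text \<open>
  Finite families of non-degenerate, non-overlapping subintervals of \<open>[l, u]\<close>, each recorded by its
  end points. Sets of pairs, rather than indexed families, make splitting a family at a point and
  merging families plain set operations.
\<close>

definition interval_families :: "real \<Rightarrow> real \<Rightarrow> (real \<times> real) set set" where
  "interval_families l u = {S. finite S \<and> (\<forall>(a, b)\<in>S. l \<le> a \<and> a < b \<and> b \<le> u) \<and>
     disjoint_family_on (\<lambda>(a, b). {a<..<b}) S}"

definition oscillation :: "(real \<Rightarrow> 'a::real_normed_vector) \<Rightarrow> (real \<times> real) set \<Rightarrow> real" where
  "oscillation f S = (\<Sum>(a, b)\<in>S. norm (f b - f a))"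

definition total_length :: "(real \<times> real) set \<Rightarrow> real" where
  "total_length S = (\<Sum>(a, b)\<in>S. b - a)"

text \<open>
  Absolute continuity in terms of such families; the indexed formulation, which admits degenerate
  intervals, implies it (\<open>absolutely_continuous_fun_imp_AC_on\<close> below).
\<close>

definition AC_on :: "real \<Rightarrow> real \<Rightarrow> (real \<Rightarrow> 'a::real_normed_vector) \<Rightarrow> bool" where
  "AC_on l u f \<longleftrightarrow> (\<forall>\<epsilon>>0. \<exists>\<delta>>0. \<forall>S\<in>interval_families l u. total_length S < \<delta> \<longrightarrow> oscillation f S < \<epsilon>)"


lemma interval_families_D:
  assumes "S \<in> interval_families l u"
  shows "finite S" "\<And>a b. (a, b) \<in> S \<Longrightarrow> l \<le> a \<and> a < b \<and> b \<le> u"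
    "\<And>a b c d. (a, b) \<in> S \<Longrightarrow> (c, d) \<in> S \<Longrightarrow> (a, b) \<noteq> (c, d) \<Longrightarrow> b \<le> c \<or> d \<le> a"
proof -
  show "finite S" "\<And>a b. (a, b) \<in> S \<Longrightarrow> l \<le> a \<and> a < b \<and> b \<le> u"
    using assms by (auto simp: interval_families_def)
  fix a b c d assume *: "(a, b) \<in> S" "(c, d) \<in> S" "(a, b) \<noteq> (c, d)"
  have lt: "a < b" "c < d" using * assms by (auto simp: interval_families_def)
  have dis: "{a<..<b} \<inter> {c<..<d} = {}"
  proof -
    have "disjoint_family_on (\<lambda>(a, b). {a<..<b}) S"
      using assms by (simp add: interval_families_def)
    from disjoint_family_onD[OF this *] show ?thesis unfolding prod.case .
  qed
  show "b \<le> c \<or> d \<le> a"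
  proof (rule ccontr)
    assume "\<not> (b \<le> c \<or> d \<le> a)"
    hence "max a c < min b d" using lt by auto
    then obtain x where "max a c < x" "x < min b d" using dense by blast
    hence "x \<in> {a<..<b} \<inter> {c<..<d}" by auto
    thus False using dis by blast
  qed
qed

lemma interval_families_I:
  assumes "finite S" "\<And>a b. (a, b) \<in> S \<Longrightarrow> l \<le> a \<and> a < b \<and> b \<le> u"
    "\<And>a b c d. (a, b) \<in> S \<Longrightarrow> (c, d) \<in> S \<Longrightarrow> (a, b) \<noteq> (c, d) \<Longrightarrow> b \<le> c \<or> d \<le> a"
  shows "S \<in> interval_families l u"
proof -
  have "{a<..<b} \<inter> {c<..<d} = {}" if "(a, b) \<in> S" "(c, d) \<in> S" "(a, b) \<noteq> (c, d)" for a b c d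
    using assms(3)[OF that] by (auto intro!: equals0I)
  hence "disjoint_family_on (\<lambda>(a, b). {a<..<b}) S"
    unfolding disjoint_family_on_def by (simp add: split_paired_all)
  moreover have "\<forall>(a, b)\<in>S. l \<le> a \<and> a < b \<and> b \<le> u" using assms(2) by blast
  ultimately show ?thesis using assms(1) unfolding interval_families_def by blast
qed


lemma interval_families_widen:
  assumes "S \<in> interval_families a b" "l \<le> a" "b \<le> u"
  shows "S \<in> interval_families l u"
proof -
  have "l \<le> c \<and> c < d \<and> d \<le> u" if "(c, d) \<in> S" for c d
    using interval_families_D(2)[OF assms(1) that] assms(2,3) by auto
  thus ?thesis using assms(1) unfolding interval_families_def by auto
qed

lemma interval_families_insert_right:
  assumes S: "S \<in> interval_families l p" and "l \<le> p" "p < q"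
  shows "insert (p, q) S \<in> interval_families l q" "(p, q) \<notin> S"
proof -
  note D = interval_families_D[OF S]
  show "insert (p, q) S \<in> interval_families l q"
  proof (rule interval_families_I)
    show "l \<le> a \<and> a < b \<and> b \<le> q" if "(a, b) \<in> insert (p, q) S" for a b
      using D(2)[of a b] that assms by auto
    show "b \<le> c \<or> d \<le> a"
      if "(a, b) \<in> insert (p, q) S" "(c, d) \<in> insert (p, q) S" "(a, b) \<noteq> (c, d)" for a b c d
      using D(2)[of a b] D(2)[of c d] D(3)[of a b c d] that by auto
  qed (use D(1) in auto)
  show "(p, q) \<notin> S" using D(2)[of p q] \<open>p < q\<close> by auto
qed

lemma interval_families_insert_left:
  assumes S: "S \<in> interval_families q u" and "p < q" "q \<le> u"
  shows "insert (p, q) S \<in> interval_families p u" "(p, q) \<notin> S"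
proof -
  note D = interval_families_D[OF S]
  show "insert (p, q) S \<in> interval_families p u"
  proof (rule interval_families_I)
    show "p \<le> a \<and> a < b \<and> b \<le> u" if "(a, b) \<in> insert (p, q) S" for a b
      using D(2)[of a b] that assms by auto
    show "b \<le> c \<or> d \<le> a"
      if "(a, b) \<in> insert (p, q) S" "(c, d) \<in> insert (p, q) S" "(a, b) \<noteq> (c, d)" for a b c d
      using D(2)[of a b] D(2)[of c d] D(3)[of a b c d] that by auto
  qed (use D(1) in auto)
  show "(p, q) \<notin> S" using D(2)[of p q] \<open>p < q\<close> by auto
qed

lemma total_length_le:
  assumes "S \<in> interval_families l u" "l \<le> u"
  shows "total_length S \<le> u - l"
proof -
  note D = interval_families_D[OF assms(1)]
  have "ennreal (total_length S) = (\<Sum>i\<in>S. emeasure lborel ((\<lambda>(a, b). {a<..<b}) i))"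
    unfolding total_length_def using D(2)
    by (subst sum_ennreal[symmetric]) (force simp: less_imp_le split: prod.split intro!: sum.cong)+
  also have "\<dots> = emeasure lborel (\<Union>i\<in>S. (\<lambda>(a, b). {a<..<b}) i)"
    using assms D(1) by (intro sum_emeasure) (auto simp: interval_families_def)
  also have "\<dots> \<le> emeasure lborel {l..u}"
    using D(2) by (intro emeasure_mono) force+
  also have "\<dots> = ennreal (u - l)" using assms by simp
  finally show ?thesis using assms by simp
qed

text \<open>
  At most one interval \<open>(p, q)\<close> of the family contains the cut point \<open>c\<close>; it is replaced by \<open>(p, c)\<close> and
  \<open>(c, q)\<close>, which can only increase the oscillation.
\<close>

lemma split_interval_family:
  assumes S: "S \<in> interval_families l u" and c: "l \<le> c" "c \<le> u"
  obtains S1 S2 where "S1 \<in> interval_families l c" "S2 \<in> interval_families c u"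
    "oscillation f S \<le> oscillation f S1 + oscillation f S2"
proof -
  note D = interval_families_D[OF S]
  define L R M where "L = {i\<in>S. snd i \<le> c}" and "R = {i\<in>S. c \<le> fst i}"
    and "M = {i\<in>S. fst i < c \<and> c < snd i}"
  have S_eq: "S = L \<union> R \<union> M" by (auto simp: L_def R_def M_def)
  have fin: "finite L" "finite R" "finite M" using D(1) by (auto simp: L_def R_def M_def)
  have dj: "L \<inter> R = {}" "(L \<union> R) \<inter> M = {}" using D(2) by (force simp: L_def R_def M_def)+
  have osc: "oscillation f S = oscillation f L + oscillation f R + oscillation f M"
    unfolding oscillation_def S_eq using fin dj by (simp add: sum.union_disjoint)
  have L: "L \<in> interval_families l c" using D
    by (intro interval_families_I) (auto simp: L_def)
  have R: "R \<in> interval_families c u" using D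
    by (intro interval_families_I) (auto simp: R_def)
  show ?thesis
  proof (cases "M = {}")
    case True
    thus ?thesis using that[OF L R] osc by (simp add: oscillation_def)
  next
    case False
    then obtain p q where pq: "(p, q) \<in> S" "p < c" "c < q" by (auto simp: M_def)
    have sep: "b \<le> p \<or> q \<le> a" if "(a, b) \<in> S" "(a, b) \<noteq> (p, q)" for a b
      using D(3)[OF that(1) pq(1) that(2)] by auto
    have M: "M = {(p, q)}"
    proof (intro equalityI subsetI)
      fix i assume "i \<in> M"
      then obtain a b where ab: "i = (a, b)" "(a, b) \<in> S" "a < c" "c < b" by (cases i) (auto simp: M_def)
      show "i \<in> {(p, q)}" using sep[OF ab(2)] ab pq by auto
    qed (use pq in \<open>auto simp: M_def\<close>)
    have lpqu: "l \<le> p" "q \<le> u" using D(2)[OF pq(1)] by auto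
    have L: "L \<in> interval_families l p"
    proof (rule interval_families_I)
      fix a b assume ab: "(a, b) \<in> L"
      hence "(a, b) \<in> S" "b \<le> c" by (auto simp: L_def)
      thus "l \<le> a \<and> a < b \<and> b \<le> p" using D(2)[of a b] sep[of a b] pq by auto
    qed (use fin D(3) in \<open>auto simp: L_def\<close>)
    have R: "R \<in> interval_families q u"
    proof (rule interval_families_I)
      fix a b assume ab: "(a, b) \<in> R"
      hence "(a, b) \<in> S" "c \<le> a" by (auto simp: R_def)
      thus "q \<le> a \<and> a < b \<and> b \<le> u" using D(2)[of a b] sep[of a b] pq by auto
    qed (use fin D(3) in \<open>auto simp: R_def\<close>)
    note L' = interval_families_insert_right[OF L lpqu(1) pq(2)]
    note R' = interval_families_insert_left[OF R pq(3) lpqu(2)]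
    have "oscillation f (insert (p, c) L) = norm (f c - f p) + oscillation f L"
      using L'(2) fin by (simp add: oscillation_def)
    moreover have "oscillation f (insert (c, q) R) = norm (f q - f c) + oscillation f R"
      using R'(2) fin by (simp add: oscillation_def)
    moreover have "norm (f q - f p) \<le> norm (f c - f p) + norm (f q - f c)"
      using norm_triangle_ineq[of "f c - f p" "f q - f c"] by simp
    ultimately show ?thesis using osc
      by (intro that[OF L'(1) R'(1)]) (simp add: M oscillation_def)
  qed
qed

text \<open>
  On an interval shorter than \<open>\<delta>\<close> every oscillation is below 1, and \<open>[l, u]\<close> is cut into finitely many
  pieces of length \<open>\<delta> / 2\<close>.
\<close>

lemma AC_on_bounded_variation:
  assumes "AC_on l u f"
  shows "\<exists>B. \<forall>S\<in>interval_families l u. oscillation f S \<le> B"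
proof -
  obtain \<delta> where \<delta>: "\<delta> > 0" "\<And>S. S \<in> interval_families l u \<Longrightarrow> total_length S < \<delta> \<Longrightarrow> oscillation f S < 1"
    using assms unfolding AC_on_def by (meson zero_less_one)
  define d where "d = \<delta> / 2"
  have "d > 0" using \<delta>(1) by (simp add: d_def)
  have *: "oscillation f S \<le> real n" if "S \<in> interval_families l x" "l \<le> x" "x \<le> u" "x \<le> l + real n * d" for n x S
    using that
  proof (induction n arbitrary: x S)
    case 0
    hence "S = {}" using interval_families_D(2)[OF 0(1)] by force
    thus ?case by (simp add: oscillation_def)
  next
    case (Suc n)
    \<comment> \<open>the maximum covers the first step, where less than \<open>d\<close> may be left\<close>
    define c where "c = max l (x - d)"
    have c: "l \<le> c" "c \<le> x" "c \<le> l + real n * d" using Suc.prems \<open>d > 0\<close> by (auto simp: c_def algebra_simps)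
    obtain S1 S2 where S: "S1 \<in> interval_families l c" "S2 \<in> interval_families c x"
        "oscillation f S \<le> oscillation f S1 + oscillation f S2"
      using split_interval_family[OF Suc.prems(1) c(1,2), of f] by blast
    have "oscillation f S1 \<le> real n" using Suc S(1) c by auto
    moreover have "oscillation f S2 < 1"
    proof (rule \<delta>(2))
      show "S2 \<in> interval_families l u" using interval_families_widen[OF S(2)] c Suc.prems by auto
      show "total_length S2 < \<delta>" using total_length_le[OF S(2)] c \<open>d > 0\<close> by (auto simp: c_def d_def)
    qed
    ultimately show ?case using S(3) by simp
  qed
  show ?thesis
  proof (cases "l \<le> u")
    case True
    obtain n :: nat where "(u - l) / d \<le> real n" using real_arch_simple by blast
    hence "u \<le> l + real n * d" using \<open>d > 0\<close> by (simp add: field_simps)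
    thus ?thesis using *[of _ u n] True by auto
  next
    case False
    hence "S = {}" if "S \<in> interval_families l u" for S using interval_families_D(2)[OF that] by force
    hence "oscillation f S \<le> 0" if "S \<in> interval_families l u" for S
      using that by (fastforce simp: oscillation_def)
    thus ?thesis by blast
  qed
qed

definition variation :: "(real \<Rightarrow> 'a::real_normed_vector) \<Rightarrow> real \<Rightarrow> real \<Rightarrow> real" where
  "variation f x y = (SUP S\<in>interval_families x y. oscillation f S)"

context
  fixes f :: "real \<Rightarrow> 'a::real_normed_vector" and l u
  assumes AC: "AC_on l u f"
begin

lemma bdd_above_oscillation:
  assumes "l \<le> x" "y \<le> u"
  shows "bdd_above (oscillation f ` interval_families x y)"
proof -
  obtain B where B: "\<forall>S\<in>interval_families l u. oscillation f S \<le> B"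
    using AC_on_bounded_variation[OF AC] by blast
  have "S \<in> interval_families l u" if "S \<in> interval_families x y" for S
    using interval_families_widen[OF that] assms by auto
  thus ?thesis using B by (auto simp: bdd_above_def)
qed

lemma oscillation_le_variation:
  assumes "l \<le> x" "y \<le> u" "S \<in> interval_families x y"
  shows "oscillation f S \<le> variation f x y"
  unfolding variation_def by (intro cSUP_upper assms bdd_above_oscillation)

lemma variation_leI:
  assumes "\<And>S. S \<in> interval_families x y \<Longrightarrow> oscillation f S \<le> B"
  shows "variation f x y \<le> B"
  unfolding variation_def
proof (rule cSUP_least)
  have "{} \<in> interval_families x y" by (intro interval_families_I) auto
  thus "interval_families x y \<noteq> {}" by blast
qed fact

lemma variation_add_le:
  assumes "l \<le> x" "x \<le> y" "y \<le> u"
  shows "variation f l y \<le> variation f l x + variation f x y"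
proof (rule variation_leI)
  fix S assume "S \<in> interval_families l y"
  then obtain S1 S2 where S: "S1 \<in> interval_families l x" "S2 \<in> interval_families x y"
        "oscillation f S \<le> oscillation f S1 + oscillation f S2"
    using split_interval_family[of S l y x f] assms by blast
  thus "oscillation f S \<le> variation f l x + variation f x y"
    using oscillation_le_variation[of l x S1] oscillation_le_variation[of x y S2] assms by auto
qed

lemma norm_diff_le_variation:
  assumes "l \<le> x" "x \<le> y" "y \<le> u"
  shows "norm (f y - f x) \<le> variation f l y - variation f l x"
proof (cases "x = y")
  case False
  have "variation f l x \<le> variation f l y - norm (f y - f x)"
  proof (rule variation_leI)
    fix S assume S: "S \<in> interval_families l x"
    note xy = interval_families_insert_right[OF S, of y]
    have "insert (x, y) S \<in> interval_families l y"
      using xy assms False by auto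
    hence "oscillation f (insert (x, y) S) \<le> variation f l y"
      using assms by (intro oscillation_le_variation) auto
    moreover have "(x, y) \<notin> S" using xy assms False by auto
    ultimately show "oscillation f S \<le> variation f l y - norm (f y - f x)"
      using interval_families_D(1)[OF S] by (simp add: oscillation_def)
  qed
  thus ?thesis by simp
qed auto

text \<open>
  A family that nearly realises the variation on each interval of \<open>T\<close> can be substituted for that
  interval without increasing the total length. The auxiliary claim substitutes the intervals of \<open>T\<close>
  one at a time; \<open>S\<close> collects the intervals that are already in place.
\<close>

lemma AC_on_variation: "AC_on l u (variation f l)"
  unfolding AC_on_def
proof (intro allI impI)
  fix \<epsilon> :: real assume "\<epsilon> > 0"
  obtain \<delta> where \<delta>: "\<delta> > 0" "\<And>S. S \<in> interval_families l u \<Longrightarrow> total_length S < \<delta> \<Longrightarrow> oscillation f S < \<epsilon> / 2"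
    using AC \<open>\<epsilon> > 0\<close> unfolding AC_on_def by (meson half_gt_zero)
  have *: "oscillation f S + oscillation (variation f l) T \<le> \<epsilon> / 2"
    if "finite T" "S \<union> T \<in> interval_families l u" "S \<inter> T = {}" "total_length (S \<union> T) < \<delta>" for S T
    using that
  proof (induction T arbitrary: S rule: finite_induct)
    case empty
    thus ?case using \<delta>(2)[of S] by (simp add: oscillation_def)
  next
    case (insert i T)
    obtain a b where i: "i = (a, b)" by (cases i)
    note D = interval_families_D[OF insert.prems(1)]
    have ab: "l \<le> a" "a < b" "b \<le> u" using D(2)[of a b] by (auto simp: i)
    have finS: "finite S" using D(1) by auto
    have "variation f a b \<le> \<epsilon> / 2 - oscillation f S - oscillation (variation f l) T"
    proof (rule variation_leI)
      fix R assume R: "R \<in> interval_families a b"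
      note DR = interval_families_D[OF R]
      have sep: "b \<le> c \<or> d \<le> a" "(c, d) \<notin> R" "c < d" if "(c, d) \<in> S \<union> T" for c d
      proof -
        have "(c, d) \<noteq> (a, b)" using that insert.hyps(2) insert.prems(2) by (auto simp: i)
        thus *: "b \<le> c \<or> d \<le> a" using D(3)[of c d a b] that by (auto simp: i)
        show "c < d" using D(2)[of c d] that by auto
        thus "(c, d) \<notin> R" using * DR(2)[of c d] by auto
      qed
      have fam: "(S \<union> R) \<union> T \<in> interval_families l u"
      proof (rule interval_families_I)
        show "finite (S \<union> R \<union> T)" using D(1) DR(1) by auto
        show "l \<le> c \<and> c < d \<and> d \<le> u" if "(c, d) \<in> S \<union> R \<union> T" for c d
          using that D(2)[of c d] DR(2)[of c d] ab by force
        fix c d p q assume *: "(c, d) \<in> S \<union> R \<union> T" "(p, q) \<in> S \<union> R \<union> T" "(c, d) \<noteq> (p, q)"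
        consider "(c, d) \<in> S \<union> T" "(p, q) \<in> S \<union> T" | "(c, d) \<in> S \<union> T" "(p, q) \<in> R"
          | "(c, d) \<in> R" "(p, q) \<in> S \<union> T" | "(c, d) \<in> R" "(p, q) \<in> R" using * by blast
        thus "d \<le> p \<or> q \<le> c"
        proof cases
          case 1 thus ?thesis using D(3)[of c d p q] *(3) by auto
        next
          case 2 thus ?thesis using sep[of c d] DR(2)[of p q] by auto
        next
          case 3 thus ?thesis using sep[of p q] DR(2)[of c d] by auto
        next
          case 4 thus ?thesis using DR(3)[of c d p q] *(3) by auto
        qed
      qed
      have d1: "R \<inter> (S \<union> T) = {}" using sep(2) by auto
      have d2: "S \<inter> T = {}" using insert.prems(2) by auto
      have "total_length (S \<union> R \<union> T) = total_length R + total_length (S \<union> T)"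
        using d1 finS insert.hyps(1) DR(1)
        by (subst Un_commute[of S R], unfold Un_assoc total_length_def, subst sum.union_disjoint) auto
      also have "\<dots> \<le> (b - a) + total_length (S \<union> T)"
        using total_length_le[OF R] ab by simp
      also have "\<dots> = total_length (S \<union> insert i T)"
        using insert.hyps insert.prems(2) finS by (simp add: total_length_def i)
      finally have "total_length (S \<union> R \<union> T) < \<delta>" using insert.prems(3) by simp
      hence "oscillation f (S \<union> R) + oscillation (variation f l) T \<le> \<epsilon> / 2"
        using insert.IH[OF fam] d1 d2 by auto
      moreover have "oscillation f (S \<union> R) = oscillation f S + oscillation f R"
        unfolding oscillation_def using d1 finS DR(1) by (intro sum.union_disjoint) auto
      ultimately show "oscillation f R \<le> \<epsilon> / 2 - oscillation f S - oscillation (variation f l) T"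
        by simp
    qed
    moreover have "norm (variation f l b - variation f l a) \<le> variation f a b"
      using variation_add_le[of a b] norm_diff_le_variation[of a b] norm_ge_zero[of "f b - f a"] ab
      unfolding real_norm_def by linarith
    moreover have "oscillation (variation f l) (insert i T) =
        norm (variation f l b - variation f l a) + oscillation (variation f l) T"
      using insert.hyps by (simp add: oscillation_def i)
    ultimately show ?case by linarith
  qed
  show "\<exists>\<delta>>0. \<forall>S\<in>interval_families l u. total_length S < \<delta> \<longrightarrow> oscillation (variation f l) S < \<epsilon>"
  proof (intro exI[of _ \<delta>] conjI ballI impI)
    fix S assume S: "S \<in> interval_families l u" "total_length S < \<delta>"
    show "oscillation (variation f l) S < \<epsilon>"
      using *[of S "{}"] S interval_families_D(1)[OF S(1)] \<open>\<epsilon> > 0\<close>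
      by (simp add: oscillation_def)
  qed (rule \<delta>(1))
qed

end

section \<open>Densities of absolutely continuous functions\<close>

lemma AC_on_singleton:
  assumes AC: "AC_on l u f" and "\<epsilon> > 0"
  shows "\<exists>\<delta>>0. \<forall>x y. l \<le> x \<longrightarrow> x \<le> y \<longrightarrow> y \<le> u \<longrightarrow> y - x < \<delta> \<longrightarrow> norm (f y - f x) < \<epsilon>"
proof -
  obtain \<delta> where \<delta>: "\<delta> > 0" "\<And>S. S \<in> interval_families l u \<Longrightarrow> total_length S < \<delta> \<Longrightarrow> oscillation f S < \<epsilon>"
    using assms unfolding AC_on_def by meson
  have "norm (f y - f x) < \<epsilon>" if "l \<le> x" "x \<le> y" "y \<le> u" "y - x < \<delta>" for x y
  proof (cases "x = y")
    case False
    have "{(x, y)} \<in> interval_families l u" using that False by (intro interval_families_I) auto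
    from \<delta>(2)[OF this] show ?thesis using that by (simp add: total_length_def oscillation_def)
  qed (use \<open>\<epsilon> > 0\<close> in auto)
  thus ?thesis using \<delta>(1) by blast
qed

lemma AC_on_imp_continuous:
  assumes "AC_on l u f"
  shows "continuous_on {l..u} f"
  unfolding continuous_on_iff
proof (intro ballI allI impI)
  fix x e :: real assume x: "x \<in> {l..u}" and "e > 0"
  obtain \<delta> where \<delta>: "\<delta> > 0" "\<And>x y. l \<le> x \<Longrightarrow> x \<le> y \<Longrightarrow> y \<le> u \<Longrightarrow> y - x < \<delta> \<Longrightarrow> norm (f y - f x) < e"
    using AC_on_singleton[OF assms \<open>e > 0\<close>] by blast
  have "dist (f x') (f x) < e" if "x' \<in> {l..u}" "dist x' x < \<delta>" for x'
    using \<delta>(2)[of x x'] \<delta>(2)[of x' x] that x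
    by (cases "x \<le> x'") (auto simp: dist_norm norm_minus_commute)
  thus "\<exists>d>0. \<forall>x'\<in>{l..u}. dist x' x < d \<longrightarrow> dist (f x') (f x) < e"
    using \<delta>(1) by blast
qed

text \<open>
  The Stieltjes measure \<open>\<mu>\<close> of \<open>w\<close>, extended by constants outside \<open>[l, u]\<close>, is absolutely continuous
  with respect to Lebesgue measure: a null set lies in open sets of small length, and the components
  of an open set are disjoint intervals, so absolute continuity of \<open>w\<close> bounds their \<open>\<mu>\<close>-mass. The
  density is the Radon--Nikodym derivative.
\<close>

lemma mono_AC_on_has_density:
  fixes w :: "real \<Rightarrow> real"
  assumes AC: "AC_on l u w" and mono: "\<And>x y. l \<le> x \<Longrightarrow> x \<le> y \<Longrightarrow> y \<le> u \<Longrightarrow> w x \<le> w y"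
    and lu: "l < u"
  obtains g where "integrable lborel g"
    "\<And>x y. l \<le> x \<Longrightarrow> x \<le> y \<Longrightarrow> y \<le> u \<Longrightarrow> w y - w x = (LINT t:{x..y}|lborel. g t)"
proof -
  define W where "W x = w (max l (min u x))" for x
  have W_eq: "W x = w x" if "l \<le> x" "x \<le> u" for x using that by (simp add: W_def)
  have monoW: "W x \<le> W y" if "x \<le> y" for x y
    unfolding W_def using that lu by (intro mono) auto
  have contW: "continuous_on UNIV W"
  proof -
    have "continuous_on UNIV (\<lambda>x. max l (min u x))" by (intro continuous_intros)
    moreover have "(\<lambda>x. max l (min u x)) ` UNIV \<subseteq> {l..u}" using lu by auto
    ultimately show ?thesis
      unfolding W_def using continuous_on_compose2[OF AC_on_imp_continuous[OF AC]] by blast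
  qed
  hence rcont: "continuous (at_right a) W" for a
    by (simp add: continuous_on_eq_continuous_at continuous_at_imp_continuous_within)
  define \<mu> where "\<mu> = interval_measure W"
  have sets_\<mu>[simp, measurable_cong]: "sets \<mu> = sets borel" by (simp add: \<mu>_def)
  have Icc: "emeasure \<mu> {a..b} = ennreal (W b - W a)" if "a \<le> b" for a b
    unfolding \<mu>_def using that monoW contW by (rule emeasure_interval_measure_Icc)
  have open_le: "emeasure \<mu> U \<le> ennreal \<epsilon>" if U: "open U" "U \<subseteq> {l<..<u}" and
    small: "emeasure lborel U < ennreal \<delta>" and
    \<delta>: "\<And>S. S \<in> interval_families l u \<Longrightarrow> total_length S < \<delta> \<Longrightarrow> oscillation w S < \<epsilon>" for U \<epsilon> \<delta>
  proof -
    have \<epsilon>: "\<epsilon> \<ge> 0"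
    proof -
      have "{} \<in> interval_families l u" by (intro interval_families_I) auto
      moreover have "0 < \<delta>" using small by (cases "\<delta> > 0") (auto simp: ennreal_neg)
      ultimately show ?thesis using \<delta>[of "{}"] by (simp add: total_length_def oscillation_def)
    qed
    have c: "Inf c < Sup c" "{Inf c<..<Sup c} \<subseteq> c" "c \<subseteq> {Inf c..Sup c}" "l \<le> Inf c" "Sup c \<le> u" "open c" "c \<subseteq> U"
      if "c \<in> components U" for c
    proof -
      have conn: "connected c" and ne: "c \<noteq> {}" and op: "open c" and sub: "c \<subseteq> U"
        using in_components_connected[OF that] in_components_nonempty[OF that] open_components[OF U(1) that] in_components_subset[OF that] by blast+
      show "open c" "c \<subseteq> U" by fact+
      have bd: "bdd_below c" "bdd_above c" using sub U(2) by (auto intro!: bdd_belowI[of _ l] bdd_aboveI[of _ u])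
      obtain x where x: "x \<in> c" using ne by auto
      then obtain e where "e > 0" "ball x e \<subseteq> c" using op openE by blast
      hence "x + e/2 \<in> c" "x - e/2 \<in> c" by (auto simp: dist_real_def subset_iff)
      hence "Inf c \<le> x - e/2" "x + e/2 \<le> Sup c" using bd by (auto intro: cInf_lower cSup_upper)
      thus "Inf c < Sup c" using \<open>e > 0\<close> by simp
      show "c \<subseteq> {Inf c..Sup c}" using bd by (auto intro: cInf_lower cSup_upper)
      show "l \<le> Inf c" using ne sub U(2) by (intro cInf_greatest) auto
      show "Sup c \<le> u" using ne sub U(2) by (intro cSup_least) auto
      show "{Inf c<..<Sup c} \<subseteq> c"
      proof
        fix y assume y: "y \<in> {Inf c<..<Sup c}"
        obtain a where a: "a \<in> c" "a < y" using y cInf_lessD[OF ne, of y] by auto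
        obtain b where b: "b \<in> c" "y < b" using y less_cSupD[OF ne, of y] by auto
        have "{a..b} \<subseteq> c" using connected_contains_Icc[OF conn a(1) b(1)] .
        thus "y \<in> c" using a b by auto
      qed
    qed
    have cnt: "countable (components U)"
    proof (rule countable_disjoint_open_subsets)
      show "pairwise disjnt (components U)"
        using pairwise_disjoint_components[of U] by (simp add: pairwise_def disjnt_def)
    qed (rule c(6))
      have meas: "D \<in> fmeasurable \<mu>" if "D \<in> components U" for D
      proof (rule fmeasurableI)
        show "D \<in> sets \<mu>" using c(6)[OF that] by simp
        have "emeasure \<mu> D \<le> emeasure \<mu> {Inf D..Sup D}" using c(3)[OF that] by (intro emeasure_mono) auto
        thus "emeasure \<mu> D < \<infinity>" using Icc[of "Inf D" "Sup D"] c(1)[OF that] by (auto simp: less_top[symmetric] top_unique)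
      qed
      have bd: "measure \<mu> (\<Union>E) \<le> \<epsilon>" if E: "E \<subseteq> components U" "finite E" for E
      proof -
        define S where "S = (\<lambda>c. (Inf c, Sup c)) ` E"
        have ends: "c = d" if "c \<in> E" "d \<in> E" "Inf c < Sup d" "Inf d < Sup c" for c d
        proof -
          have "max (Inf c) (Inf d) < min (Sup c) (Sup d)"
            using that c(1)[OF subsetD[OF E(1) that(1)]] c(1)[OF subsetD[OF E(1) that(2)]] by simp
          then obtain x where "max (Inf c) (Inf d) < x" "x < min (Sup c) (Sup d)" using dense by blast
          hence x: "x \<in> {Inf c<..<Sup c}" "x \<in> {Inf d<..<Sup d}" by auto
          have cd: "c \<in> components U" "d \<in> components U" using that E(1) by auto
          have "x \<in> c" "x \<in> d" using subsetD[OF c(2)[OF cd(1)] x(1)] subsetD[OF c(2)[OF cd(2)] x(2)] .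
          thus ?thesis using components_nonoverlap[OF cd] by blast
        qed
        have S: "S \<in> interval_families l u"
        proof (rule interval_families_I)
          show "l \<le> a \<and> a < b \<and> b \<le> u" if ab: "(a, b) \<in> S" for a b
          proof -
            obtain d where d: "d \<in> E" "a = Inf d" "b = Sup d" using ab by (auto simp: S_def)
            hence "d \<in> components U" using E(1) by blast
            thus ?thesis using c(1,4,5)[of d] d by simp
          qed
          show "b \<le> p \<or> q \<le> a" if ab: "(a, b) \<in> S" and pq: "(p, q) \<in> S" and ne: "(a, b) \<noteq> (p, q)" for a b p q
          proof -
            obtain c where c: "c \<in> E" "a = Inf c" "b = Sup c" using ab by (auto simp: S_def)
            obtain d where d: "d \<in> E" "p = Inf d" "q = Sup d" using pq by (auto simp: S_def)
            show ?thesis using ends[OF c(1) d(1)] ne c d by (metis not_le)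
          qed
        qed (use E in \<open>simp add: S_def\<close>)
        have inj: "inj_on (\<lambda>c. (Inf c, Sup c)) E"
        proof (rule inj_onI)
          fix c d assume *: "c \<in> E" "d \<in> E" "(Inf c, Sup c) = (Inf d, Sup d)"
          thus "c = d" using ends[of c d] c(1)[OF subsetD[OF E(1) *(1)]] by simp
        qed
        have "ennreal (total_length S) = (\<Sum>c\<in>E. emeasure lborel {Inf c<..<Sup c})"
        proof -
          have "(\<Sum>c\<in>E. emeasure lborel {Inf c<..<Sup c}) = (\<Sum>c\<in>E. ennreal (Sup c - Inf c))"
            using c(1) E(1) by (intro sum.cong) (auto simp: less_imp_le)
          also have "\<dots> = ennreal (\<Sum>c\<in>E. Sup c - Inf c)"
            using c(1) E(1) by (intro sum_ennreal) (auto simp: less_imp_le)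
          finally show ?thesis unfolding total_length_def S_def using inj by (simp add: sum.reindex)
        qed
        also have "\<dots> = emeasure lborel (\<Union>c\<in>E. {Inf c<..<Sup c})"
        proof (rule sum_emeasure)
          have "{Inf c<..<Sup c} \<inter> {Inf d<..<Sup d} = {}" if "c \<in> E" "d \<in> E" "c \<noteq> d" for c d
            using ends[OF that(1,2)] that(3) by (intro equals0I) auto
          thus "disjoint_family_on (\<lambda>c. {Inf c<..<Sup c}) E"
            unfolding disjoint_family_on_def by blast
        qed (use E(2) in auto)
        also have "\<dots> \<le> emeasure lborel U"
        proof (rule emeasure_mono)
          show "(\<Union>c\<in>E. {Inf c<..<Sup c}) \<subseteq> U"
          proof (rule UN_least)
            fix d assume "d \<in> E"
            hence d: "d \<in> components U" using E(1) by blast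
            show "{Inf d<..<Sup d} \<subseteq> U" using c(2,7)[OF d] by blast
          qed
        qed (use U(1) in simp)
        also have "\<dots> < ennreal \<delta>" by fact
        finally have "total_length S < \<delta>"
          by (metis ennreal_leI linorder_not_less)
        hence osc: "oscillation w S < \<epsilon>" by (rule \<delta>[OF S])
        have "measure \<mu> (\<Union>E) \<le> (\<Sum>c\<in>E. measure \<mu> c)"
          using E meas by (intro measure_Union_le) (auto simp del: sets_\<mu> dest: fmeasurableD)
        also have "\<dots> \<le> (\<Sum>c\<in>E. w (Sup c) - w (Inf c))"
        proof (intro sum_mono)
          fix d assume "d \<in> E"
          hence d: "d \<in> components U" using E by auto
          have em: "emeasure \<mu> {Inf d..Sup d} = ennreal (w (Sup d) - w (Inf d))"
            using Icc[of "Inf d" "Sup d"] c[OF d] W_eq by simp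
          have nn: "0 \<le> w (Sup d) - w (Inf d)" using mono c[OF d] by simp
          have "measure \<mu> d \<le> measure \<mu> {Inf d..Sup d}"
            using c(3,6)[OF d] em by (intro measure_mono_fmeasurable fmeasurableI) auto
          also have "\<dots> = w (Sup d) - w (Inf d)" using em nn by (simp add: measure_def)
          finally show "measure \<mu> d \<le> w (Sup d) - w (Inf d)" .
        qed
        also have "\<dots> \<le> oscillation w S"
          unfolding oscillation_def S_def using inj by (simp add: sum.reindex sum_mono)
        finally show ?thesis using osc by simp
      qed
    have "\<Union>(components U) \<in> fmeasurable \<mu>" "measure \<mu> (\<Union>(components U)) \<le> \<epsilon>"
      using fmeasurable_Union_bound[OF cnt meas bd] measure_Union_bound[OF cnt meas bd] by blast+
    thus ?thesis
      using emeasure_eq_measure2[of U \<mu>] by (simp add: ennreal_leI)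
  qed
  have ac: "absolutely_continuous lborel \<mu>"
    unfolding absolutely_continuous_def
  proof
    fix N :: "real set" assume N: "N \<in> null_sets lborel"
    hence [measurable]: "N \<in> sets borel" by auto
    have inner: "N \<inter> {l<..<u} \<in> null_sets \<mu>"
    proof -
      have "emeasure \<mu> (N \<inter> {l<..<u}) \<le> 0"
      proof (rule ennreal_le_epsilon)
        fix e :: real assume "0 < e"
        obtain \<delta> where \<delta>: "\<delta> > 0" "\<And>S. S \<in> interval_families l u \<Longrightarrow> total_length S < \<delta> \<Longrightarrow> oscillation w S < e"
          using AC \<open>0 < e\<close> unfolding AC_on_def by meson
        obtain T where T: "open T" "N \<subseteq> T" "emeasure lborel (T - N) < ennreal \<delta>"
          using outer_regular_lborel[of N \<delta>] \<delta>(1) by auto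
        have "emeasure lborel T = emeasure lborel ((T - N) \<union> N)" using T(2) by (simp add: Un_absorb2)
        also have "\<dots> = emeasure lborel (T - N)" using N T(1) by (intro emeasure_Un_null_set) auto
        finally have "emeasure lborel T < ennreal \<delta>" using T(3) by simp
        moreover have "emeasure lborel (T \<inter> {l<..<u}) \<le> emeasure lborel T"
          using T(1) by (intro emeasure_mono) auto
        ultimately have "emeasure \<mu> (T \<inter> {l<..<u}) \<le> ennreal e"
          using T(1) \<delta>(2) by (intro open_le[of _ \<delta>]) (auto intro: open_Int)
        moreover have "emeasure \<mu> (N \<inter> {l<..<u}) \<le> emeasure \<mu> (T \<inter> {l<..<u})"
          using T by (intro emeasure_mono) auto
        ultimately show "emeasure \<mu> (N \<inter> {l<..<u}) \<le> 0 + ennreal e" by simp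
      qed
      thus ?thesis by (auto simp: null_sets_def)
    qed
    have lo: "{l - real n..l} \<in> null_sets \<mu>" for n
      using Icc[of "l - real n" l] lu by (auto simp: null_sets_def W_def min_def max_def)
    have hi: "{u..u + real n} \<in> null_sets \<mu>" for n
      using Icc[of u "u + real n"] lu by (auto simp: null_sets_def W_def min_def max_def)
    have null: "N \<inter> {l<..<u} \<union> (\<Union>n. {l - real n..l}) \<union> (\<Union>n. {u..u + real n}) \<in> null_sets \<mu>"
      using inner lo hi by (intro null_sets.Un null_sets_UN) auto
    have "N \<subseteq> N \<inter> {l<..<u} \<union> (\<Union>n. {l - real n..l}) \<union> (\<Union>n. {u..u + real n})"
    proof
      fix x assume "x \<in> N"
      obtain n m :: nat where "l - x \<le> real n" "x - u \<le> real m" using real_arch_simple by metis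
      hence "x \<in> {l<..<u} \<or> x \<in> {l - real n..l} \<or> x \<in> {u..u + real m}" by auto
      thus "x \<in> N \<inter> {l<..<u} \<union> (\<Union>n. {l - real n..l}) \<union> (\<Union>n. {u..u + real n})"
        using \<open>x \<in> N\<close> by blast
    qed
    thus "N \<in> null_sets \<mu>" by (intro null_sets_subset[OF null]) auto
  qed
  obtain g0 where g0: "g0 \<in> borel_measurable lborel" "density lborel g0 = \<mu>"
    using sigma_finite_measure.Radon_Nikodym[OF sigma_finite_lborel ac] by auto
  have [measurable]: "g0 \<in> borel_measurable borel" using g0(1) by simp
  define g where "g t = indicator {l..u} t * enn2real (g0 t)" for t
  have [measurable]: "g \<in> borel_measurable borel" unfolding g_def by measurable
  have g_nn: "g t \<ge> 0" for t by (auto simp: g_def)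
  have int0: "(\<integral>\<^sup>+t. g0 t * indicator {x..y} t \<partial>lborel) = ennreal (w y - w x)" if "l \<le> x" "x \<le> y" "y \<le> u" for x y
    using Icc[of x y] that W_eq by (simp add: g0(2)[symmetric] emeasure_density)
  have fin: "AE t in lborel. g0 t * indicator {l..u} t \<noteq> \<infinity>"
    using int0[of l u] lu by (intro nn_integral_PInf_AE) auto
  have int: "(\<integral>\<^sup>+t. ennreal (g t) * indicator {x..y} t \<partial>lborel) = ennreal (w y - w x)" if "l \<le> x" "x \<le> y" "y \<le> u" for x y
  proof -
    have "(\<integral>\<^sup>+t. ennreal (g t) * indicator {x..y} t \<partial>lborel) = (\<integral>\<^sup>+t. g0 t * indicator {x..y} t \<partial>lborel)"
      using fin by (intro nn_integral_cong_AE, eventually_elim)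
        (use that in \<open>auto simp: g_def less_top split: split_indicator\<close>)
    thus ?thesis using int0[OF that] by simp
  qed
  have g_int: "integrable lborel g"
  proof (rule integrableI_nonneg)
    have "(\<integral>\<^sup>+t. ennreal (g t) \<partial>lborel) = (\<integral>\<^sup>+t. ennreal (g t) * indicator {l..u} t \<partial>lborel)"
      by (intro nn_integral_cong) (auto simp: g_def split: split_indicator)
    thus "(\<integral>\<^sup>+t. ennreal (g t) \<partial>lborel) < \<infinity>" using int[of l u] lu by simp
  qed (use g_nn in auto)
  show ?thesis
  proof (rule that[OF g_int])
    fix x y assume xy: "l \<le> x" "x \<le> y" "y \<le> u"
    have "ennreal (LINT t:{x..y}|lborel. g t) = (\<integral>\<^sup>+t. ennreal (indicator {x..y} t *\<^sub>R g t) \<partial>lborel)"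
      unfolding set_lebesgue_integral_def using g_int g_nn
      by (intro nn_integral_eq_integral[symmetric] integrable_mult_indicator) auto
    also have "\<dots> = (\<integral>\<^sup>+t. ennreal (g t) * indicator {x..y} t \<partial>lborel)"
      by (intro nn_integral_cong) (auto split: split_indicator)
    also have "\<dots> = ennreal (w y - w x)" by (rule int[OF xy])
    finally show "w y - w x = (LINT t:{x..y}|lborel. g t)"
      using mono[OF xy] g_nn unfolding set_lebesgue_integral_def
      by (subst (asm) ennreal_inj) (auto intro!: Bochner_Integration.integral_nonneg)
  qed
qed

lemma AC_on_dominated:
  assumes "AC_on l u f"
    and le: "\<And>x y. l \<le> x \<Longrightarrow> x \<le> y \<Longrightarrow> y \<le> u \<Longrightarrow> norm (h y - h x) \<le> c * norm (f y - f x)" and "c > 0"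
  shows "AC_on l u h"
  unfolding AC_on_def
proof (intro allI impI)
  fix e :: real assume "e > 0"
  obtain \<delta> where \<delta>: "\<delta> > 0" "\<And>S. S \<in> interval_families l u \<Longrightarrow> total_length S < \<delta> \<Longrightarrow> oscillation f S < e / c"
    using assms(1)[unfolded AC_on_def, rule_format, of "e / c"] \<open>e > 0\<close> \<open>c > 0\<close> by auto
  have "oscillation h S < e" if S: "S \<in> interval_families l u" "total_length S < \<delta>" for S
  proof -
    have "oscillation h S \<le> c * oscillation f S"
      unfolding oscillation_def sum_distrib_left
    proof (rule sum_mono)
      fix i assume "i \<in> S"
      then obtain a b where i: "i = (a, b)" "(a, b) \<in> S" by (cases i) auto
      show "(case i of (a, b) \<Rightarrow> norm (h b - h a)) \<le> c * (case i of (a, b) \<Rightarrow> norm (f b - f a))"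
        using le[of a b] interval_families_D(2)[OF S(1) i(2)] by (simp add: i(1))
    qed
    also have "\<dots> < e" using \<delta>(2)[OF S] \<open>c > 0\<close> by (simp add: field_simps)
    finally show ?thesis .
  qed
  thus "\<exists>\<delta>>0. \<forall>S\<in>interval_families l u. total_length S < \<delta> \<longrightarrow> oscillation h S < e"
    using \<delta>(1) by blast
qed

lemma absolutely_continuous_fun_imp_AC_on:
  assumes "absolutely_continuous_fun l u f"
  shows "AC_on l u f"
  unfolding AC_on_def
proof (intro allI impI)
  fix e :: real assume "e > 0"
  then obtain \<delta> where \<delta>: "\<delta> > 0" "\<And>(n::nat) a b. (\<forall>i<n. l \<le> a i \<and> a i \<le> b i \<and> b i \<le> u) \<Longrightarrow>
        disjoint_family_on (\<lambda>i. {a i<..<b i}) {..<n} \<Longrightarrow>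
        (\<Sum>i<n. b i - a i) < \<delta> \<Longrightarrow> (\<Sum>i<n. norm (f (b i) - f (a i))) < e"
    using assms[unfolded absolutely_continuous_fun_def, rule_format, of e] by blast
  have "oscillation f S < e" if S: "S \<in> interval_families l u" "total_length S < \<delta>" for S
  proof -
    note D = interval_families_D[OF S(1)]
    obtain h where h: "bij_betw h {..<card S} S"
      using ex_bij_betw_nat_finite[OF D(1)] by (auto simp: atLeast0LessThan)
    have hS: "(fst (h i), snd (h i)) \<in> S" if "i < card S" for i
      using bij_betwE[OF h] that by simp
    have sum: "(\<Sum>i<card S. k (h i)) = sum k S" for k :: "real \<times> real \<Rightarrow> real"
      using sum.reindex_bij_betw[OF h] .
    have "(\<Sum>i<card S. norm (f (snd (h i)) - f (fst (h i)))) < e"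
    proof (rule \<delta>(2))
      show "\<forall>i<card S. l \<le> fst (h i) \<and> fst (h i) \<le> snd (h i) \<and> snd (h i) \<le> u"
        using D(2)[OF hS] by (simp add: less_imp_le)
      show "(\<Sum>i<card S. snd (h i) - fst (h i)) < \<delta>"
        using S(2) sum[of "\<lambda>i. snd i - fst i"] by (simp add: total_length_def case_prod_unfold)
      have "{fst (h i)<..<snd (h i)} \<inter> {fst (h j)<..<snd (h j)} = {}"
        if ij: "i < card S" "j < card S" "i \<noteq> j" for i j
      proof -
        have "h i \<noteq> h j" using h ij by (auto simp: bij_betw_def inj_on_def)
        hence "(fst (h i), snd (h i)) \<noteq> (fst (h j), snd (h j))" by simp
        from D(3)[OF hS[OF ij(1)] hS[OF ij(2)] this] show ?thesis by (intro equals0I) auto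
      qed
      thus "disjoint_family_on (\<lambda>i. {fst (h i)<..<snd (h i)}) {..<card S}"
        unfolding disjoint_family_on_def by blast
    qed
    thus ?thesis using sum[of "\<lambda>i. norm (f (snd i) - f (fst i))"]
      by (simp add: oscillation_def case_prod_unfold)
  qed
  thus "\<exists>\<delta>>0. \<forall>S\<in>interval_families l u. total_length S < \<delta> \<longrightarrow> oscillation f S < e"
    using \<delta>(1) by blast
qed

text \<open>
  With \<open>V\<close> the variation of \<open>f\<close>, both \<open>V\<close> and \<open>V - f\<close> are increasing and absolutely continuous, and
  \<open>f\<close> is their difference.
\<close>

lemma AC_on_real_has_density:
  fixes f :: "real \<Rightarrow> real"
  assumes AC: "AC_on l u f" and "l < u"
  obtains g where "integrable lborel g"
    "\<And>x y. l \<le> x \<Longrightarrow> x \<le> y \<Longrightarrow> y \<le> u \<Longrightarrow> f y - f x = (LINT t:{x..y}|lborel. g t)"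
proof -
  define V where "V = variation f l"
  have V: "\<bar>f y - f x\<bar> \<le> V y - V x" if "l \<le> x" "x \<le> y" "y \<le> u" for x y
    using norm_diff_le_variation[OF AC that] by (simp add: V_def)
  have ACV: "AC_on l u V" unfolding V_def by (rule AC_on_variation[OF AC])
  have ACW: "AC_on l u (\<lambda>x. V x - f x)"
  proof (rule AC_on_dominated[OF ACV])
    show "norm ((V y - f y) - (V x - f x)) \<le> 2 * norm (V y - V x)" if "l \<le> x" "x \<le> y" "y \<le> u" for x y
    proof -
      have "0 \<le> V y - V x" using V[OF that] by linarith
      thus ?thesis using V[OF that] unfolding real_norm_def abs_of_nonneg[OF \<open>0 \<le> V y - V x\<close>] abs_le_iff
        by auto
    qed
  qed auto
  have mono: "V x \<le> V y" "V x - f x \<le> V y - f y" if "l \<le> x" "x \<le> y" "y \<le> u" for x y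
    using V[OF that] by linarith+
  obtain g1 where g1: "integrable lborel g1"
      "\<And>x y. l \<le> x \<Longrightarrow> x \<le> y \<Longrightarrow> y \<le> u \<Longrightarrow> V y - V x = (LINT t:{x..y}|lborel. g1 t)"
    using mono_AC_on_has_density[OF ACV mono(1) \<open>l < u\<close>] by blast
  obtain g2 where g2: "integrable lborel g2"
      "\<And>x y. l \<le> x \<Longrightarrow> x \<le> y \<Longrightarrow> y \<le> u \<Longrightarrow> (V y - f y) - (V x - f x) = (LINT t:{x..y}|lborel. g2 t)"
    using mono_AC_on_has_density[OF ACW mono(2) \<open>l < u\<close>] by blast
  show ?thesis
  proof (rule that)
    show "integrable lborel (\<lambda>t. g1 t - g2 t)" using g1(1) g2(1) by simp
    show "f y - f x = (LINT t:{x..y}|lborel. g1 t - g2 t)" if "l \<le> x" "x \<le> y" "y \<le> u" for x y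
      using g1(2)[OF that] g2(2)[OF that]
      by (simp add: set_integral_diff(2)[OF set_integrable_Icc[OF g1(1)] set_integrable_Icc[OF g2(1)]])
  qed
qed

text \<open>
  The fundamental theorem of calculus for absolutely continuous functions, applied to real and
  imaginary part separately.
\<close>

theorem AC_on_FTC:
  fixes f :: "real \<Rightarrow> complex"
  assumes AC: "AC_on l u f" and "l < u"
  obtains g where "integrable lborel g"
    "\<And>x y. l \<le> x \<Longrightarrow> x \<le> y \<Longrightarrow> y \<le> u \<Longrightarrow> f y - f x = (LINT t:{x..y}|lborel. g t)"
    "AE x in lborel. x \<in> {l<..<u} \<longrightarrow> (f has_vector_derivative g x) (at x)"
proof -
  have "AC_on l u (\<lambda>x. Re (f x))"
    by (rule AC_on_dominated[OF AC, where c = 1]) (auto simp: abs_Re_le_cmod simp flip: minus_complex.simps)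
  then obtain g1 where g1: "integrable lborel g1"
      "\<And>x y. l \<le> x \<Longrightarrow> x \<le> y \<Longrightarrow> y \<le> u \<Longrightarrow> Re (f y) - Re (f x) = (LINT t:{x..y}|lborel. g1 t)"
    using AC_on_real_has_density \<open>l < u\<close> by blast
  have "AC_on l u (\<lambda>x. Im (f x))"
    by (rule AC_on_dominated[OF AC, where c = 1]) (auto simp: abs_Im_le_cmod simp flip: minus_complex.simps)
  then obtain g2 where g2: "integrable lborel g2"
      "\<And>x y. l \<le> x \<Longrightarrow> x \<le> y \<Longrightarrow> y \<le> u \<Longrightarrow> Im (f y) - Im (f x) = (LINT t:{x..y}|lborel. g2 t)"
    using AC_on_real_has_density \<open>l < u\<close> by blast
  define g where "g t = of_real (g1 t) + \<i> * of_real (g2 t)" for t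
  have g: "integrable lborel g" unfolding g_def using g1(1) g2(1) by auto
  show ?thesis
  proof (rule that[OF g])
    fix x y assume xy: "l \<le> x" "x \<le> y" "y \<le> u"
    note I1 = set_integrable_Icc[OF g1(1), of x y] and I2 = set_integrable_Icc[OF g2(1), of x y]
    have "(LINT t:{x..y}|lborel. g t) =
       (LINT t:{x..y}|lborel. of_real (g1 t)) + (LINT t:{x..y}|lborel. \<i> * of_real (g2 t))"
      unfolding g_def by (intro set_integral_add set_integrable_Icc) (use g1(1) g2(1) in auto)
    also have "\<dots> = of_real (LINT t:{x..y}|lborel. g1 t) + \<i> * of_real (LINT t:{x..y}|lborel. g2 t)"
      by (simp add: set_integral_complex_of_real)
    also have "\<dots> = f y - f x" using g1(2)[OF xy] g2(2)[OF xy] by (simp add: complex_eq_iff)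
    finally show "f y - f x = (LINT t:{x..y}|lborel. g t)" by simp
  next
    have "AE x in lborel. x \<in> {l<..<u} \<longrightarrow> ((\<lambda>x. Re (f x)) has_real_derivative g1 x) (at x)"
      by (rule Lebesgue_differentiation_real[OF g1(1)]) (use g1(2) in auto)
    moreover have "AE x in lborel. x \<in> {l<..<u} \<longrightarrow> ((\<lambda>x. Im (f x)) has_real_derivative g2 x) (at x)"
      by (rule Lebesgue_differentiation_real[OF g2(1)]) (use g2(2) in auto)
    ultimately show "AE x in lborel. x \<in> {l<..<u} \<longrightarrow> (f has_vector_derivative g x) (at x)"
    proof eventually_elim
      case (elim x)
      show ?case
      proof
        assume x: "x \<in> {l<..<u}"
        have "((\<lambda>x. of_real (Re (f x)) + \<i> * of_real (Im (f x))) has_vector_derivative g x) (at x)"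
          unfolding g_def using elim x
          by (intro has_vector_derivative_add has_vector_derivative_mult_right has_vector_derivative_of_real) auto
        thus "(f has_vector_derivative g x) (at x)" by (simp flip: complex_eq)
      qed
    qed
  qed
qed

section \<open>Integration by parts\<close>

lemma AC_on_mult:
  fixes f g :: "real \<Rightarrow> 'a::real_normed_algebra"
  assumes f: "AC_on l u f" and g: "AC_on l u g"
  shows "AC_on l u (\<lambda>x. f x * g x)"
  unfolding AC_on_def
proof (intro allI impI)
  fix e :: real assume "e > 0"
  have bnd: "bounded (h ` {l..u})" if "AC_on l u h" for h :: "real \<Rightarrow> 'a"
    by (intro compact_imp_bounded compact_continuous_image AC_on_imp_continuous that compact_Icc)
  obtain M1 where M1: "M1 > 0" "\<And>x. x \<in> {l..u} \<Longrightarrow> norm (f x) \<le> M1"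
    using bnd[OF f] unfolding bounded_pos by blast
  obtain M2 where M2: "M2 > 0" "\<And>x. x \<in> {l..u} \<Longrightarrow> norm (g x) \<le> M2"
    using bnd[OF g] unfolding bounded_pos by blast
  obtain d1 where d1: "d1 > 0" "\<And>S. S \<in> interval_families l u \<Longrightarrow> total_length S < d1 \<Longrightarrow> oscillation f S < e / (2 * M2)"
    using f[unfolded AC_on_def, rule_format, of "e / (2 * M2)"] \<open>e > 0\<close> M2(1) by auto
  obtain d2 where d2: "d2 > 0" "\<And>S. S \<in> interval_families l u \<Longrightarrow> total_length S < d2 \<Longrightarrow> oscillation g S < e / (2 * M1)"
    using g[unfolded AC_on_def, rule_format, of "e / (2 * M1)"] \<open>e > 0\<close> M1(1) by auto
  show "\<exists>d>0. \<forall>S\<in>interval_families l u. total_length S < d \<longrightarrow> oscillation (\<lambda>x. f x * g x) S < e"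
  proof (intro exI[of _ "min d1 d2"] conjI ballI impI)
    fix S assume S: "S \<in> interval_families l u" "total_length S < min d1 d2"
    have "oscillation (\<lambda>x. f x * g x) S \<le> M2 * oscillation f S + M1 * oscillation g S"
      unfolding oscillation_def sum_distrib_left sum.distrib[symmetric]
    proof (rule sum_mono)
      fix i assume "i \<in> S"
      then obtain a b where i: "i = (a, b)" "(a, b) \<in> S" by (cases i) auto
      have ab: "a \<in> {l..u}" "b \<in> {l..u}" using interval_families_D(2)[OF S(1) i(2)] by auto
      have "f b * g b - f a * g a = (f b - f a) * g b + f a * (g b - g a)" by (simp add: algebra_simps)
      also have "norm \<dots> \<le> norm (f b - f a) * norm (g b) + norm (f a) * norm (g b - g a)"
        by (intro norm_triangle_le add_mono norm_mult_ineq)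
      also have "\<dots> \<le> norm (f b - f a) * M2 + M1 * norm (g b - g a)"
        by (intro add_mono mult_left_mono mult_right_mono M1 M2 ab) auto
      finally show "(case i of (a, b) \<Rightarrow> norm (f b * g b - f a * g a)) \<le>
         M2 * (case i of (a, b) \<Rightarrow> norm (f b - f a)) + M1 * (case i of (a, b) \<Rightarrow> norm (g b - g a))"
        by (simp add: i(1) mult.commute)
    qed
    also have "\<dots> < e / 2 + e / 2"
    proof (rule add_strict_mono)
      show "M2 * oscillation f S < e / 2" using d1(2)[OF S(1)] S(2) M2(1) by (simp add: field_simps)
      show "M1 * oscillation g S < e / 2" using d2(2)[OF S(1)] S(2) M1(1) by (simp add: field_simps)
    qed
    finally show "oscillation (\<lambda>x. f x * g x) S < e" by simp
  qed (use d1 d2 in auto)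
qed

lemma AC_on_ident: "AC_on l u (\<lambda>x::real. x)"
  unfolding AC_on_def
proof (intro allI impI)
  fix e :: real assume "e > 0"
  have "oscillation (\<lambda>x. x) S = total_length S" if "S \<in> interval_families l u" for S
    unfolding oscillation_def total_length_def
    using interval_families_D(2)[OF that] by (intro sum.cong refl) (auto simp: less_imp_le)
  thus "\<exists>d>0. \<forall>S\<in>interval_families l u. total_length S < d \<longrightarrow> oscillation (\<lambda>x. x) S < e"
    using \<open>e > 0\<close> by (intro exI[of _ e]) simp
qed

lemma C1_imp_AC_on:
  fixes H H' :: "real \<Rightarrow> real"
  assumes H: "\<And>t. (H has_real_derivative H' t) (at t)" and H': "continuous_on {l..u} H'"
  shows "AC_on l u H"
proof -
  have "bounded (H' ` {l..u})" by (intro compact_imp_bounded compact_continuous_image H' compact_Icc)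
  then obtain L where L: "L > 0" "\<And>x. x \<in> {l..u} \<Longrightarrow> norm (H' x) \<le> L"
    unfolding bounded_pos by blast
  show ?thesis
  proof (rule AC_on_dominated[OF AC_on_ident _ L(1)])
    fix x y assume "l \<le> x" "x \<le> y" "y \<le> u"
    thus "norm (H y - H x) \<le> L * norm (y - x)"
      using L(2) by (intro field_differentiable_bound[of "{l..u}" H H'])
        (auto intro: has_field_derivative_at_within H)
  qed
qed

text \<open>
  The product \<open>H \<phi>\<close> is again absolutely continuous, and by the product rule its almost everywhere
  derivative is \<open>H' \<phi> + H g\<close>; the fundamental theorem applied to the product gives the formula.
\<close>

lemma AC_on_integration_by_parts:
  fixes \<phi> g :: "real \<Rightarrow> complex" and H H' :: "real \<Rightarrow> real"
  assumes \<phi>: "AC_on l u \<phi>" and lu: "l < u"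
    and g: "integrable lborel g" "AE x in lborel. x \<in> {l<..<u} \<longrightarrow> (\<phi> has_vector_derivative g x) (at x)"
    and H: "\<And>t. (H has_real_derivative H' t) (at t)" and H': "continuous_on {l..u} H'"
  shows "(LINT t:{l..u}|lborel. of_real (H' t) * \<phi> t) =
     of_real (H u) * \<phi> u - of_real (H l) * \<phi> l - (LINT t:{l..u}|lborel. of_real (H t) * g t)"
    and "set_integrable lborel {l..u} (\<lambda>t. of_real (H t) * g t)"
proof -
  have "AC_on l u (\<lambda>t. complex_of_real (H t))"
    by (rule AC_on_dominated[OF C1_imp_AC_on[OF H H'], where c = 1]) (simp_all flip: of_real_diff)
  hence AC: "AC_on l u (\<lambda>t. of_real (H t) * \<phi> t)" using \<phi> by (rule AC_on_mult)
  obtain k where k: "integrable lborel k"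
      "\<And>x y. l \<le> x \<Longrightarrow> x \<le> y \<Longrightarrow> y \<le> u \<Longrightarrow> of_real (H y) * \<phi> y - of_real (H x) * \<phi> x = (LINT t:{x..y}|lborel. k t)"
      "AE x in lborel. x \<in> {l<..<u} \<longrightarrow> ((\<lambda>t. of_real (H t) * \<phi> t) has_vector_derivative k x) (at x)"
    using AC_on_FTC[OF AC lu] by blast
  have contH: "continuous_on A H" for A
    using H by (meson DERIV_continuous_on has_field_derivative_at_within)
  have [measurable]: "H \<in> borel_measurable borel" using contH by (rule borel_measurable_continuous_onI)
  have [measurable]: "g \<in> borel_measurable borel" using g(1) by auto
  have "bounded (H ` {l..u})" by (intro compact_imp_bounded compact_continuous_image contH compact_Icc)
  then obtain M where M: "\<And>x. x \<in> {l..u} \<Longrightarrow> norm (H x) \<le> M" unfolding bounded_pos by blast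
  show Hg: "set_integrable lborel {l..u} (\<lambda>t. of_real (H t) * g t)"
    unfolding set_integrable_def
  proof (rule Bochner_Integration.integrable_bound)
    show "integrable lborel (\<lambda>t. M * norm (g t))" using g(1) by auto
    show "AE t in lborel. norm (indicat_real {l..u} t *\<^sub>R (complex_of_real (H t) * g t)) \<le> norm (M * norm (g t))"
    proof (rule AE_I2)
      fix t show "norm (indicat_real {l..u} t *\<^sub>R (complex_of_real (H t) * g t)) \<le> norm (M * norm (g t))"
        using M[of t] by (auto simp: norm_mult indicator_def abs_mult intro!: mult_right_mono)
    qed
  qed measurable
  have cont: "continuous_on {l..u} (\<lambda>t. of_real (H' t) * \<phi> t)"
    by (intro continuous_intros H' AC_on_imp_continuous[OF \<phi>])
  have H'\<phi>: "set_integrable lborel {l..u} (\<lambda>t. of_real (H' t) * \<phi> t)"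
    using cont by (rule borel_integrable_atLeastAtMost')
  have "finite {l, u}" by simp
  hence "AE t in lborel. t \<notin> {l, u}" by (intro AE_not_in finite_imp_null_set_lborel)
  hence ae: "AE t in lborel. indicat_real {l..u} t *\<^sub>R (of_real (H' t) * \<phi> t + of_real (H t) * g t) = indicat_real {l..u} t *\<^sub>R k t"
    using g(2) k(3)
  proof eventually_elim
    case (elim t)
    show ?case
    proof (cases "t \<in> {l<..<u}")
      case True
      have "((\<lambda>t. of_real (H t) * \<phi> t) has_vector_derivative (of_real (H t) * g t + of_real (H' t) * \<phi> t)) (at t)"
        using elim True H[of t] by (intro has_vector_derivative_mult has_vector_derivative_of_real)
          (auto simp: has_real_derivative_iff_has_vector_derivative)
      hence "of_real (H' t) * \<phi> t + of_real (H t) * g t = k t"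
        using elim True by (metis add.commute vector_derivative_unique_at)
      thus ?thesis by simp
    next
      case False
      hence "t \<notin> {l..u}" using elim by auto
      thus ?thesis by simp
    qed
  qed
  have "(LINT t:{l..u}|lborel. of_real (H' t) * \<phi> t) + (LINT t:{l..u}|lborel. of_real (H t) * g t)
      = (LINT t:{l..u}|lborel. of_real (H' t) * \<phi> t + of_real (H t) * g t)"
    by (rule set_integral_add(2)[OF H'\<phi> Hg, symmetric])
  also have "\<dots> = (LINT t:{l..u}|lborel. k t)"
  proof -
    have "set_integrable lborel {l..u} (\<lambda>t. of_real (H' t) * \<phi> t + of_real (H t) * g t)"
      by (rule set_integral_add(1)[OF H'\<phi> Hg])
    thus ?thesis unfolding set_lebesgue_integral_def set_integrable_def
      using ae k(1) by (intro integral_cong_AE) (auto intro!: borel_measurable_scaleR)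
  qed
  also have "\<dots> = of_real (H u) * \<phi> u - of_real (H l) * \<phi> l" using k(2)[of l u] lu by simp
  finally show "(LINT t:{l..u}|lborel. of_real (H' t) * \<phi> t) =
     of_real (H u) * \<phi> u - of_real (H l) * \<phi> l - (LINT t:{l..u}|lborel. of_real (H t) * g t)"
    by (simp add: algebra_simps)
qed

section \<open>The kernel and its derivatives\<close>

text \<open>
  The factor \<open>\<gamma>\<close> shared by the kernel derivative, its potential and the remainder; the kernel itself is
  \<open>1 - |z|\<^sup>2\<close> times it. The three definitions that follow are \<open>\<partial>\<^sub>u k\<close>, \<open>H\<^sub>u\<close> and \<open>R\<^sub>u\<close>.
\<close>

definition base_kernel :: "real \<Rightarrow> complex \<Rightarrow> complex \<Rightarrow> real" where
  "base_kernel \<alpha> \<zeta> z = (1 - (norm z)\<^sup>2) powr \<alpha> * norm (\<zeta> - z) powr - (\<alpha> + 2)"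

definition kernel_deriv :: "real \<Rightarrow> complex \<Rightarrow> complex \<Rightarrow> complex \<Rightarrow> real" where
  "kernel_deriv \<alpha> u \<zeta> z = base_kernel \<alpha> \<zeta> z *
     ((\<alpha> + 2) * (1 - (norm z)\<^sup>2) * ((\<zeta> - z) \<bullet> u) / (norm (\<zeta> - z))\<^sup>2 - 2 * (\<alpha> + 1) * (z \<bullet> u))"

definition kernel_potential :: "real \<Rightarrow> complex \<Rightarrow> complex \<Rightarrow> complex \<Rightarrow> real" where
  "kernel_potential \<alpha> u \<zeta> z = - 2 * Im (u * cnj (\<zeta> - z)) * base_kernel \<alpha> \<zeta> z"

definition kernel_remainder :: "real \<Rightarrow> complex \<Rightarrow> complex \<Rightarrow> complex \<Rightarrow> real" where
  "kernel_remainder \<alpha> u \<zeta> z = \<alpha> * ((\<zeta> - z) \<bullet> u) * base_kernel \<alpha> \<zeta> z"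

lemma norm_powr_eq: "norm (w :: 'a :: real_normed_vector) powr r = ((norm w)\<^sup>2) powr (r / 2)"
proof (cases "w = 0")
  case False
  thus ?thesis by (simp add: powr_powr flip: powr_numeral)
qed auto

lemma has_derivative_kernel:
  assumes z: "norm (z + of_real s * u) < 1" and \<zeta>: "norm \<zeta> = 1"
  shows "((\<lambda>s. (1 - (norm (z + of_real s * u))\<^sup>2) powr (\<alpha> + 1) * norm (\<zeta> - (z + of_real s * u)) powr - (\<alpha> + 2))
     has_real_derivative kernel_deriv \<alpha> u \<zeta> (z + of_real s * u)) (at s)"
proof -
  define d where "d s = 1 - (norm (z + of_real s * u))\<^sup>2" for s :: real
  define D where "D s = (norm (\<zeta> - (z + of_real s * u)))\<^sup>2" for s :: real
  have d: "(d has_real_derivative - 2 * ((z + of_real s * u) \<bullet> u)) (at s)"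
    unfolding d_def cmod_power2 inner_complex_def
    by (auto intro!: derivative_eq_intros simp: power2_eq_square algebra_simps)
  have D: "(D has_real_derivative - 2 * ((\<zeta> - (z + of_real s * u)) \<bullet> u)) (at s)"
    unfolding D_def cmod_power2 inner_complex_def
    by (auto intro!: derivative_eq_intros simp: power2_eq_square algebra_simps)
  have d_pos: "d s > 0" using z unfolding d_def
    by (metis abs_norm_cancel abs_square_less_1 diff_gt_0_iff_gt)
  have "\<zeta> \<noteq> z + of_real s * u" using z \<zeta> by auto
  hence D_pos: "D s > 0" by (simp add: D_def)
  have "((\<lambda>s. d s powr (\<alpha> + 1) * D s powr (- (\<alpha> + 2) / 2)) has_real_derivative
      ((\<alpha> + 1) * d s powr (\<alpha> + 1 - 1) * (- 2 * ((z + of_real s * u) \<bullet> u))) * D s powr (- (\<alpha> + 2) / 2) +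
      ((- (\<alpha> + 2) / 2) * D s powr (- (\<alpha> + 2) / 2 - 1) * (- 2 * ((\<zeta> - (z + of_real s * u)) \<bullet> u))) * d s powr (\<alpha> + 1)) (at s)"
    by (intro DERIV_mult has_real_derivative_powr[THEN DERIV_chain2] d D d_pos D_pos)
  moreover have "((\<alpha> + 1) * d s powr (\<alpha> + 1 - 1) * (- 2 * ((z + of_real s * u) \<bullet> u))) * D s powr (- (\<alpha> + 2) / 2) +
      ((- (\<alpha> + 2) / 2) * D s powr (- (\<alpha> + 2) / 2 - 1) * (- 2 * ((\<zeta> - (z + of_real s * u)) \<bullet> u))) * d s powr (\<alpha> + 1) =
      d s powr \<alpha> * D s powr (- (\<alpha> + 2) / 2) *
      ((\<alpha> + 2) * d s * ((\<zeta> - (z + of_real s * u)) \<bullet> u) / D s - 2 * (\<alpha> + 1) * ((z + of_real s * u) \<bullet> u))"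
  proof -
    have 1: "D s powr (- (\<alpha> + 2) / 2 - 1) = D s powr (- (\<alpha> + 2) / 2) / D s"
      using D_pos by (simp add: powr_diff)
    have 2: "d s powr (\<alpha> + 1) = d s powr \<alpha> * d s" "\<alpha> + 1 - 1 = \<alpha>" using d_pos by (simp_all add: powr_add)
    have alg: "((\<alpha> + 1) * a * (- 2 * X)) * P + ((- (\<alpha> + 2) / 2) * (P / E) * (- 2 * Y)) * (a * b) =
        a * P * ((\<alpha> + 2) * b * Y / E - 2 * (\<alpha> + 1) * X)" if "E > 0" for a b P X Y E :: real
      using that by (simp add: field_simps)
    show ?thesis unfolding 1 2 by (rule alg[OF D_pos])
  qed
  ultimately have "((\<lambda>s. d s powr (\<alpha> + 1) * D s powr (- (\<alpha> + 2) / 2)) has_real_derivative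
      d s powr \<alpha> * D s powr (- (\<alpha> + 2) / 2) *
      ((\<alpha> + 2) * d s * ((\<zeta> - (z + of_real s * u)) \<bullet> u) / D s - 2 * (\<alpha> + 1) * ((z + of_real s * u) \<bullet> u))) (at s)"
    by (rule DERIV_cong)
  thus ?thesis
    unfolding kernel_deriv_def base_kernel_def norm_powr_eq d_def D_def .
qed

text \<open>
  The identity \<open>\<partial>\<^sub>u k = \<partial>\<^sub>t H\<^sub>u + R\<^sub>u\<close> in coordinates \<open>\<zeta> = (c, s)\<close>, \<open>z = (x, y)\<close>, \<open>u = (p, q)\<close>, after
  division by \<open>\<gamma>\<close> and multiplication by \<open>D = |\<zeta> - z|\<^sup>2\<close>; the last factor is the \<open>t\<close>-derivative of \<open>D\<close>.
\<close>

lemma trigonometric_identity: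
  fixes c s x y p q \<alpha> :: real
  assumes "c\<^sup>2 + s\<^sup>2 = 1"
  defines "D \<equiv> (c - x)\<^sup>2 + (s - y)\<^sup>2"
  shows "(\<alpha> + 2) * (1 - (x\<^sup>2 + y\<^sup>2)) * ((c - x) * p + (s - y) * q) - 2 * (\<alpha> + 1) * (x * p + y * q) * D
     - \<alpha> * ((c - x) * p + (s - y) * q) * D
     = 2 * (q * s + p * c) * D + (\<alpha> + 2) * (q * (c - x) - p * (s - y)) * (2 * (x * s - y * c))"
  using assms(1) unfolding D_def by algebra

text \<open>
  The key identity: up to the remainder, which is smaller by a factor \<open>|\<zeta> - z|\<close>, every derivative of
  the kernel in the disc is a derivative along the circle.
\<close>

lemma has_derivative_kernel_potential:
  assumes z: "norm z < 1"
  shows "((\<lambda>t. kernel_potential \<alpha> u (cis t) z) has_real_derivative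
     kernel_deriv \<alpha> u (cis t) z - kernel_remainder \<alpha> u (cis t) z) (at t)"
proof -
  define x y p q where "x = Re z" and "y = Im z" and "p = Re u" and "q = Im u"
  define d where "d = 1 - (norm z)\<^sup>2"
  define D where "D t = (norm (cis t - z))\<^sup>2" for t :: real
  define I where "I t = q * (cos t - x) - p * (sin t - y)" for t :: real
  have D: "(D has_real_derivative 2 * (x * sin t - y * cos t)) (at t)"
    unfolding D_def cmod_power2 x_def y_def
    by (auto intro!: derivative_eq_intros simp: algebra_simps)
  have I: "((\<lambda>t. - 2 * I t) has_real_derivative 2 * (q * sin t + p * cos t)) (at t)"
    unfolding I_def by (auto intro!: derivative_eq_intros simp: algebra_simps)
  have "cis t \<noteq> z" using z by auto
  hence D_pos: "D t > 0" by (simp add: D_def)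
  let ?P = "D t powr (- (\<alpha> + 2) / 2)"
  have "((\<lambda>t. - 2 * I t * (d powr \<alpha> * D t powr (- (\<alpha> + 2) / 2))) has_real_derivative
     2 * (q * sin t + p * cos t) * (d powr \<alpha> * D t powr (- (\<alpha> + 2) / 2)) +
     d powr \<alpha> * ((- (\<alpha> + 2) / 2) * D t powr (- (\<alpha> + 2) / 2 - 1) * (2 * (x * sin t - y * cos t))) * (- 2 * I t)) (at t)"
    by (intro DERIV_mult DERIV_cmult has_real_derivative_powr[THEN DERIV_chain2] D I D_pos)
  moreover have "2 * (q * sin t + p * cos t) * (d powr \<alpha> * ?P) +
     d powr \<alpha> * ((- (\<alpha> + 2) / 2) * D t powr (- (\<alpha> + 2) / 2 - 1) * (2 * (x * sin t - y * cos t))) * (- 2 * I t) =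
     kernel_deriv \<alpha> u (cis t) z - kernel_remainder \<alpha> u (cis t) z" (is "?L = _")
  proof -
    have 1: "D t powr (- (\<alpha> + 2) / 2 - 1) = ?P / D t"
      using D_pos by (simp add: powr_diff)
    have alg: "X * (a * P) + a * ((- (\<alpha> + 2) / 2) * (P / E) * Y) * (- 2 * J) = a * P / E * (X * E + (\<alpha> + 2) * J * Y)"
      if "E > 0" for a P E X Y J :: real
      using that by (simp add: field_simps)
    have "?L = d powr \<alpha> * ?P / D t * (2 * (q * sin t + p * cos t) * D t + (\<alpha> + 2) * I t * (2 * (x * sin t - y * cos t)))"
      unfolding 1 by (rule alg[OF D_pos])
    also have "2 * (q * sin t + p * cos t) * D t + (\<alpha> + 2) * I t * (2 * (x * sin t - y * cos t)) =
       (\<alpha> + 2) * d * ((cis t - z) \<bullet> u) - 2 * (\<alpha> + 1) * (z \<bullet> u) * D t - \<alpha> * ((cis t - z) \<bullet> u) * D t"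
      using trigonometric_identity[of "cos t" "sin t" \<alpha> x y p q]
      unfolding I_def D_def d_def cmod_power2 inner_complex_def x_def y_def p_def q_def by simp
    also have "d powr \<alpha> * ?P / D t * \<dots> = kernel_deriv \<alpha> u (cis t) z - kernel_remainder \<alpha> u (cis t) z"
    proof -
      have alg: "a * P / E * (X - Y * E - Z * E) = a * P * (X / E - Y) - Z * (a * P)"
        if "E > 0" for a P E X Y Z :: real
        using that by (simp add: field_simps)
      show ?thesis
        unfolding kernel_deriv_def kernel_remainder_def base_kernel_def norm_powr_eq D_def[symmetric] d_def[symmetric]
        by (rule alg[OF D_pos])
    qed
    finally show ?thesis .
  qed
  ultimately have "((\<lambda>t. - 2 * I t * (d powr \<alpha> * D t powr (- (\<alpha> + 2) / 2))) has_real_derivative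
     kernel_deriv \<alpha> u (cis t) z - kernel_remainder \<alpha> u (cis t) z) (at t)"
    by (rule DERIV_cong)
  moreover have "kernel_potential \<alpha> u (cis t) z = - 2 * I t * (d powr \<alpha> * D t powr (- (\<alpha> + 2) / 2))" for t
    unfolding kernel_potential_def base_kernel_def norm_powr_eq D_def d_def I_def x_def y_def p_def q_def
    by (simp add: algebra_simps)
  ultimately show ?thesis by simp
qed

text \<open>
  Since \<open>1 - |z|\<^sup>2 = (1 - |z|) (1 + |z|) \<le> 2 |\<zeta> - z|\<close>, lowering the exponent from \<open>\<alpha>\<close> to \<open>\<beta>\<close> costs at
  most a factor \<open>2 powr (\<alpha> - \<beta>)\<close>. For \<open>\<alpha> = 0\<close> this replaces a kernel whose mean
  grows logarithmically towards the circle by one with bounded mean.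
\<close>

lemma base_kernel_bound:
  assumes z: "norm z < 1" and \<zeta>: "norm \<zeta> = 1" and \<beta>: "\<beta> \<le> \<alpha>" "\<alpha> \<le> \<beta> + 1"
  shows "norm (\<zeta> - z) * base_kernel \<alpha> \<zeta> z \<le> 2 * (1 - (norm z)\<^sup>2) powr \<beta> * norm (\<zeta> - z) powr - (\<beta> + 1)"
proof -
  define d w where "d = 1 - (norm z)\<^sup>2" and "w = norm (\<zeta> - z)"
  have d: "d > 0" unfolding d_def using z
    by (metis abs_norm_cancel abs_square_less_1 diff_gt_0_iff_gt)
  have w1: "1 - norm z \<le> w" unfolding w_def using norm_triangle_ineq2[of \<zeta> z] \<zeta> by simp
  have w: "w > 0" using w1 z by simp
  have "d = (1 - norm z) * (1 + norm z)" by (simp add: d_def power2_eq_square algebra_simps)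
  also have "\<dots> \<le> w * 2" using w1 z by (intro mult_mono) auto
  finally have dw: "d / w \<le> 2" using w by (simp add: field_simps)
  have "w * (d powr \<alpha> * w powr - (\<alpha> + 2)) = d powr \<alpha> * (w powr 1 * w powr - (\<alpha> + 2))" using w by simp
  also have "w powr 1 * w powr - (\<alpha> + 2) = w powr - (\<alpha> + 1)"
    by (simp only: powr_add[symmetric]) (simp add: algebra_simps)
  also have "d powr \<alpha> * w powr - (\<alpha> + 1) = (d / w) powr (\<alpha> - \<beta>) * (d powr \<beta> * w powr - (\<beta> + 1))"
    using d w by (simp add: powr_divide powr_diff powr_minus powr_add field_simps)
  also have "\<dots> \<le> 2 * (d powr \<beta> * w powr - (\<beta> + 1))"
  proof (rule mult_right_mono)
    have "(d / w) powr (\<alpha> - \<beta>) \<le> 2 powr (\<alpha> - \<beta>)"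
      using dw d w \<beta> by (intro powr_mono2) auto
    also have "\<dots> \<le> 2 powr 1" using \<beta> by (intro powr_mono) auto
    finally show "(d / w) powr (\<alpha> - \<beta>) \<le> 2" by simp
  qed auto
  finally show ?thesis by (simp add: base_kernel_def d_def w_def mult.assoc)
qed

lemma abs_kernel_potential_le: "\<bar>kernel_potential \<alpha> u \<zeta> z\<bar> \<le> 2 * norm u * (norm (\<zeta> - z) * base_kernel \<alpha> \<zeta> z)"
proof -
  have "\<bar>Im (u * cnj (\<zeta> - z))\<bar> \<le> norm u * norm (\<zeta> - z)"
    using abs_Im_le_cmod[of "u * cnj (\<zeta> - z)"] by (simp add: norm_mult del: complex_cnj_diff)
  hence "\<bar>Im (u * cnj (\<zeta> - z))\<bar> * base_kernel \<alpha> \<zeta> z \<le> norm u * norm (\<zeta> - z) * base_kernel \<alpha> \<zeta> z"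
    by (intro mult_right_mono) (auto simp: base_kernel_def)
  thus ?thesis unfolding kernel_potential_def abs_mult by (simp add: base_kernel_def mult_ac)
qed

lemma abs_kernel_remainder_le: "\<bar>kernel_remainder \<alpha> u \<zeta> z\<bar> \<le> \<bar>\<alpha>\<bar> * norm u * (norm (\<zeta> - z) * base_kernel \<alpha> \<zeta> z)"
proof -
  have "\<bar>(\<zeta> - z) \<bullet> u\<bar> \<le> norm u * norm (\<zeta> - z)"
    using Cauchy_Schwarz_ineq2[of "\<zeta> - z" u] by (simp add: mult.commute)
  hence "\<bar>\<alpha>\<bar> * \<bar>(\<zeta> - z) \<bullet> u\<bar> * base_kernel \<alpha> \<zeta> z \<le> \<bar>\<alpha>\<bar> * (norm u * norm (\<zeta> - z)) * base_kernel \<alpha> \<zeta> z"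
    by (intro mult_right_mono mult_left_mono) (auto simp: base_kernel_def)
  thus ?thesis unfolding kernel_remainder_def abs_mult by (simp add: base_kernel_def mult_ac)
qed

section \<open>Differentiation under the integral\<close>

definition kernel_integral :: "real \<Rightarrow> (real \<Rightarrow> complex) \<Rightarrow> complex \<Rightarrow> complex" where
  "kernel_integral \<alpha> \<phi> z = integral {0..2*pi}
     (\<lambda>t. of_real ((1 - (norm z)\<^sup>2) powr (\<alpha> + 1) * norm (cis t - z) powr - (\<alpha> + 2)) * \<phi> t)"

text \<open>
  What differentiation of \<open>kernel_integral\<close> under the integral sign in the direction \<open>u\<close> produces.
\<close>

definition kernel_deriv_integral :: "real \<Rightarrow> (real \<Rightarrow> complex) \<Rightarrow> complex \<Rightarrow> complex \<Rightarrow> complex" where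
  "kernel_deriv_integral \<alpha> \<phi> u z = integral {0..2*pi} (\<lambda>t. of_real (kernel_deriv \<alpha> u (cis t) z) * \<phi> t)"

lemma disc_pos:
  assumes "norm (z::complex) < 1"
  shows "1 - (norm z)\<^sup>2 > 0" "cis t - z \<noteq> 0"
  using assms by (auto simp: abs_square_less_1)

lemma continuous_on_kernel:
  assumes "norm z < 1"
  shows "continuous_on A (\<lambda>t. (1 - (norm z)\<^sup>2) powr (\<alpha> + 1) * norm (cis t - z) powr - (\<alpha> + 2))"
  using disc_pos[OF assms] by (intro continuous_intros) auto

lemma continuous_on_kernel_deriv:
  "continuous_on (ball 0 1 \<times> A) (\<lambda>(z, t). kernel_deriv \<alpha> u (cis t) z)"
proof -
  have "1 - (norm z)\<^sup>2 \<noteq> 0" "cis t - z \<noteq> 0" if "(z, t) \<in> ball 0 1 \<times> A" for z t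
    using disc_pos(1)[of z] disc_pos(2)[of z t] that by auto
  thus ?thesis
    unfolding kernel_deriv_def base_kernel_def case_prod_unfold
    by (intro continuous_intros) auto
qed

lemma continuous_on_kernel_remainder:
  assumes "norm z < 1"
  shows "continuous_on A (\<lambda>t. kernel_remainder \<alpha> u (cis t) z)"
  unfolding kernel_remainder_def base_kernel_def
  using disc_pos[OF assms] by (intro continuous_intros) auto

lemma continuous_on_kernel_deriv_fixed:
  assumes "norm z < 1"
  shows "continuous_on A (\<lambda>t. kernel_deriv \<alpha> u (cis t) z)"
proof -
  have "continuous_on A (\<lambda>t. (\<lambda>(z, t). kernel_deriv \<alpha> u (cis t) z) (z, t))"
    by (rule continuous_on_compose2[OF continuous_on_kernel_deriv[of A]])
       (use assms in \<open>auto intro!: continuous_intros\<close>)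
  thus ?thesis by simp
qed

lemma K_integral_eq_kernel_integral:
  assumes z: "norm z < 1" and F: "continuous_on {0..2*pi} (\<lambda>t. F (cis t))"
  shows "K_integral \<alpha> F z = of_real (C_const \<alpha> / (2 * pi)) * kernel_integral \<alpha> (\<lambda>t. F (cis t)) z"
proof -
  let ?k = "\<lambda>t. (1 - (norm z)\<^sup>2) powr (\<alpha> + 1) * norm (cis t - z) powr - (\<alpha> + 2)"
  have K: "K_kernel \<alpha> (z * cis (- t)) = C_const \<alpha> * ?k t" for t
  proof -
    have "cis t * (1 - z * cis (- t)) = cis t - z"
      by (simp add: right_diff_distrib mult.left_commute[of "cis t"] cis_mult)
    hence "norm (1 - z * cis (- t)) = norm (cis t - z)"
      by (metis mult_1 norm_cis norm_mult)
    thus ?thesis unfolding K_kernel_def powr_minus_divide by (simp add: norm_mult)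
  qed
  have cont: "continuous_on {0..2*pi} (\<lambda>t. of_real (?k t) * F (cis t))"
    by (intro continuous_intros F continuous_on_kernel[OF z])
  have "integral\<^sup>L (lebesgue_on {0..2 * pi}) (\<lambda>t. complex_of_real (K_kernel \<alpha> (z * cis (- t))) * F (cis t))
     = integral\<^sup>L (lebesgue_on {0..2 * pi}) (\<lambda>t. of_real (C_const \<alpha>) * (of_real (?k t) * F (cis t)))"
    unfolding K by (simp add: mult.assoc)
  also have "\<dots> = of_real (C_const \<alpha>) * integral\<^sup>L (lebesgue_on {0..2 * pi}) (\<lambda>t. of_real (?k t) * F (cis t))"
    by simp
  also have "integral\<^sup>L (lebesgue_on {0..2 * pi}) (\<lambda>t. of_real (?k t) * F (cis t)) =
      kernel_integral \<alpha> (\<lambda>t. F (cis t)) z"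
    unfolding kernel_integral_def
    using continuous_imp_integrable[of 0 "2 * pi" "\<lambda>t. of_real (?k t) * F (cis t)"] cont
    by (intro lebesgue_integral_eq_integral) auto
  finally show ?thesis by (simp add: K_integral_def)
qed

lemma has_vector_derivative_kernel_integral:
  assumes z: "norm z < 1" and \<phi>: "continuous_on {0..2*pi} \<phi>"
  shows "((\<lambda>s. kernel_integral \<alpha> \<phi> (z + of_real s * u)) has_vector_derivative kernel_deriv_integral \<alpha> \<phi> u z) (at 0)"
proof -
  define U where "U = {s::real. z + of_real s * u \<in> ball 0 1}"
  have openU: "open U" unfolding U_def vimage_def[symmetric]
    by (intro open_vimage continuous_intros) auto
  have U0: "0 \<in> U" using z by (simp add: U_def)
  have convex: "convex U"
  proof (rule convexI)
    fix x y a b :: real assume *: "x \<in> U" "y \<in> U" "0 \<le> a" "0 \<le> b" "a + b = 1"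
    have "z + of_real (a *\<^sub>R x + b *\<^sub>R y) * u = a *\<^sub>R (z + of_real x * u) + b *\<^sub>R (z + of_real y * u)"
    proof -
      have "a *\<^sub>R (z + of_real x * u) + b *\<^sub>R (z + of_real y * u) = of_real (a + b) * z + of_real (a *\<^sub>R x + b *\<^sub>R y) * u"
        by (simp add: scaleR_conv_of_real algebra_simps)
      thus ?thesis using *(5) by simp
    qed
    moreover have "a *\<^sub>R (z + of_real x * u) + b *\<^sub>R (z + of_real y * u) \<in> ball 0 1"
      using * by (intro convexD[OF convex_ball]) (auto simp: U_def)
    ultimately show "a *\<^sub>R x + b *\<^sub>R y \<in> U" by (simp add: U_def)
  qed
  have "((\<lambda>s. integral (cbox 0 (2*pi)) (\<lambda>t. of_real ((1 - (norm (z + of_real s * u))\<^sup>2) powr (\<alpha> + 1) *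
           norm (cis t - (z + of_real s * u)) powr - (\<alpha> + 2)) * \<phi> t)) has_vector_derivative
       integral (cbox 0 (2*pi)) (\<lambda>t. of_real (kernel_deriv \<alpha> u (cis t) (z + of_real 0 * u)) * \<phi> t)) (at 0 within U)"
  proof (rule leibniz_rule_vector_derivative[where U = U and ?x0.0 = 0])
    fix s t assume "s \<in> U"
    hence s: "norm (z + of_real s * u) < 1" by (simp add: U_def)
    show "((\<lambda>s. of_real ((1 - (norm (z + of_real s * u))\<^sup>2) powr (\<alpha> + 1) *
           norm (cis t - (z + of_real s * u)) powr - (\<alpha> + 2)) * \<phi> t) has_vector_derivative
       of_real (kernel_deriv \<alpha> u (cis t) (z + of_real s * u)) * \<phi> t) (at s within U)"
      using has_derivative_kernel[OF s, of "cis t" \<alpha>]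
      by (intro has_vector_derivative_mult_left has_vector_derivative_of_real has_vector_derivative_at_within)
         (simp add: has_real_derivative_iff_has_vector_derivative)
  next
    fix s assume "s \<in> U"
    hence s: "norm (z + of_real s * u) < 1" by (simp add: U_def)
    show "(\<lambda>t. of_real ((1 - (norm (z + of_real s * u))\<^sup>2) powr (\<alpha> + 1) *
           norm (cis t - (z + of_real s * u)) powr - (\<alpha> + 2)) * \<phi> t) integrable_on cbox 0 (2*pi)"
      by (intro integrable_continuous continuous_on_mult continuous_on_of_real continuous_on_kernel[OF s])
         (use \<phi> in simp)
  next
    have 1: "continuous_on (U \<times> cbox 0 (2*pi)) (\<lambda>(s, t). \<phi> t)"
      unfolding case_prod_unfold by (rule continuous_on_compose2[OF \<phi>]) (auto intro!: continuous_intros)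
    have "continuous_on (U \<times> cbox 0 (2*pi)) (\<lambda>p. (\<lambda>(z, t). kernel_deriv \<alpha> u (cis t) z) (z + of_real (fst p) * u, snd p))"
      by (rule continuous_on_compose2[OF continuous_on_kernel_deriv[of UNIV]])
         (auto intro!: continuous_intros simp: U_def)
    hence 2: "continuous_on (U \<times> cbox 0 (2*pi)) (\<lambda>(s, t). kernel_deriv \<alpha> u (cis t) (z + of_real s * u))"
      by (simp add: case_prod_unfold)
    show "continuous_on (U \<times> cbox 0 (2*pi)) (\<lambda>(s, t). of_real (kernel_deriv \<alpha> u (cis t) (z + of_real s * u)) * \<phi> t)"
      using continuous_on_mult[OF continuous_on_of_real[OF 2] 1] by (simp add: case_prod_unfold)
  qed (fact U0, fact convex)
  moreover have "at 0 within U = at 0" by (rule at_within_open[OF U0 openU])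
  ultimately show ?thesis
    unfolding kernel_integral_def kernel_deriv_integral_def
    by (simp only: of_real_0 mult_zero_left add_0_right cbox_interval)
qed

lemma continuous_on_kernel_deriv_integral:
  assumes \<phi>: "continuous_on {0..2*pi} \<phi>"
  shows "continuous_on (ball 0 1) (kernel_deriv_integral \<alpha> \<phi> u)"
proof -
  have 1: "continuous_on (ball 0 1 \<times> cbox 0 (2*pi)) (\<lambda>(z::complex, t). \<phi> t)"
    unfolding case_prod_unfold by (rule continuous_on_compose2[OF \<phi>]) (auto intro!: continuous_intros)
  have "continuous_on (ball 0 1 \<times> cbox 0 (2*pi)) (\<lambda>(z, t). of_real (kernel_deriv \<alpha> u (cis t) z) * \<phi> t)"
    using continuous_on_mult[OF continuous_on_of_real[OF continuous_on_kernel_deriv] 1]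
    by (simp add: case_prod_unfold)
  from integral_continuous_on_param[OF this] show ?thesis
    unfolding kernel_deriv_integral_def by simp
qed


section \<open>Integrals of the kernel over the circle and the disc\<close>

lemma half_le_sin:
  assumes "0 \<le> x" "x \<le> pi / 2"
  shows "x / 2 \<le> sin x"
proof (cases "x \<le> pi / 3")
  case True
  have "\<exists>y. ((\<lambda>x. sin x - x / 2) has_real_derivative y) (at t) \<and> 0 \<le> y" if "0 \<le> t" "t \<le> x" for t
  proof (intro exI conjI)
    show "((\<lambda>x. sin x - x / 2) has_real_derivative (cos t - 1 / 2)) (at t)"
      by (auto intro!: derivative_eq_intros)
    show "0 \<le> cos t - 1 / 2"
      using cos_monotone_0_pi_le[of t "pi / 3"] that True by (simp add: cos_60)
  qed
  from DERIV_nonneg_imp_nondecreasing[OF assms(1) this] show ?thesis by simp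
next
  case False
  have "x / 2 \<le> pi / 4" using assms by simp
  also have "\<dots> \<le> sqrt 3 / 2"
  proof -
    have "pi / 2 \<le> 1.6" using pi_less_4 pi_approx by simp
    also have "(1.6 :: real) \<le> sqrt 3" by (rule real_le_rsqrt) (simp add: power2_eq_square)
    finally show ?thesis by simp
  qed
  also have "\<dots> = sin (pi / 3)" by (simp add: sin_60)
  also have "\<dots> \<le> sin x" using False assms by (intro sin_monotone_2pi_le) auto
  finally show ?thesis .
qed

text \<open>
  The restriction to \<open>\<bar>x\<bar> \<le> 3 pi\<close> is what \<open>x = t - \<theta>\<close> with \<open>t\<close> in \<open>[0, 2 pi]\<close> and \<open>\<bar>\<theta>\<bar> \<le> pi\<close> requires;
  it keeps the set of possible \<open>k\<close> finite.
\<close>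

lemma abs_sin_ge:
  assumes "\<bar>x\<bar> \<le> 3 * pi"
  obtains k :: int where "k \<in> {-3..3}" "\<bar>x - k * pi\<bar> / 2 \<le> \<bar>sin x\<bar>"
proof -
  define k where "k = round (x / pi)"
  have r: "\<bar>x / pi - k\<bar> \<le> 1 / 2" using of_int_round_abs_le[of "x / pi"] by (simp add: k_def abs_minus_commute)
  have "\<bar>x / pi\<bar> \<le> 3" using assms by (simp add: field_simps)
  hence "\<bar>real_of_int k\<bar> < 4" using r by linarith
  hence k: "k \<in> {-3..3}" by auto
  have "x - k * pi = (x / pi - k) * pi" by (simp add: field_simps)
  hence v: "\<bar>x - k * pi\<bar> \<le> pi / 2" using r by (simp add: abs_mult)
  have "\<bar>sin x\<bar> = \<bar>sin (x - k * pi)\<bar>"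
  proof -
    have "sin (k * pi) = 0" by (metis Ints_of_int sin_times_pi_eq_0)
    thus ?thesis using sin_zero_abs_cos_one[of "k * pi"] by (simp add: sin_diff abs_mult)
  qed
  also have "\<dots> = sin \<bar>x - k * pi\<bar>"
  proof -
    have "\<bar>sin y\<bar> = sin \<bar>y\<bar>" if "\<bar>y\<bar> \<le> pi" for y
      using sin_ge_zero[of y] sin_ge_zero[of "- y"] that by (cases "y \<ge> 0") auto
    from this[of "x - k * pi"] show ?thesis using v pi_gt_zero by linarith
  qed
  finally show ?thesis using that[OF k] half_le_sin[OF _ v] by simp
qed

text \<open>
  The singularity contributes at most the integral of \<open>\<bar>u\<bar> powr - b\<close> over \<open>[-1, 1]\<close>; elsewhere the integrand is
  at most 1. The point is that the bound does not depend on \<open>a\<close>.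
\<close>

lemma nn_integral_powr_translate_le:
  fixes a b :: real
  assumes b: "0 < b" "b < 1"
  shows "(\<integral>\<^sup>+t. ennreal (\<bar>t - a\<bar> powr - b) * indicator {0..2*pi} t \<partial>lborel) \<le> ennreal (2 * pi + 2 / (1 - b))"
proof -
  define q where "q = (\<lambda>u. ennreal (u powr - b) * indicator {0..1::real} u)"
  have [measurable]: "q \<in> borel_measurable borel" unfolding q_def by measurable
  have "((\<lambda>x. x powr - b) has_integral (1 powr (- b + 1) / (- b + 1))) {0..1}"
    using b by (intro has_integral_powr_from_0) auto
  hence q: "(\<integral>\<^sup>+u. q u \<partial>lborel) = ennreal (1 / (1 - b))"
    unfolding q_def by (intro nn_integral_has_integral_lebesgue') (auto simp: algebra_simps)
  have le: "ennreal (\<bar>t - a\<bar> powr - b) * indicator {0..2*pi} t \<le> indicator {0..2*pi} t + (q (- a + 1 * t) + q (a + (-1) * t))" for t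
  proof (cases "\<bar>t - a\<bar> \<le> 1")
    case True
    have "ennreal (\<bar>t - a\<bar> powr - b) * indicator {0..2*pi} t \<le> ennreal (\<bar>t - a\<bar> powr - b)"
      by (auto split: split_indicator)
    also have "\<dots> \<le> q (- a + 1 * t) + q (a + (-1) * t)"
      using True by (cases "t \<ge> a") (auto simp: q_def abs_if not_le)
    finally show ?thesis by (simp add: add_increasing)
  next
    case False
    hence "\<bar>t - a\<bar> powr - b \<le> 1 powr - b"
      using b by (intro powr_mono2') auto
    hence "ennreal (\<bar>t - a\<bar> powr - b) * indicator {0..2*pi} t \<le> 1 * indicator {0..2*pi} t"
      by (intro mult_right_mono) auto
    thus ?thesis by (simp add: add_increasing2)
  qed
  have "(\<integral>\<^sup>+t. ennreal (\<bar>t - a\<bar> powr - b) * indicator {0..2*pi} t \<partial>lborel)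
     \<le> (\<integral>\<^sup>+t. indicator {0..2*pi} t + (q (- a + 1 * t) + q (a + (-1) * t)) \<partial>lborel)"
    by (intro nn_integral_mono le)
  also have "\<dots> = emeasure lborel {0..2*pi} + ((\<integral>\<^sup>+t. q (- a + 1 * t) \<partial>lborel) + (\<integral>\<^sup>+t. q (a + (-1) * t) \<partial>lborel))"
    by (simp add: nn_integral_add)
  also have "(\<integral>\<^sup>+t. q (- a + 1 * t) \<partial>lborel) = (\<integral>\<^sup>+u. q u \<partial>lborel)"
    using nn_integral_real_affine[of q 1 "- a"] by simp
  also have "(\<integral>\<^sup>+t. q (a + (-1) * t) \<partial>lborel) = (\<integral>\<^sup>+u. q u \<partial>lborel)"
    using nn_integral_real_affine[of q "-1" a] by simp
  also have "emeasure lborel {0..2*pi} + ((\<integral>\<^sup>+u. q u \<partial>lborel) + (\<integral>\<^sup>+u. q u \<partial>lborel)) = ennreal (2 * pi + 2 / (1 - b))"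
    unfolding q using b by (simp flip: ennreal_plus)
  finally show ?thesis .
qed

lemma borel_measurable_cis [measurable]: "cis \<in> borel_measurable borel"
  by (intro borel_measurable_continuous_onI continuous_intros)

text \<open>
  The distance of \<open>cis t\<close> from any point on the line through 0 and \<open>cis \<theta>\<close> is at least
  \<open>\<bar>sin (t - \<theta>)\<bar>\<close>, whose zeros are simple.
\<close>

lemma kernel_mean_bounded:
  assumes b: "0 < b" "b < 1"
  obtains B where "B > 0"
    "\<And>w. (\<integral>\<^sup>+t. ennreal (norm (cis t - w) powr - b) * indicator {0..2*pi} t \<partial>lborel) \<le> ennreal B"
proof -
  \<comment> \<open>the mean is at most 14 times this: seven zeros of the sine, each with a factor 2\<close>
  define X where "X = 2 * pi + 2 / (1 - b)"
  have X: "X \<ge> 0" using b by (simp add: X_def)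
  define B where "B = 14 * (2 * pi + 2 / (1 - b))"
  have "B > 0" using b by (simp add: B_def add_pos_pos)
  moreover have "(\<integral>\<^sup>+t. ennreal (norm (cis t - w) powr - b) * indicator {0..2*pi} t \<partial>lborel) \<le> ennreal B" for w
  proof -
    define \<theta> where "\<theta> = Arg w"
    have w: "w = of_real (norm w) * cis \<theta>" by (simp add: \<theta>_def flip: rcis_def rcis_cmod_Arg)
    have \<theta>: "\<bar>\<theta>\<bar> \<le> pi" using Arg_bounded[of w] by (auto simp: \<theta>_def)
    have low: "\<bar>sin (t - \<theta>)\<bar> \<le> norm (cis t - w)" for t
    proof -
      have "cis t - w = cis \<theta> * (cis (t - \<theta>) - of_real (norm w))"
        by (subst w) (simp add: algebra_simps cis_mult)
      hence "norm (cis t - w) = norm (cis (t - \<theta>) - of_real (norm w))" by (simp add: norm_mult)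
      also have "\<dots> \<ge> \<bar>Im (cis (t - \<theta>) - of_real (norm w))\<bar>" by (rule abs_Im_le_cmod)
      finally show ?thesis by simp
    qed
    let ?f = "\<lambda>k::int. \<lambda>t. ennreal (\<bar>t - (\<theta> + k * pi)\<bar> powr - b) * indicator {0..2*pi} t"
    have "finite ((\<lambda>k::int. \<theta> + k * pi) ` {-3..3})" by simp
    hence "AE t in lborel. t \<notin> (\<lambda>k::int. \<theta> + k * pi) ` {-3..3}"
      by (intro AE_not_in finite_imp_null_set_lborel)
    hence "AE t in lborel. ennreal (norm (cis t - w) powr - b) * indicator {0..2*pi} t \<le> (\<Sum>k\<in>{-3..3::int}. 2 * ?f k t)"
    proof eventually_elim
      case (elim t)
      show ?case
      proof (cases "t \<in> {0..2*pi}")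
        case True
        have "\<bar>t - \<theta>\<bar> \<le> 3 * pi" using True \<theta> by auto
        then obtain k :: int where k: "k \<in> {-3..3}" "\<bar>t - \<theta> - k * pi\<bar> / 2 \<le> \<bar>sin (t - \<theta>)\<bar>"
          by (rule abs_sin_ge)
        define v where "v = \<bar>t - (\<theta> + k * pi)\<bar>"
        have v: "v > 0" using elim k(1) by (auto simp: v_def)
        have "v / 2 \<le> norm (cis t - w)" using k(2) low[of t] by (simp add: v_def algebra_simps)
        hence "norm (cis t - w) powr - b \<le> (v / 2) powr - b" using v b by (intro powr_mono2') auto
        also have "\<dots> = 2 powr b * v powr - b" using v by (simp add: powr_divide powr_minus field_simps)
        also have "\<dots> \<le> 2 powr 1 * v powr - b" using b by (intro mult_right_mono powr_mono) auto
        finally have "ennreal (norm (cis t - w) powr - b) \<le> ennreal (2 * v powr - b)" by (intro ennreal_leI) simp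
        also have "\<dots> = 2 * ?f k t" using True by (simp add: v_def ennreal_mult)
        also have "\<dots> \<le> (\<Sum>k\<in>{-3..3::int}. 2 * ?f k t)" using k(1) by (intro member_le_sum) auto
        finally show ?thesis using True by simp
      qed auto
    qed
    hence "(\<integral>\<^sup>+t. ennreal (norm (cis t - w) powr - b) * indicator {0..2*pi} t \<partial>lborel)
       \<le> (\<integral>\<^sup>+t. (\<Sum>k\<in>{-3..3::int}. 2 * ?f k t) \<partial>lborel)"
      by (rule nn_integral_mono_AE)
    also have "\<dots> = (\<Sum>k\<in>{-3..3::int}. 2 * (\<integral>\<^sup>+t. ?f k t \<partial>lborel))"
      by (subst nn_integral_sum) (auto intro!: sum.cong nn_integral_cmult)
    also have "\<dots> \<le> (\<Sum>k\<in>{-3..3::int}. 2 * ennreal X)"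
      unfolding X_def by (intro sum_mono mult_left_mono nn_integral_powr_translate_le b) auto
    also have "\<dots> = (\<Sum>k\<in>{-3..3::int}. ennreal (2 * X))" using X by (simp only: ennreal_mult) simp
    also have "\<dots> = ennreal (\<Sum>k\<in>{-3..3::int}. 2 * X)" using X by (intro sum_ennreal) auto
    also have "(\<Sum>k\<in>{-3..3::int}. 2 * X) = B" by (simp add: B_def X_def)
    finally show ?thesis .
  qed
  ultimately show ?thesis using that by blast
qed

lemma lborel_complex_eq: "distr (lborel \<Otimes>\<^sub>M lborel) borel (\<lambda>(x, y). Complex x y) = lborel"
proof (rule lborel_eqI[symmetric])
  have [measurable]: "(\<lambda>(x, y). Complex x y) \<in> borel_measurable (lborel \<Otimes>\<^sub>M lborel)"
    unfolding case_prod_unfold Complex_eq by measurable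
  fix l u :: complex assume le: "\<And>b. b \<in> Basis \<Longrightarrow> l \<bullet> b \<le> u \<bullet> b"
  have le': "Re l \<le> Re u" "Im l \<le> Im u" using le[of 1] le[of \<i>] by (auto simp: Basis_complex_def)
  have "(\<lambda>(x, y). Complex x y) -` box l u \<inter> space (lborel \<Otimes>\<^sub>M lborel) = {Re l<..<Re u} \<times> {Im l<..<Im u}"
    by (auto simp: box_def Basis_complex_def space_pair_measure)
  thus "emeasure (distr (lborel \<Otimes>\<^sub>M lborel) borel (\<lambda>(x, y). Complex x y)) (box l u) = (\<Prod>b\<in>Basis. (u - l) \<bullet> b)"
    using le' by (simp add: emeasure_distr lborel.emeasure_pair_measure_Times Basis_complex_def ennreal_mult)
qed simp

lemma nn_integral_lborel_complex:
  assumes [measurable]: "f \<in> borel_measurable borel"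
  shows "(\<integral>\<^sup>+z. f z \<partial>lborel) = (\<integral>\<^sup>+x. \<integral>\<^sup>+y. f (Complex x y) \<partial>lborel \<partial>lborel)" (is ?A)
    and "(\<integral>\<^sup>+z. f z \<partial>lborel) = (\<integral>\<^sup>+y. \<integral>\<^sup>+x. f (Complex x y) \<partial>lborel \<partial>lborel)" (is ?B)
proof -
  have m [measurable]: "(\<lambda>(x, y). Complex x y) \<in> borel_measurable (lborel \<Otimes>\<^sub>M lborel)"
    unfolding case_prod_unfold Complex_eq by measurable
  have "(\<integral>\<^sup>+z. f z \<partial>lborel) = (\<integral>\<^sup>+p. f (case p of (x, y) \<Rightarrow> Complex x y) \<partial>(lborel \<Otimes>\<^sub>M lborel))"
    by (subst lborel_complex_eq[symmetric], subst nn_integral_distr) auto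
  also have "\<dots> = (\<integral>\<^sup>+p. (\<lambda>(x, y). f (Complex x y)) p \<partial>(lborel \<Otimes>\<^sub>M lborel))"
    by (simp add: case_prod_unfold)
  finally have *: "(\<integral>\<^sup>+z. f z \<partial>lborel) = \<dots>" .
  have m2: "(\<lambda>(x, y). f (Complex x y)) \<in> borel_measurable (lborel \<Otimes>\<^sub>M lborel)"
    unfolding case_prod_unfold Complex_eq by measurable
  show ?A using lborel.nn_integral_fst[OF m2] * by simp
  show ?B using lborel_pair.nn_integral_snd[OF m2] * by simp
qed

lemma nn_integral_shear:
  fixes a :: real
  assumes f [measurable]: "f \<in> borel_measurable borel"
  shows "(\<integral>\<^sup>+z. f (z + of_real (a * Im z)) \<partial>lborel) = (\<integral>\<^sup>+z. f z \<partial>lborel)"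
    and "(\<integral>\<^sup>+z. f (z + \<i> * of_real (a * Re z)) \<partial>lborel) = (\<integral>\<^sup>+z. f z \<partial>lborel)"
proof -
  have m: "(\<lambda>x. f (Complex x y)) \<in> borel_measurable borel" "(\<lambda>x. f (Complex y x)) \<in> borel_measurable borel" for y
    unfolding Complex_eq by measurable
  have "(\<integral>\<^sup>+z. f (z + of_real (a * Im z)) \<partial>lborel) = (\<integral>\<^sup>+y. \<integral>\<^sup>+x. f (Complex (a * y + 1 * x) y) \<partial>lborel \<partial>lborel)"
    by (subst nn_integral_lborel_complex(2)) (auto intro!: nn_integral_cong arg_cong[where f = f] simp: complex_eq_iff)
  also have "\<dots> = (\<integral>\<^sup>+y. \<integral>\<^sup>+x. f (Complex x y) \<partial>lborel \<partial>lborel)"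
    using nn_integral_real_affine[OF m(1), of 1] by simp
  also have "\<dots> = (\<integral>\<^sup>+z. f z \<partial>lborel)" by (simp add: nn_integral_lborel_complex(2))
  finally show "(\<integral>\<^sup>+z. f (z + of_real (a * Im z)) \<partial>lborel) = (\<integral>\<^sup>+z. f z \<partial>lborel)" .
  have "(\<integral>\<^sup>+z. f (z + \<i> * of_real (a * Re z)) \<partial>lborel) = (\<integral>\<^sup>+x. \<integral>\<^sup>+y. f (Complex x (a * x + 1 * y)) \<partial>lborel \<partial>lborel)"
    by (subst nn_integral_lborel_complex(1)) (auto intro!: nn_integral_cong arg_cong[where f = f] simp: complex_eq_iff)
  also have "\<dots> = (\<integral>\<^sup>+x. \<integral>\<^sup>+y. f (Complex x y) \<partial>lborel \<partial>lborel)"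
    using nn_integral_real_affine[OF m(2), of 1] by simp
  also have "\<dots> = (\<integral>\<^sup>+z. f z \<partial>lborel)" by (simp add: nn_integral_lborel_complex(1))
  finally show "(\<integral>\<^sup>+z. f (z + \<i> * of_real (a * Re z)) \<partial>lborel) = (\<integral>\<^sup>+z. f z \<partial>lborel)" .
qed

text \<open>
  A rotation by \<open>s\<close> is a product of three shears, with slopes \<open>- tan (s / 2)\<close>, \<open>sin s\<close> and \<open>- tan (s / 2)\<close>,
  and shears preserve area by Tonelli and translation invariance on the line. When \<open>tan (s / 2)\<close> is
  undefined, rotate by \<open>s / 2\<close> twice.
\<close>

lemma nn_integral_rotate:
  assumes f [measurable]: "f \<in> borel_measurable borel"
  shows "(\<integral>\<^sup>+z. f (cis s * z) \<partial>lborel) = (\<integral>\<^sup>+z. f z \<partial>lborel)"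
proof -
  have *: "(\<integral>\<^sup>+z. f (cis s * z) \<partial>lborel) = (\<integral>\<^sup>+z. f z \<partial>lborel)" if s: "cos (s / 2) \<noteq> 0"
    and f [measurable]: "f \<in> borel_measurable borel" for s f
  proof -
    define a where "a = - tan (s / 2)"
    \<comment> \<open>shears along the real and the imaginary axis\<close>
    define S T where "S z = z + of_real (a * Im z)" and "T z = z + \<i> * of_real (sin s * Re z)" for z :: complex
    have [measurable]: "S \<in> borel_measurable borel" "T \<in> borel_measurable borel"
      unfolding S_def T_def by measurable
    have inv: "(\<integral>\<^sup>+z. h (S z) \<partial>lborel) = (\<integral>\<^sup>+z. h z \<partial>lborel)" "(\<integral>\<^sup>+z. h (T z) \<partial>lborel) = (\<integral>\<^sup>+z. h z \<partial>lborel)"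
      if "h \<in> borel_measurable borel" for h
      unfolding S_def T_def using nn_integral_shear[OF that] by blast+
    have c: "cos s = 1 + a * sin s" "a * (1 + cos s) = - sin s"
    proof -
      have sc: "sin s = 2 * sin (s / 2) * cos (s / 2)" "cos s = 2 * (cos (s / 2))\<^sup>2 - 1"
        using sin_double[of "s / 2"] cos_double_cos[of "s / 2"] by simp_all
      have "cos s = 1 - 2 * (sin (s / 2))\<^sup>2" using cos_double_sin[of "s / 2"] by simp
      thus "cos s = 1 + a * sin s" unfolding a_def tan_def sc(1) using s by (simp add: power2_eq_square)
      show "a * (1 + cos s) = - sin s" unfolding a_def tan_def sc using s by (simp add: power2_eq_square)
    qed
    have "cis s * z = S (T (S z))" for z
    proof (rule complex_eqI)
      show "Im (cis s * z) = Im (S (T (S z)))" by (simp add: S_def T_def c(1) algebra_simps)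
      have "Re (S (T (S z))) = (1 + a * sin s) * Re z + a * (1 + (1 + a * sin s)) * Im z"
        by (simp add: S_def T_def algebra_simps)
      also have "\<dots> = cos s * Re z - sin s * Im z" unfolding c(1)[symmetric] c(2) by simp
      finally show "Re (cis s * z) = Re (S (T (S z)))" by simp
    qed
    hence "(\<integral>\<^sup>+z. f (cis s * z) \<partial>lborel) = (\<integral>\<^sup>+z. f (S (T (S z))) \<partial>lborel)" by simp
    also have "\<dots> = (\<integral>\<^sup>+z. f (S (T z)) \<partial>lborel)" by (rule inv(1)) measurable
    also have "\<dots> = (\<integral>\<^sup>+z. f (S z) \<partial>lborel)" by (rule inv(2)) measurable
    also have "\<dots> = (\<integral>\<^sup>+z. f z \<partial>lborel)" by (rule inv(1)) measurable
    finally show ?thesis .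
  qed
  show ?thesis
  proof (cases "cos (s / 2) = 0")
    case True
    have "cos (s / 2 / 2) \<noteq> 0"
    proof
      assume "cos (s / 2 / 2) = 0"
      hence "cos (s / 2) = -1" using cos_double_cos[of "s / 2 / 2"] by simp
      thus False using True by simp
    qed
    note h = *[OF this]
    have "(\<integral>\<^sup>+z. f (cis s * z) \<partial>lborel) = (\<integral>\<^sup>+z. f (cis (s / 2) * (cis (s / 2) * z)) \<partial>lborel)"
      by (simp add: cis_mult flip: mult.assoc)
    also have "\<dots> = (\<integral>\<^sup>+z. f (cis (s / 2) * z) \<partial>lborel)" by (rule h) measurable
    also have "\<dots> = (\<integral>\<^sup>+z. f z \<partial>lborel)" by (rule h) measurable
    finally show ?thesis .
  qed (use * f in blast)
qed

text \<open>
  Decompose the disc into the annuli where \<open>1 - |z|\<^sup>2\<close> is between \<open>2\<^sup>-\<^sup>n\<^sup>-\<^sup>1\<close> and \<open>2\<^sup>-\<^sup>n\<close>; each has area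
  of order \<open>2\<^sup>-\<^sup>n\<close>, so the integral is dominated by a geometric series with ratio \<open>2 powr - (1 + q)\<close>.
\<close>

lemma nn_integral_disc_powr_finite:
  assumes q: "-1 < q" "q \<le> 0"
  shows "(\<integral>\<^sup>+z. ennreal ((1 - (norm z)\<^sup>2) powr q) * indicator (ball 0 1) z \<partial>(lborel :: complex measure)) < \<infinity>"
proof -
  define A where "A n = ball (0::complex) 1 - ball 0 (sqrt (1 - (1/2) ^ n))" for n :: nat
  have [measurable]: "A n \<in> sets borel" for n by (simp add: A_def)
  have half: "(1/2 :: real) ^ n \<le> 1" for n by (simp add: power_le_one)
  have emA: "emeasure lborel (A n) = ennreal (pi * (1/2) ^ n)" for n
  proof -
    have "emeasure lborel (A n) = emeasure lborel (ball (0::complex) 1) - emeasure lborel (ball (0::complex) (sqrt (1 - (1/2) ^ n)))"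
      unfolding A_def using half[of n] by (intro emeasure_Diff) (auto simp: emeasure_ball intro!: subset_ball)
    also have "\<dots> = ennreal pi - ennreal (pi * (1 - (1/2) ^ n))"
      using half[of n] by (simp add: emeasure_ball unit_ball_vol_2)
    also have "\<dots> = ennreal (pi * (1/2) ^ n)"
      using half[of n] by (subst ennreal_minus) (auto simp: algebra_simps)
    finally show ?thesis .
  qed
  have pw: "ennreal ((1 - (norm z)\<^sup>2) powr q) * indicator (ball 0 1) z
      \<le> (\<Sum>n. ennreal (((1/2) ^ Suc n) powr q) * indicator (A n) z)" for z :: complex
  proof (cases "z \<in> ball 0 1")
    case True
    define d where "d = 1 - (norm z)\<^sup>2"
    have d: "d > 0" "d \<le> 1" using True unfolding d_def
      by (auto simp: abs_square_less_1 power_less_one_iff)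
    obtain n0 where "(1/2) ^ n0 < d" using real_arch_pow_inv[OF d(1), of "1/2"] by auto
    define m where "m = (LEAST m. (1/2) ^ m < d)"
    have m: "(1/2) ^ m < d" unfolding m_def by (rule LeastI) fact
    have "m \<noteq> 0" using m d by (intro notI) simp
    then obtain n where n: "m = Suc n" by (cases m) auto
    have "\<not> (1/2) ^ n < d" using not_less_Least[of n "\<lambda>m. (1/2) ^ m < d"] n by (simp add: m_def)
    hence "(norm z)\<^sup>2 \<ge> 1 - (1/2) ^ n" by (simp add: d_def)
    hence "sqrt (1 - (1/2) ^ n) \<le> norm z" using real_sqrt_le_mono[of "1 - (1/2) ^ n" "(norm z)\<^sup>2"] by simp
    hence zA: "z \<in> A n" using True by (simp add: A_def)
    have "d powr q \<le> ((1/2) ^ Suc n) powr q" using m q d n by (intro powr_mono2') auto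
    hence "ennreal (d powr q) * indicator (ball 0 1) z \<le> ennreal (((1/2) ^ Suc n) powr q) * indicator (A n) z"
      using zA True by (auto intro!: ennreal_leI)
    also have "\<dots> \<le> (\<Sum>n. ennreal (((1/2) ^ Suc n) powr q) * indicator (A n) z)"
    proof -
      have "h n \<le> suminf h" for h :: "nat \<Rightarrow> ennreal" using sum_le_suminf[of h "{n}"] by simp
      thus ?thesis .
    qed
    finally show ?thesis by (simp add: d_def)
  qed auto
  have "(\<integral>\<^sup>+z. ennreal ((1 - (norm z)\<^sup>2) powr q) * indicator (ball 0 1) z \<partial>(lborel :: complex measure))
     \<le> (\<integral>\<^sup>+z. (\<Sum>n. ennreal (((1/2) ^ Suc n) powr q) * indicator (A n) z) \<partial>lborel)"
    by (intro nn_integral_mono pw)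
  also have "\<dots> = (\<Sum>n. ennreal (((1/2) ^ Suc n) powr q) * emeasure lborel (A n))"
    by (subst nn_integral_suminf) (auto simp: nn_integral_cmult_indicator)
  also have "\<dots> = (\<Sum>n. ennreal (pi * (1/2) powr q * ((1/2) powr (1 + q)) ^ n))"
  proof (intro suminf_cong)
    fix n
    have "((1/2) ^ Suc n) powr q * (pi * (1/2) ^ n) = pi * (1/2) powr q * ((1/2) powr (1 + q)) ^ n"
    proof -
      have r: "(a::real) ^ k = a powr real k" if "a > 0" for a k using that by (simp add: powr_realpow)
      have hp: "(0 :: real) < 1/2" and hp': "(0 :: real) < (1/2) powr (1 + q)" by simp_all
      have "((1/2) ^ Suc n) powr q * (1/2 :: real) ^ n = (1/2) powr (real (Suc n) * q + real n)"
        by (simp only: r[OF hp] powr_add powr_powr)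
      also have "real (Suc n) * q + real n = q + (1 + q) * real n" by (simp add: algebra_simps)
      also have "(1/2 :: real) powr (q + (1 + q) * real n) = (1/2) powr q * ((1/2) powr (1 + q)) ^ n"
        by (simp only: r[OF hp'] powr_add[of "1/2" q] powr_powr)
      finally show ?thesis by (simp only: mult_ac)
    qed
    thus "ennreal (((1/2) ^ Suc n) powr q) * emeasure lborel (A n) = ennreal (pi * (1/2) powr q * ((1/2) powr (1 + q)) ^ n)"
      unfolding emA by (simp flip: ennreal_mult)
  qed
  also have "\<dots> < \<infinity>"
  proof -
    have "(1/2 :: real) powr (1 + q) < (1/2) powr 0" using q by (intro powr_less_mono') auto
    hence "summable (\<lambda>n. pi * (1/2) powr q * ((1/2) powr (1 + q)) ^ n)"
      by (intro summable_mult summable_geometric) auto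
    hence "(\<Sum>n. ennreal (pi * (1/2) powr q * ((1/2) powr (1 + q)) ^ n)) =
        ennreal (\<Sum>n. pi * (1/2) powr q * ((1/2) powr (1 + q)) ^ n)"
      by (intro suminf_ennreal2 mult_nonneg_nonneg zero_le_power) auto
    also have "\<dots> < \<infinity>" by (simp only: infinity_ennreal_def ennreal_less_top)
    finally show ?thesis .
  qed
  finally show ?thesis .
qed

text \<open>
  The weight \<open>(1 - |z|\<^sup>2) powr q\<close> is radial, so by rotation invariance the kernel may be averaged over the
  rotations of \<open>z\<close>; the average is bounded by \<open>kernel_mean_bounded\<close>.
\<close>

lemma disc_kernel_bounded:
  assumes b: "0 < b" "b < 1" and q: "-1 < q" "q \<le> 0"
  obtains I where "I \<ge> 0"
    "\<And>t. (\<integral>\<^sup>+z. ennreal ((1 - (norm z)\<^sup>2) powr q * norm (cis t - z) powr - b) * indicator (ball 0 1) z \<partial>lborel) \<le> ennreal I"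
proof -
  obtain B where B: "B > 0"
    "\<And>w. (\<integral>\<^sup>+t. ennreal (norm (cis t - w) powr - b) * indicator {0..2*pi} t \<partial>lborel) \<le> ennreal B"
    using kernel_mean_bounded[OF b] by blast
  define Q where "Q = (\<integral>\<^sup>+z. ennreal ((1 - (norm z)\<^sup>2) powr q) * indicator (ball 0 1) z \<partial>(lborel :: complex measure))"
  have Q: "Q < \<infinity>" unfolding Q_def by (rule nn_integral_disc_powr_finite[OF q])
  have "(\<integral>\<^sup>+z. ennreal ((1 - (norm z)\<^sup>2) powr q * norm (cis t - z) powr - b) * indicator (ball 0 1) z \<partial>lborel) \<le> ennreal B * Q" (is "?L \<le> _") for t
  proof -
    let ?g = "\<lambda>z. ennreal ((1 - (norm z)\<^sup>2) powr q * norm (cis t - z) powr - b) * indicator (ball (0::complex) 1) z"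
    have [measurable]: "Measurable.pred borel (\<lambda>z. z \<in> ball (0::complex) 1)"
      unfolding mem_ball by measurable
    have [measurable]: "?g \<in> borel_measurable borel" by measurable
    have rot: "?L = (\<integral>\<^sup>+z. ?g (cis s * z) \<partial>lborel)" for s
      by (rule nn_integral_rotate[symmetric]) measurable
    have ker: "norm (cis t - cis s * z) = norm (cis s - cis t * cnj z)" for s z
    proof -
      have "cis t - cis s * z = cis t * cis s * cnj (cis s - cis t * cnj z)"
        by (simp add: algebra_simps cis_cnj) (simp add: cis_mult flip: mult.assoc)
      thus ?thesis by (simp add: norm_mult del: complex_cnj_diff)
    qed
    have "?L \<le> ennreal (2 * pi) * ?L"
    proof -
      have "1 \<le> 2 * pi" using pi_gt3 by simp
      hence "1 * ?L \<le> ennreal (2 * pi) * ?L" by (intro mult_right_mono) auto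
      thus ?thesis by simp
    qed
    also have "\<dots> = (\<integral>\<^sup>+s. ?L * indicator {0..2*pi} s \<partial>lborel)"
      by (subst nn_integral_cmult_indicator) (auto simp: mult.commute)
    also have "\<dots> = (\<integral>\<^sup>+s. (\<integral>\<^sup>+z. ?g (cis s * z) * indicator {0..2*pi} s \<partial>lborel) \<partial>lborel)"
      by (intro nn_integral_cong, subst rot, subst nn_integral_multc) auto
    also have "\<dots> = (\<integral>\<^sup>+z. (\<integral>\<^sup>+s. ?g (cis s * z) * indicator {0..2*pi} s \<partial>lborel) \<partial>lborel)"
      by (rule lborel_pair.Fubini') measurable
    also have "\<dots> = (\<integral>\<^sup>+z. ennreal ((1 - (norm z)\<^sup>2) powr q) * indicator (ball 0 1) z *
        (\<integral>\<^sup>+s. ennreal (norm (cis s - cis t * cnj z) powr - b) * indicator {0..2*pi} s \<partial>lborel) \<partial>lborel)"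
      by (intro nn_integral_cong, subst nn_integral_cmult[symmetric])
         (auto intro!: nn_integral_cong simp: ker norm_mult ennreal_mult split: split_indicator)
    also have "\<dots> \<le> (\<integral>\<^sup>+z. ennreal ((1 - (norm z)\<^sup>2) powr q) * indicator (ball 0 1) z * ennreal B \<partial>(lborel :: complex measure))"
      by (intro nn_integral_mono mult_left_mono B) auto
    also have "\<dots> = ennreal B * Q"
      unfolding Q_def by (subst nn_integral_multc) (auto simp: mult.commute)
    finally show ?thesis .
  qed
  moreover have "ennreal B * Q = ennreal (B * enn2real Q)"
    using Q B(1) by (simp add: ennreal_mult less_top)
  ultimately show ?thesis using that[of "B * enn2real Q"] B(1) by simp
qed

section \<open>Integrability of the derivatives over the disc\<close>

text \<open>
  Integration by parts moves the \<open>t\<close>-derivative from the potential to \<open>\<phi>\<close>; the boundary terms cancel by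
  periodicity. What remains is controlled by the bounds on potential and remainder.
\<close>

lemma norm_kernel_deriv_integral_le:
  assumes z: "norm z < 1" and u: "norm u = 1" and \<beta>: "\<beta> \<le> \<alpha>" "\<alpha> \<le> \<beta> + 1"
    and \<phi>: "AC_on 0 (2*pi) \<phi>" "\<phi> (2*pi) = \<phi> 0" and M: "\<And>t. t \<in> {0..2*pi} \<Longrightarrow> norm (\<phi> t) \<le> M"
    and g: "integrable lborel g" "AE t in lborel. t \<in> {0<..<2*pi} \<longrightarrow> (\<phi> has_vector_derivative g t) (at t)"
  shows "ennreal (norm (kernel_deriv_integral \<alpha> \<phi> u z)) \<le> ennreal (2 * (1 - (norm z)\<^sup>2) powr \<beta>) *
     (\<integral>\<^sup>+t. ennreal (norm (cis t - z) powr - (\<beta> + 1) * (2 * norm (g t) + \<bar>\<alpha>\<bar> * M)) * indicator {0..2*pi} t \<partial>lborel)"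
proof -
  define H R where "H t = kernel_potential \<alpha> u (cis t) z" and "R t = kernel_remainder \<alpha> u (cis t) z" for t
  define K where "K t = kernel_deriv \<alpha> u (cis t) z" for t
  have [measurable]: "g \<in> borel_measurable borel" using g(1) by auto
  have \<phi>_cont: "continuous_on {0..2*pi} \<phi>" by (rule AC_on_imp_continuous[OF \<phi>(1)])
  have cK: "continuous_on A K" and cR: "continuous_on A R" for A
    unfolding K_def R_def using continuous_on_kernel_deriv_fixed[OF z] continuous_on_kernel_remainder[OF z] by blast+
  have H: "(H has_real_derivative K t - R t) (at t)" for t
    unfolding H_def K_def R_def by (rule has_derivative_kernel_potential[OF z])
  have cH': "continuous_on {0..2*pi} (\<lambda>t. K t - R t)" by (intro continuous_intros cK cR)
  note parts = AC_on_integration_by_parts[OF \<phi>(1) _ g H cH']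
  have HL: "H (2*pi) = H 0" by (simp add: H_def)
  have iR: "set_integrable lborel {0..2*pi} (\<lambda>t. of_real (R t) * \<phi> t)"
    by (intro borel_integrable_atLeastAtMost' continuous_intros cR \<phi>_cont)
  have iK: "set_integrable lborel {0..2*pi} (\<lambda>t. of_real (K t) * \<phi> t)"
    by (intro borel_integrable_atLeastAtMost' continuous_intros cK \<phi>_cont)
  have iH': "set_integrable lborel {0..2*pi} (\<lambda>t. of_real (K t - R t) * \<phi> t)"
    by (intro borel_integrable_atLeastAtMost' continuous_intros cK cR \<phi>_cont)
  have iHg: "set_integrable lborel {0..2*pi} (\<lambda>t. of_real (H t) * g t)" using parts(2) by simp
  have "kernel_deriv_integral \<alpha> \<phi> u z = (LINT t:{0..2*pi}|lborel. of_real (K t) * \<phi> t)"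
    unfolding kernel_deriv_integral_def K_def[symmetric] by (rule set_borel_integral_eq_integral(2)[OF iK, symmetric])
  also have "\<dots> = (LINT t:{0..2*pi}|lborel. of_real (K t - R t) * \<phi> t + of_real (R t) * \<phi> t)"
    by (simp add: algebra_simps)
  also have "\<dots> = (LINT t:{0..2*pi}|lborel. of_real (K t - R t) * \<phi> t) + (LINT t:{0..2*pi}|lborel. of_real (R t) * \<phi> t)"
    by (rule set_integral_add(2)[OF iH' iR])
  also have "(LINT t:{0..2*pi}|lborel. of_real (K t - R t) * \<phi> t) = - (LINT t:{0..2*pi}|lborel. of_real (H t) * g t)"
    using parts(1) HL \<phi>(2) by simp
  also have "- (LINT t:{0..2*pi}|lborel. of_real (H t) * g t) + (LINT t:{0..2*pi}|lborel. of_real (R t) * \<phi> t)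
     = (LINT t:{0..2*pi}|lborel. of_real (R t) * \<phi> t - of_real (H t) * g t)"
    by (subst set_integral_diff(2)[OF iR iHg]) simp
  finally have eq: "kernel_deriv_integral \<alpha> \<phi> u z = (LINT t:{0..2*pi}|lborel. of_real (R t) * \<phi> t - of_real (H t) * g t)" .
  have pw: "norm (of_real (R t) * \<phi> t - of_real (H t) * g t) \<le>
      (2 * (1 - (norm z)\<^sup>2) powr \<beta>) * (norm (cis t - z) powr - (\<beta> + 1) * (2 * norm (g t) + \<bar>\<alpha>\<bar> * M))" if t: "t \<in> {0..2*pi}" for t
  proof -
    let ?w = "norm (cis t - z) * base_kernel \<alpha> (cis t) z"
    have w: "?w \<ge> 0" by (simp add: base_kernel_def)
    have M0: "M \<ge> 0" using M[OF t] norm_ge_zero order_trans by blast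
    have "norm (of_real (R t) * \<phi> t - of_real (H t) * g t) \<le> \<bar>R t\<bar> * norm (\<phi> t) + \<bar>H t\<bar> * norm (g t)"
      using norm_triangle_ineq4[of "of_real (R t) * \<phi> t" "of_real (H t) * g t"] by (simp add: norm_mult)
    also have "\<dots> \<le> (\<bar>\<alpha>\<bar> * ?w) * M + (2 * ?w) * norm (g t)"
      using abs_kernel_potential_le[of \<alpha> u "cis t" z] abs_kernel_remainder_le[of \<alpha> u "cis t" z] u w M[OF t]
      by (intro add_mono mult_mono) (auto simp: H_def R_def)
    also have "\<dots> = ?w * (2 * norm (g t) + \<bar>\<alpha>\<bar> * M)" by (simp add: algebra_simps)
    also have "\<dots> \<le> (2 * (1 - (norm z)\<^sup>2) powr \<beta> * norm (cis t - z) powr - (\<beta> + 1)) * (2 * norm (g t) + \<bar>\<alpha>\<bar> * M)"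
      using M0 by (intro mult_right_mono base_kernel_bound z \<beta>) auto
    finally show ?thesis by (simp add: mult.assoc)
  qed
  have int: "integrable lborel (\<lambda>t. indicat_real {0..2*pi} t *\<^sub>R (of_real (R t) * \<phi> t - of_real (H t) * g t))"
    using set_integral_diff(1)[OF iR iHg] by (simp add: set_integrable_def)
  have "ennreal (norm (kernel_deriv_integral \<alpha> \<phi> u z)) \<le>
      (\<integral>\<^sup>+t. ennreal (norm (indicat_real {0..2*pi} t *\<^sub>R (of_real (R t) * \<phi> t - of_real (H t) * g t))) \<partial>lborel)"
    unfolding eq set_lebesgue_integral_def by (rule integral_norm_bound_ennreal[OF int])
  also have "\<dots> \<le> (\<integral>\<^sup>+t. ennreal (2 * (1 - (norm z)\<^sup>2) powr \<beta>) *
     (ennreal (norm (cis t - z) powr - (\<beta> + 1) * (2 * norm (g t) + \<bar>\<alpha>\<bar> * M)) * indicator {0..2*pi} t) \<partial>lborel)"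
  proof (rule nn_integral_mono)
    fix t
    show "ennreal (norm (indicat_real {0..2*pi} t *\<^sub>R (of_real (R t) * \<phi> t - of_real (H t) * g t))) \<le>
       ennreal (2 * (1 - (norm z)\<^sup>2) powr \<beta>) *
     (ennreal (norm (cis t - z) powr - (\<beta> + 1) * (2 * norm (g t) + \<bar>\<alpha>\<bar> * M)) * indicator {0..2*pi} t)"
      using ennreal_leI[OF pw[of t]] by (cases "t \<in> {0..2*pi}") (simp_all add: ennreal_mult' del: atLeastAtMost_iff)
  qed
  also have "\<dots> = ennreal (2 * (1 - (norm z)\<^sup>2) powr \<beta>) *
     (\<integral>\<^sup>+t. ennreal (norm (cis t - z) powr - (\<beta> + 1) * (2 * norm (g t) + \<bar>\<alpha>\<bar> * M)) * indicator {0..2*pi} t \<partial>lborel)"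
    by (rule nn_integral_cmult) measurable
  finally show ?thesis .
qed

text \<open>
  A form of Jensen's inequality for a weight \<open>\<kappa>\<close> of total mass at most \<open>B\<close>. It follows from the pointwise
  bound \<open>\<phi> \<le> A + A powr (1 - p) * \<phi> powr p\<close> by choosing \<open>A powr p\<close> as 1 plus the integral of
  \<open>\<kappa> \<phi> powr p\<close>.
\<close>

lemma weighted_power_mean:
  fixes \<kappa> \<phi> :: "'a \<Rightarrow> real"
  assumes [measurable]: "\<kappa> \<in> borel_measurable M" "\<phi> \<in> borel_measurable M"
    and nn: "\<And>x. \<kappa> x \<ge> 0" "\<And>x. \<phi> x \<ge> 0" and p: "p \<ge> 1"
    and B: "(\<integral>\<^sup>+x. ennreal (\<kappa> x) \<partial>M) \<le> ennreal B" "B \<ge> 0"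
    and v: "v \<ge> 0" "ennreal v \<le> (\<integral>\<^sup>+x. ennreal (\<kappa> x * \<phi> x) \<partial>M)"
  shows "ennreal (v powr p) \<le> ennreal ((1 + B) powr p) * (1 + (\<integral>\<^sup>+x. ennreal (\<kappa> x * \<phi> x powr p) \<partial>M))"
proof (cases "(\<integral>\<^sup>+x. ennreal (\<kappa> x * \<phi> x powr p) \<partial>M)")
  case (real j)
  define A where "A = (1 + j) powr (1 / p)"
  have A: "A > 0" "A powr p = 1 + j" using real(1) p by (simp_all add: A_def powr_powr)
  have split: "\<phi> x \<le> A + A powr (1 - p) * \<phi> x powr p" for x
  proof (cases "\<phi> x \<le> A")
    case False
    have "\<phi> x = \<phi> x powr (1 - p) * \<phi> x powr p" using False A(1) by (simp flip: powr_add)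
    also have "\<dots> \<le> A powr (1 - p) * \<phi> x powr p"
      using False A(1) p by (intro mult_right_mono powr_mono2') auto
    finally show ?thesis using A(1) by simp
  qed (simp add: add_increasing2)
  have "ennreal v \<le> (\<integral>\<^sup>+x. ennreal A * ennreal (\<kappa> x) + ennreal (A powr (1 - p)) * ennreal (\<kappa> x * \<phi> x powr p) \<partial>M)"
  proof (rule order.trans[OF v(2)], rule nn_integral_mono)
    fix x
    have "\<kappa> x * \<phi> x \<le> \<kappa> x * (A + A powr (1 - p) * \<phi> x powr p)" by (intro mult_left_mono split nn)
    also have "\<dots> = A * \<kappa> x + A powr (1 - p) * (\<kappa> x * \<phi> x powr p)" by (simp add: algebra_simps)
    finally have "ennreal (\<kappa> x * \<phi> x) \<le> ennreal (A * \<kappa> x + A powr (1 - p) * (\<kappa> x * \<phi> x powr p))" by (rule ennreal_leI)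
    also have "\<dots> = ennreal A * ennreal (\<kappa> x) + ennreal (A powr (1 - p)) * ennreal (\<kappa> x * \<phi> x powr p)"
      using A nn by (simp add: ennreal_mult ennreal_plus)
    finally show "ennreal (\<kappa> x * \<phi> x) \<le> ennreal A * ennreal (\<kappa> x) + ennreal (A powr (1 - p)) * ennreal (\<kappa> x * \<phi> x powr p)" .
  qed
  also have "\<dots> = ennreal A * (\<integral>\<^sup>+x. ennreal (\<kappa> x) \<partial>M) + ennreal (A powr (1 - p)) * ennreal j"
    using real by (simp add: nn_integral_add nn_integral_cmult)
  also have "\<dots> \<le> ennreal A * ennreal B + ennreal (A powr (1 - p)) * ennreal j"
    by (intro add_right_mono mult_left_mono B) auto
  also have "\<dots> = ennreal (A * B + A powr (1 - p) * j)"
    using A B(2) real(1) by (simp add: ennreal_mult ennreal_plus)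
  also have "\<dots> \<le> ennreal (A * (1 + B))"
  proof (rule ennreal_leI)
    have "A powr (1 - p) * j \<le> A powr (1 - p) * A powr p"
      unfolding A(2) by (intro mult_left_mono) auto
    also have "\<dots> = A" using A(1) by (simp flip: powr_add)
    finally show "A * B + A powr (1 - p) * j \<le> A * (1 + B)" by (simp add: algebra_simps)
  qed
  finally have "v \<le> A * (1 + B)" using A(1) B(2) by (subst (asm) ennreal_le_iff) auto
  hence "v powr p \<le> (A * (1 + B)) powr p" using v(1) p by (intro powr_mono2) auto
  also have "\<dots> = (1 + B) powr p * (1 + j)" using A B(2) by (simp add: powr_mult)
  finally have "ennreal (v powr p) \<le> ennreal ((1 + B) powr p * (1 + j))" by (rule ennreal_leI)
  thus ?thesis using real by (simp add: ennreal_mult ennreal_plus)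
next
  case top
  thus ?thesis using B(2) by (simp add: ennreal_mult_top)
qed

lemma nn_integral_disc_measure:
  fixes f :: "complex \<Rightarrow> ennreal"
  assumes "f \<in> borel_measurable borel"
  shows "(\<integral>\<^sup>+z. f z \<partial>disc_measure) = ennreal (1 / pi) * (\<integral>\<^sup>+z. f z * indicator (ball 0 1) z \<partial>lborel)"
  unfolding disc_measure_def using assms
  by (subst nn_integral_scale_measure) 
     (auto simp: nn_integral_restrict_space nn_integral_completion intro!: measurable_restrict_space1 measurable_completion)

text \<open>
  By \<open>weighted_power_mean\<close>, \<open>|X z| powr p\<close> is at most a constant times \<open>(1 - |z|\<^sup>2) powr (\<beta> p)\<close> times 1 plus
  the integral of \<open>|cis t - z| powr - (\<beta> + 1) * \<psi> t powr p\<close>; integrating over \<open>z\<close> first, the area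
  integral is bounded uniformly in \<open>t\<close>.
\<close>

lemma disc_Lp_finite:
  fixes X :: "complex \<Rightarrow> complex" and \<psi> :: "real \<Rightarrow> real"
  assumes \<beta>: "-1 < \<beta>" "\<beta> < 0" and p: "1 \<le> p" "-1 < \<beta> * p" and c: "c > 0"
    and [measurable]: "\<psi> \<in> borel_measurable borel" and \<psi>: "\<And>t. \<psi> t \<ge> 0"
      "(\<integral>\<^sup>+t. ennreal (\<psi> t powr p) * indicator {0..2*pi} t \<partial>lborel) < \<infinity>"
    and X: "\<And>z. z \<in> ball 0 1 \<Longrightarrow> ennreal (norm (X z)) \<le> ennreal (c * (1 - (norm z)\<^sup>2) powr \<beta>) *
       (\<integral>\<^sup>+t. ennreal (norm (cis t - z) powr - (\<beta> + 1) * \<psi> t) * indicator {0..2*pi} t \<partial>lborel)"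
  shows "(\<integral>\<^sup>+z. ennreal (norm (X z) powr p) \<partial>disc_measure) < \<infinity>"
proof -
  define b q where "b = \<beta> + 1" and "q = \<beta> * p"
  have b: "0 < b" "b < 1" and q: "-1 < q" "q \<le> 0"
    using \<beta> p by (auto simp: b_def q_def mult_nonpos_nonneg)
  obtain B where B: "B > 0"
    "\<And>w. (\<integral>\<^sup>+t. ennreal (norm (cis t - w) powr - b) * indicator {0..2*pi} t \<partial>lborel) \<le> ennreal B"
    using kernel_mean_bounded[OF b] by blast
  obtain I where I: "I \<ge> 0" "\<And>t. (\<integral>\<^sup>+z. ennreal ((1 - (norm z)\<^sup>2) powr q * norm (cis t - z) powr - b) * indicator (ball 0 1) z \<partial>lborel) \<le> ennreal I"
    using disc_kernel_bounded[OF b q] by blast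
  define J where "J z = (\<integral>\<^sup>+t. ennreal (norm (cis t - z) powr - b * \<psi> t powr p) * indicator {0..2*pi} t \<partial>lborel)" for z
  have [measurable]: "J \<in> borel_measurable borel"
    unfolding J_def by measurable
  have [measurable]: "Measurable.pred borel (\<lambda>z. z \<in> ball (0 :: complex) 1)"
    unfolding mem_ball by measurable
  define C where "C = c powr p * (1 + B) powr p"
  have pw: "ennreal (norm (X z) powr p) \<le> ennreal (C * (1 - (norm z)\<^sup>2) powr q) * (1 + J z)" if z: "z \<in> ball 0 1" for z
  proof -
    define d where "d = c * (1 - (norm z)\<^sup>2) powr \<beta>"
    have dz: "1 - (norm z)\<^sup>2 > 0" using z by (simp add: abs_square_less_1)
    have d: "d > 0" using dz c by (simp add: d_def)
    let ?M = "restrict_space lborel {0..2*pi}"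
    have res: "(\<integral>\<^sup>+t. f t \<partial>?M) = (\<integral>\<^sup>+t. f t * indicator {0..2*pi} t \<partial>lborel)" for f :: "real \<Rightarrow> ennreal"
      by (simp add: nn_integral_restrict_space)
    have "ennreal ((norm (X z) / d) powr p) \<le> ennreal ((1 + B) powr p) * (1 + (\<integral>\<^sup>+t. ennreal (norm (cis t - z) powr - b * \<psi> t powr p) \<partial>?M))"
    proof (rule weighted_power_mean)
      show "(\<lambda>t. norm (cis t - z) powr - b) \<in> borel_measurable ?M" "\<psi> \<in> borel_measurable ?M"
        by (intro measurable_restrict_space1, measurable)+
      show "(\<integral>\<^sup>+t. ennreal (norm (cis t - z) powr - b) \<partial>?M) \<le> ennreal B" unfolding res by (rule B)
      have "ennreal (norm (X z)) \<le> ennreal d * (\<integral>\<^sup>+t. ennreal (norm (cis t - z) powr - b * \<psi> t) \<partial>?M)"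
        using X[OF z] unfolding res b_def d_def .
      hence "ennreal (1 / d) * ennreal (norm (X z)) \<le> ennreal (1 / d) * (ennreal d * (\<integral>\<^sup>+t. ennreal (norm (cis t - z) powr - b * \<psi> t) \<partial>?M))"
        by (rule mult_left_mono) auto
      also have "\<dots> = (\<integral>\<^sup>+t. ennreal (norm (cis t - z) powr - b * \<psi> t) \<partial>?M)"
        using d by (simp flip: mult.assoc ennreal_mult)
      also have "ennreal (1 / d) * ennreal (norm (X z)) = ennreal (norm (X z) / d)"
        using d by (simp flip: ennreal_mult)
      finally show "ennreal (norm (X z) / d) \<le> (\<integral>\<^sup>+t. ennreal (norm (cis t - z) powr - b * \<psi> t) \<partial>?M)" .
    qed (use \<psi> p B d in auto)
    hence "ennreal (d powr p) * ennreal ((norm (X z) / d) powr p) \<le> ennreal (d powr p) * (ennreal ((1 + B) powr p) * (1 + J z))"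
      unfolding res J_def[symmetric] by (rule mult_left_mono) auto
    also have "ennreal (d powr p) * ennreal ((norm (X z) / d) powr p) = ennreal (norm (X z) powr p)"
      using d by (simp add: powr_divide flip: ennreal_mult)
    also have "ennreal (d powr p) * (ennreal ((1 + B) powr p) * (1 + J z)) = ennreal (d powr p * (1 + B) powr p) * (1 + J z)"
      by (simp add: ennreal_mult mult.assoc)
    also have "d powr p * (1 + B) powr p = C * (1 - (norm z)\<^sup>2) powr q"
      using dz c by (simp add: d_def C_def q_def powr_mult powr_powr)
    finally show ?thesis .
  qed
  have "(\<integral>\<^sup>+z. ennreal (norm (X z) powr p) \<partial>disc_measure) \<le> (\<integral>\<^sup>+z. ennreal (C * (1 - (norm z)\<^sup>2) powr q) * (1 + J z) \<partial>disc_measure)"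
    by (intro nn_integral_mono pw) (simp add: disc_measure_def space_scale_measure space_restrict_space)
  also have "\<dots> = ennreal (1 / pi) * (\<integral>\<^sup>+z. ennreal (C * (1 - (norm z)\<^sup>2) powr q) * (1 + J z) * indicator (ball 0 1) z \<partial>lborel)"
    by (rule nn_integral_disc_measure) measurable
  also have "(\<integral>\<^sup>+z. ennreal (C * (1 - (norm z)\<^sup>2) powr q) * (1 + J z) * indicator (ball 0 1) z \<partial>lborel) =
     (\<integral>\<^sup>+z. ennreal C * (ennreal ((1 - (norm z)\<^sup>2) powr q) * indicator (ball 0 1) z) +
        ennreal C * (ennreal ((1 - (norm z)\<^sup>2) powr q) * J z * indicator (ball 0 1) z) \<partial>lborel)"
    by (intro nn_integral_cong) (auto simp: C_def ennreal_mult distrib_left distrib_right mult_ac split: split_indicator)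
  also have "\<dots> = ennreal C * (\<integral>\<^sup>+z. ennreal ((1 - (norm z)\<^sup>2) powr q) * indicator (ball 0 1) z \<partial>(lborel :: complex measure)) +
     ennreal C * (\<integral>\<^sup>+z. ennreal ((1 - (norm z)\<^sup>2) powr q) * J z * indicator (ball 0 1) z \<partial>lborel)"
  proof -
    have m1: "(\<lambda>z::complex. ennreal ((1 - (norm z)\<^sup>2) powr q) * indicator (ball 0 1) z) \<in> borel_measurable lborel"
      by measurable
    have m2: "(\<lambda>z::complex. ennreal ((1 - (norm z)\<^sup>2) powr q) * J z * indicator (ball 0 1) z) \<in> borel_measurable lborel"
      by measurable
    show ?thesis
      unfolding nn_integral_cmult[OF m1, symmetric] nn_integral_cmult[OF m2, symmetric]
      by (intro nn_integral_add borel_measurable_times m1 m2) auto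
  qed
  also have "(\<integral>\<^sup>+z. ennreal ((1 - (norm z)\<^sup>2) powr q) * J z * indicator (ball 0 1) z \<partial>lborel) =
     (\<integral>\<^sup>+z. (\<integral>\<^sup>+t. ennreal ((1 - (norm z)\<^sup>2) powr q * norm (cis t - z) powr - b) * indicator (ball 0 1) z *
        (ennreal (\<psi> t powr p) * indicator {0..2*pi} t) \<partial>lborel) \<partial>lborel)"
    unfolding J_def
    by (intro nn_integral_cong, subst nn_integral_cmult[symmetric])
       (auto intro!: nn_integral_cong simp: ennreal_mult mult_ac split: split_indicator)
  also have "\<dots> = (\<integral>\<^sup>+t. (\<integral>\<^sup>+z. ennreal ((1 - (norm z)\<^sup>2) powr q * norm (cis t - z) powr - b) * indicator (ball 0 1) z *
        (ennreal (\<psi> t powr p) * indicator {0..2*pi} t) \<partial>lborel) \<partial>lborel)"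
    by (rule lborel_pair.Fubini') measurable
  also have "\<dots> = (\<integral>\<^sup>+t. (\<integral>\<^sup>+z. ennreal ((1 - (norm z)\<^sup>2) powr q * norm (cis t - z) powr - b) * indicator (ball 0 1) z \<partial>lborel) *
        (ennreal (\<psi> t powr p) * indicator {0..2*pi} t) \<partial>lborel)"
    by (intro nn_integral_cong nn_integral_multc) measurable
  also have "\<dots> \<le> (\<integral>\<^sup>+t. ennreal I * (ennreal (\<psi> t powr p) * indicator {0..2*pi} t) \<partial>lborel)"
    by (intro nn_integral_mono mult_right_mono I) auto
  also have "\<dots> = ennreal I * (\<integral>\<^sup>+t. ennreal (\<psi> t powr p) * indicator {0..2*pi} t \<partial>lborel)"
    by (rule nn_integral_cmult) measurable
  finally have "(\<integral>\<^sup>+z. ennreal (norm (X z) powr p) \<partial>disc_measure) \<le> ennreal (1 / pi) *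
     (ennreal C * (\<integral>\<^sup>+z. ennreal ((1 - (norm z)\<^sup>2) powr q) * indicator (ball 0 1) z \<partial>(lborel :: complex measure)) +
      ennreal C * (ennreal I * (\<integral>\<^sup>+t. ennreal (\<psi> t powr p) * indicator {0..2*pi} t \<partial>lborel)))"
    by (simp add: add_left_mono mult_left_mono)
  also have "\<dots> < \<infinity>"
    using nn_integral_disc_powr_finite[OF q] \<psi>(2) by (simp add: ennreal_mult_less_top)
  finally show ?thesis .
qed

section \<open>Partial derivatives of the Poisson type integral\<close>

lemma borel_measurable_cis_Arg [measurable]: "(\<lambda>z. cis (Arg z)) \<in> borel_measurable borel"
proof -
  have "(\<lambda>z. cis (Arg z)) = (\<lambda>z. if z = 0 then 1 else z /\<^sub>R norm z)"
    by (auto simp: fun_eq_iff cis_Arg sgn_div_norm Arg_zero)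
  thus ?thesis by simp
qed

lemma Bergman_G_I:
  assumes f: "continuous_on (ball 0 1) fx" "continuous_on (ball 0 1) fy"
    and eq: "\<And>z. z \<in> ball 0 1 \<Longrightarrow> X z = a z * fx z + b z * fy z"
    and [measurable]: "a \<in> borel_measurable borel" "b \<in> borel_measurable borel"
    and fin: "(\<integral>\<^sup>+z. ennreal (norm (X z) powr p) \<partial>disc_measure) < \<infinity>"
  shows "X \<in> Bergman_G p"
proof -
  have cont: "h \<in> borel_measurable (lebesgue_on (ball 0 1))" if "continuous_on (ball 0 1) h" for h :: "complex \<Rightarrow> complex"
    using that by (intro continuous_imp_measurable_on_sets_lebesgue) auto
  have borel: "h \<in> borel_measurable (lebesgue_on (ball 0 1))" if "h \<in> borel_measurable borel" for h :: "complex \<Rightarrow> complex"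
    using that by (intro measurable_restrict_space1 measurable_completion) simp
  have "(\<lambda>z. a z * fx z + b z * fy z) \<in> borel_measurable (lebesgue_on (ball 0 1))"
    by (intro borel_measurable_add borel_measurable_times cont[OF f(1)] cont[OF f(2)] borel assms(4,5))
  moreover have "X \<in> borel_measurable (lebesgue_on (ball 0 1)) \<longleftrightarrow>
      (\<lambda>z. a z * fx z + b z * fy z) \<in> borel_measurable (lebesgue_on (ball 0 1))"
    by (rule measurable_cong) (simp add: eq space_restrict_space)
  ultimately have "X \<in> borel_measurable (lebesgue_on (ball 0 1))" by simp
  moreover have "borel_measurable disc_measure = (borel_measurable (lebesgue_on (ball 0 1)) :: (complex \<Rightarrow> complex) set)"
    unfolding disc_measure_def by (rule measurable_cong_sets) auto
  ultimately show ?thesis using fin by (simp add: Bergman_G_def)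
qed

theorem corollary1p3:
  fixes \<alpha> p :: real and F f :: "complex \<Rightarrow> complex"
  assumes "(\<alpha>, p) \<in> Pi2"
    and "absolutely_continuous_circle F"
    and "circle_deriv F \<in> Lp_circle p"
    and "\<And>z. z \<in> ball 0 1 \<Longrightarrow> f z = K_integral \<alpha> F z"
  shows "(\<forall>z \<in> ball 0 1. has_partials_at f z) \<and>
    partial_r f \<in> Bergman_G p \<and> partial_z f \<in> Bergman_G p \<and> partial_zbar f \<in> Bergman_G p"
proof -
  define \<phi> where "\<phi> t = F (cis t)" for t
  have AC: "AC_on 0 (2*pi) \<phi>"
    using assms(2) unfolding absolutely_continuous_circle_def \<phi>_def by (rule absolutely_continuous_fun_imp_AC_on)
  have cont: "continuous_on {0..2*pi} \<phi>" by (rule AC_on_imp_continuous[OF AC])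
  have period: "\<phi> (2*pi) = \<phi> 0" by (simp add: \<phi>_def)
  have "bounded (\<phi> ` {0..2*pi})" by (intro compact_imp_bounded compact_continuous_image cont compact_Icc)
  then obtain M where M: "M > 0" "\<And>t. t \<in> {0..2*pi} \<Longrightarrow> norm (\<phi> t) \<le> M"
    unfolding bounded_pos by blast
  obtain g where g: "integrable lborel g"
      "AE t in lborel. t \<in> {0<..<2*pi} \<longrightarrow> (\<phi> has_vector_derivative g t) (at t)"
    using AC_on_FTC[OF AC] by (metis pi_gt_zero zero_less_mult_iff zero_less_numeral)
  have [measurable]: "g \<in> borel_measurable borel" using g(1) by auto
  \<comment> \<open>for \<open>\<alpha> = 0\<close> and \<open>p = 1\<close> any exponent strictly between \<open>-1\<close> and 0 would do\<close>
  define \<beta> where "\<beta> = (if \<alpha> < 0 then \<alpha> else - 1 / 2)"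
  have \<beta>: "-1 < \<beta>" "\<beta> < 0" "\<beta> \<le> \<alpha>" "\<alpha> \<le> \<beta> + 1" and p: "1 \<le> p" "-1 < \<beta> * p"
  proof -
    have "-1 < \<beta> * p \<and> -1 < \<beta> \<and> \<beta> < 0 \<and> \<beta> \<le> \<alpha> \<and> \<alpha> \<le> \<beta> + 1 \<and> 1 \<le> p"
    proof (cases "\<alpha> < 0")
      case True
      hence *: "-1 < \<alpha>" "1 \<le> p" "p < - 1 / \<alpha>" using assms(1) by (auto simp: Pi2_def)
      hence "-1 < \<alpha> * p" using True by (simp add: field_simps)
      thus ?thesis using True * by (simp add: \<beta>_def)
    next
      case False
      hence "\<alpha> = 0" "p = 1" using assms(1) by (auto simp: Pi2_def)
      thus ?thesis by (simp add: \<beta>_def)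
    qed
    thus "-1 < \<beta>" "\<beta> < 0" "\<beta> \<le> \<alpha>" "\<alpha> \<le> \<beta> + 1" "1 \<le> p" "-1 < \<beta> * p" by auto
  qed
  define c0 where "c0 = complex_of_real (C_const \<alpha> / (2 * pi))"
  define G where "G u z = c0 * kernel_deriv_integral \<alpha> \<phi> u z" for u z
  have f_eq: "f z = c0 * kernel_integral \<alpha> \<phi> z" if "z \<in> ball 0 1" for z
    using K_integral_eq_kernel_integral[of z F \<alpha>] assms(4)[OF that] that cont
    by (simp add: c0_def \<phi>_def[abs_def])
  have dir: "((\<lambda>x. f (z + of_real (x - r) * u)) has_vector_derivative G u z) (at r)" if z: "z \<in> ball 0 1" for z u r
  proof -
    have "((\<lambda>s. c0 * kernel_integral \<alpha> \<phi> (z + of_real s * u)) has_vector_derivative G u z) (at (r - r))"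
      unfolding G_def using has_vector_derivative_kernel_integral[OF _ cont] z
      by (intro has_vector_derivative_mult_right) simp
    moreover have "((\<lambda>x. x - r) has_vector_derivative 1) (at r)" by (auto intro!: derivative_eq_intros)
    ultimately have "((\<lambda>s. c0 * kernel_integral \<alpha> \<phi> (z + of_real s * u)) \<circ> (\<lambda>x. x - r) has_vector_derivative 1 *\<^sub>R G u z) (at r)"
      by (intro vector_diff_chain_at)
    hence D: "((\<lambda>x. c0 * kernel_integral \<alpha> \<phi> (z + of_real (x - r) * u)) has_vector_derivative G u z) (at r)"
      by (simp add: o_def)
    define U where "U = {x. z + of_real (x - r) * u \<in> ball 0 1}"
    have "open U" unfolding U_def vimage_def[symmetric]
      by (intro open_vimage continuous_intros) auto
    moreover have "r \<in> U" using z by (simp add: U_def)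
    ultimately show ?thesis
      by (rule has_vector_derivative_transform_within_open[OF D]) (simp add: U_def f_eq)
  qed
  have dx: "((\<lambda>x. f (Complex x (Im z))) has_vector_derivative G 1 z) (at (Re z))" if "z \<in> ball 0 1" for z
  proof -
    have "z + of_real (x - Re z) * 1 = Complex x (Im z)" for x by (simp add: complex_eq_iff)
    thus ?thesis using dir[OF that, of "Re z" 1] by simp
  qed
  have dy: "((\<lambda>y. f (Complex (Re z) y)) has_vector_derivative G \<i> z) (at (Im z))" if "z \<in> ball 0 1" for z
  proof -
    have "z + of_real (y - Im z) * \<i> = Complex (Re z) y" for y by (simp add: complex_eq_iff)
    thus ?thesis using dir[OF that, of "Im z" \<i>] by simp
  qed
  have partials: "has_partials_at f z" "partial_x f z = G 1 z" "partial_y f z = G \<i> z" if "z \<in> ball 0 1" for z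
    using dx[OF that] dy[OF that] unfolding has_partials_at_def partial_x_def partial_y_def
    by (auto intro: differentiableI_vector vector_derivative_at)
  have cG: "continuous_on (ball 0 1) (G u)" for u
    unfolding G_def[abs_def] by (intro continuous_intros continuous_on_kernel_deriv_integral cont)
  define \<psi> where "\<psi> t = 2 * norm (g t) + \<bar>\<alpha>\<bar> * M" for t
  have [measurable]: "\<psi> \<in> borel_measurable borel" unfolding \<psi>_def by measurable
  have \<psi>_nn: "\<psi> t \<ge> 0" for t using M(1) by (simp add: \<psi>_def)
  \<comment> \<open>two directions with a factor 2 each; adding 1 makes it positive\<close>
  define c where "c = 4 * norm c0 + 1"
  have c_pos: "c > 0" by (simp add: c_def add_nonneg_pos)
  have bound: "ennreal (norm (G 1 z) + norm (G \<i> z)) \<le> ennreal (c * (1 - (norm z)\<^sup>2) powr \<beta>) *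
       (\<integral>\<^sup>+t. ennreal (norm (cis t - z) powr - (\<beta> + 1) * \<psi> t) * indicator {0..2*pi} t \<partial>lborel)" (is "_ \<le> _ * ?J")
    if z: "z \<in> ball 0 1" for z
  proof -
    define d where "d = (1 - (norm z)\<^sup>2) powr \<beta>"
    have d: "d \<ge> 0" by (simp add: d_def)
    have 1: "ennreal (norm (G u z)) \<le> ennreal (norm c0 * (2 * d)) * ?J" if "norm u = 1" for u
    proof -
      have "ennreal (norm (G u z)) = ennreal (norm c0) * ennreal (norm (kernel_deriv_integral \<alpha> \<phi> u z))"
        by (simp add: G_def norm_mult ennreal_mult)
      also have "\<dots> \<le> ennreal (norm c0) * (ennreal (2 * d) * ?J)"
        unfolding d_def \<psi>_def using z that
        by (intro mult_left_mono norm_kernel_deriv_integral_le \<beta> AC period M g) auto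
      finally show ?thesis using d by (simp add: ennreal_mult mult.assoc)
    qed
    have "ennreal (norm (G 1 z) + norm (G \<i> z)) \<le> ennreal (norm c0 * (2 * d)) * ?J + ennreal (norm c0 * (2 * d)) * ?J"
      using add_mono[OF 1[of 1] 1[of \<i>]] by simp
    also have "\<dots> = ennreal (norm c0 * (2 * d) + norm c0 * (2 * d)) * ?J"
    proof -
      have "ennreal x * j + ennreal x * j = ennreal (x + x) * j" if "x \<ge> 0" for x and j :: ennreal
        using that by (simp only: ennreal_plus distrib_right)
      from this[of "norm c0 * (2 * d)" ?J] show ?thesis using d by auto
    qed
    also have "\<dots> \<le> ennreal (c * d) * ?J"
      using d by (intro mult_right_mono ennreal_leI) (auto simp: c_def algebra_simps)
    finally show ?thesis by (simp add: d_def)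
  qed
  have \<psi>_fin: "(\<integral>\<^sup>+t. ennreal (\<psi> t powr p) * indicator {0..2*pi} t \<partial>lborel) < \<infinity>"
  proof -
    have "finite {0, 2 * pi}" by simp
    hence "AE t in lborel. t \<notin> {0, 2 * pi}" by (intro AE_not_in finite_imp_null_set_lborel)
    hence "AE t in lborel. t \<in> {0..2*pi} \<longrightarrow> g t = circle_deriv F (cis t)"
      using g(2)
    proof eventually_elim
      case (elim t)
      show ?case
      proof
        assume "t \<in> {0..2*pi}"
        hence "(\<phi> has_vector_derivative g t) (at t)" using elim by auto
        thus "g t = circle_deriv F (cis t)"
          by (simp add: circle_deriv_cis \<phi>_def[abs_def] vector_derivative_at)
      qed
    qed
    hence ae: "AE t in lebesgue. t \<in> {0..2*pi} \<longrightarrow> g t = circle_deriv F (cis t)" by (rule AE_completion)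
    have "(\<integral>\<^sup>+t. ennreal (norm (g t) powr p) * indicator {0..2*pi} t \<partial>lborel) =
        (\<integral>\<^sup>+t. ennreal (norm (g t) powr p) * indicator {0..2*pi} t \<partial>lebesgue)"
      by (rule nn_integral_completion[symmetric]) measurable
    also have "\<dots> = (\<integral>\<^sup>+t. ennreal (norm (circle_deriv F (cis t)) powr p) * indicator {0..2*pi} t \<partial>lebesgue)"
      using ae by (intro nn_integral_cong_AE, eventually_elim) (auto split: split_indicator)
    also have "\<dots> = (\<integral>\<^sup>+t. ennreal (norm (circle_deriv F (cis t)) powr p) \<partial>lebesgue_on {0..2*pi})"
      by (simp add: nn_integral_restrict_space)
    also have "\<dots> < \<infinity>" using assms(3) by (simp add: Lp_circle_def)
    finally have gp: "(\<integral>\<^sup>+t. ennreal (norm (g t) powr p) * indicator {0..2*pi} t \<partial>lborel) < \<infinity>" .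
    define k where "k = (2 * \<bar>\<alpha>\<bar> * M) powr p"
    have "\<psi> t powr p \<le> 4 powr p * norm (g t) powr p + k" for t
    proof -
      have "\<psi> t \<le> max (4 * norm (g t)) (2 * \<bar>\<alpha>\<bar> * M)" by (simp add: \<psi>_def)
      hence "\<psi> t powr p \<le> max (4 * norm (g t)) (2 * \<bar>\<alpha>\<bar> * M) powr p"
        using \<psi>_nn p by (intro powr_mono2) auto
      also have "\<dots> \<le> (4 * norm (g t)) powr p + (2 * \<bar>\<alpha>\<bar> * M) powr p" by (simp add: max_def)
      also have "\<dots> = 4 powr p * norm (g t) powr p + k" by (simp add: k_def powr_mult)
      finally show ?thesis .
    qed
    note le = this
    have "ennreal (\<psi> t powr p) \<le> ennreal (4 powr p) * ennreal (norm (g t) powr p) + ennreal k" for t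
      using ennreal_leI[OF le[of t]] by (simp add: k_def ennreal_mult ennreal_plus)
    hence "(\<integral>\<^sup>+t. ennreal (\<psi> t powr p) * indicator {0..2*pi} t \<partial>lborel) \<le>
       (\<integral>\<^sup>+t. ennreal (4 powr p) * (ennreal (norm (g t) powr p) * indicator {0..2*pi} t) + ennreal k * indicator {0..2*pi} t \<partial>lborel)"
      by (intro nn_integral_mono) (auto split: split_indicator)
    also have "\<dots> = ennreal (4 powr p) * (\<integral>\<^sup>+t. ennreal (norm (g t) powr p) * indicator {0..2*pi} t \<partial>lborel)
       + ennreal k * emeasure lborel {0..2*pi}"
      by (simp add: nn_integral_add nn_integral_cmult nn_integral_cmult_indicator)
    also have "\<dots> < \<infinity>" using gp by (simp add: ennreal_mult_less_top)
    finally show ?thesis .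
  qed
  have Bergman: "X \<in> Bergman_G p"
    if eq: "\<And>z. z \<in> ball 0 1 \<Longrightarrow> X z = a z * G 1 z + b z * G \<i> z"
      and meas: "a \<in> borel_measurable borel" "b \<in> borel_measurable borel"
      and le: "\<And>z. norm (a z) \<le> 1" "\<And>z. norm (b z) \<le> 1" for X a b
  proof (rule Bergman_G_I[OF cG cG eq meas])
    show "(\<integral>\<^sup>+z. ennreal (norm (X z) powr p) \<partial>disc_measure) < \<infinity>"
    proof (rule disc_Lp_finite[OF \<beta>(1,2) p c_pos _ \<psi>_nn \<psi>_fin])
      fix z :: complex assume z: "z \<in> ball 0 1"
      have "norm (X z) \<le> norm (a z) * norm (G 1 z) + norm (b z) * norm (G \<i> z)"
        using norm_triangle_ineq[of "a z * G 1 z" "b z * G \<i> z"] by (simp add: eq[OF z] norm_mult)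
      also have "\<dots> \<le> 1 * norm (G 1 z) + 1 * norm (G \<i> z)"
        by (intro add_mono mult_right_mono le) auto
      finally have "ennreal (norm (X z)) \<le> ennreal (norm (G 1 z) + norm (G \<i> z))" by (intro ennreal_leI) simp
      thus "ennreal (norm (X z)) \<le> ennreal (c * (1 - (norm z)\<^sup>2) powr \<beta>) *
          (\<integral>\<^sup>+t. ennreal (norm (cis t - z) powr - (\<beta> + 1) * \<psi> t) * indicator {0..2*pi} t \<partial>lborel)"
        using bound[OF z] by (rule order.trans)
    qed measurable
  qed
  have "partial_z f \<in> Bergman_G p"
    by (rule Bergman[of _ "\<lambda>_. 1 / 2" "\<lambda>_. - \<i> / 2"]) (auto simp: partial_z_def partials field_simps norm_divide)
  moreover have "partial_zbar f \<in> Bergman_G p"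
    by (rule Bergman[of _ "\<lambda>_. 1 / 2" "\<lambda>_. \<i> / 2"]) (auto simp: partial_zbar_def partials field_simps norm_divide)
  moreover have "partial_r f \<in> Bergman_G p"
  \<comment> \<open>the radial derivative is \<open>cos \<theta> \<partial>\<^sub>x f + sin \<theta> \<partial>\<^sub>y f\<close> with \<open>\<theta> = Arg z\<close>\<close>
  proof (rule Bergman[of _ "\<lambda>z. of_real (Re (cis (Arg z)))" "\<lambda>z. of_real (Im (cis (Arg z)))"])
    fix z :: complex assume z: "z \<in> ball 0 1"
    have "cis (Arg z) = of_real (Re (cis (Arg z))) + \<i> * of_real (Im (cis (Arg z)))" by (rule complex_eq)
    moreover have "cis (- Arg z) = of_real (Re (cis (Arg z))) - \<i> * of_real (Im (cis (Arg z)))"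
      by (simp add: complex_eq_iff)
    ultimately show "partial_r f z = of_real (Re (cis (Arg z))) * G 1 z + of_real (Im (cis (Arg z))) * G \<i> z"
      unfolding partial_r_def partial_z_def partial_zbar_def partials(2,3)[OF z]
      by (simp only:) (simp add: field_simps)
  next
    show "(\<lambda>z. complex_of_real (Re (cis (Arg z)))) \<in> borel_measurable borel" by measurable
    show "(\<lambda>z. complex_of_real (Im (cis (Arg z)))) \<in> borel_measurable borel" by measurable
  qed (auto simp del: cis.simps simp: abs_Re_le_cmod[THEN order.trans] abs_Im_le_cmod[THEN order.trans])
  ultimately show ?thesis using partials(1) by blast
qed

end
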